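(* Let $d\ge 2$ and $D\ge 1$ be integers, let $G=(V,E)$ be a $D$-regular graph with $n=|V|$ vertices, identified with $[n]$, and let $\rho=\rho^{Q_1\cdots Q_n}$ be a quantum state on $n$ qudits $Q_1,\ldots,Q_n$, each of dimension $d$ (i.e. a density matrix on $(\mathbb{C}^d)^{\otimes n}$). Then there exists a globally separable state $\sigma$ on $(\mathbb{C}^d)^{\otimes n}$ such that $$\mathbb{E}_{(i,j)\in E}\,\big\|\rho^{Q_iQ_j}-\sigma^{Q_iQ_j}\big\|_1\le 12\left(\frac{d^2\ln(d)}{D}\right)^{1/3}.$$
   Context: A quantum state (density matrix) is a positive semidefinite matrix of unit trace. For a state $\rho$ on $Q_1\cdots Q_n$, $\rho^{Q_iQ_j}$ denotes its reduced state (partial trace over all systems other than $Q_i,Q_j$). $\|X\|_1=\operatorname{tr}\sqrt{X^\dagger X}$ is the trace norm. A state $\sigma$ is globally separable if $\sigma=\sum_z p_z\,\sigma_z^{Q_1}\otimes\cdots\otimes\sigma_z^{Q_n}$ for a probability distribution $(p_z)$ and single-qudit states $\sigma_z^{Q_i}$. $\mathbb{E}_{(i,j)\in E}$ denotes the average over a uniformly random edge of $G$. *)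

theory Defs
  imports Complex_Main
begin

(* Matrices over a finite index set S are functions 'a => 'a => complex;
   only entries on S x S matter. *)

definition mat_on :: "'a set \<Rightarrow> ('a \<Rightarrow> 'a \<Rightarrow> complex) \<Rightarrow> bool" where
  "mat_on S A \<longleftrightarrow> (\<forall>x y. (x \<notin> S \<or> y \<notin> S) \<longrightarrow> A x y = 0)"

definition mmult :: "'a set \<Rightarrow> ('a \<Rightarrow> 'a \<Rightarrow> complex) \<Rightarrow> ('a \<Rightarrow> 'a \<Rightarrow> complex) \<Rightarrow> ('a \<Rightarrow> 'a \<Rightarrow> complex)" where
  "mmult S A B = (\<lambda>x y. if x \<in> S \<and> y \<in> S then (\<Sum>z\<in>S. A x z * B z y) else 0)"

definition adjoint :: "('a \<Rightarrow> 'a \<Rightarrow> complex) \<Rightarrow> ('a \<Rightarrow> 'a \<Rightarrow> complex)" where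
  "adjoint A = (\<lambda>x y. cnj (A y x))"

definition mtrace :: "'a set \<Rightarrow> ('a \<Rightarrow> 'a \<Rightarrow> complex) \<Rightarrow> complex" where
  "mtrace S A = (\<Sum>x\<in>S. A x x)"

definition psd_on :: "'a set \<Rightarrow> ('a \<Rightarrow> 'a \<Rightarrow> complex) \<Rightarrow> bool" where
  "psd_on S A \<longleftrightarrow> (\<forall>v :: 'a \<Rightarrow> complex.
      Im (\<Sum>x\<in>S. \<Sum>y\<in>S. cnj (v x) * A x y * v y) = 0 \<and>
      Re (\<Sum>x\<in>S. \<Sum>y\<in>S. cnj (v x) * A x y * v y) \<ge> 0)"

definition density_on :: "'a set \<Rightarrow> ('a \<Rightarrow> 'a \<Rightarrow> complex) \<Rightarrow> bool" where
  "density_on S A \<longleftrightarrow> psd_on S A \<and> mtrace S A = 1"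

definition psd_sqrt :: "'a set \<Rightarrow> ('a \<Rightarrow> 'a \<Rightarrow> complex) \<Rightarrow> ('a \<Rightarrow> 'a \<Rightarrow> complex)" where
  "psd_sqrt S A = (THE B. mat_on S B \<and> psd_on S B \<and> mmult S B B = A)"

definition trace_norm :: "'a set \<Rightarrow> ('a \<Rightarrow> 'a \<Rightarrow> complex) \<Rightarrow> real" where
  "trace_norm S X = Re (mtrace S (psd_sqrt S (mmult S (adjoint X) X)))"

(* computational basis of (C^d)^{\<otimes> n}: strings x with x i < d for i < n (and 0 beyond) *)
definition cfg :: "nat \<Rightarrow> nat \<Rightarrow> (nat \<Rightarrow> nat) set" where
  "cfg n d = {x. (\<forall>i<n. x i < d) \<and> (\<forall>i\<ge>n. x i = 0)}"

(* basis of C^d \<otimes> C^d *)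
definition pairs :: "nat \<Rightarrow> (nat \<times> nat) set" where
  "pairs d = {..<d} \<times> {..<d}"

(* reduced state rho^{Q_i Q_j}: partial trace over all qudits other than i, j *)
definition reduced :: "nat \<Rightarrow> nat \<Rightarrow> ((nat \<Rightarrow> nat) \<Rightarrow> (nat \<Rightarrow> nat) \<Rightarrow> complex)
    \<Rightarrow> nat \<Rightarrow> nat \<Rightarrow> (nat \<times> nat) \<Rightarrow> (nat \<times> nat) \<Rightarrow> complex" where
  "reduced n d \<rho> i j = (\<lambda>(a, b) (a', b').
     if (a, b) \<in> pairs d \<and> (a', b') \<in> pairs d then
       (\<Sum>x\<in>cfg n d. \<Sum>y\<in>cfg n d.
          if x i = a \<and> x j = b \<and> y i = a' \<and> y j = b' \<and> (\<forall>k. k \<noteq> i \<and> k \<noteq> j \<longrightarrow> x k = y k)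
          then \<rho> x y else 0)
     else 0)"

definition glob_separable :: "nat \<Rightarrow> nat \<Rightarrow> ((nat \<Rightarrow> nat) \<Rightarrow> (nat \<Rightarrow> nat) \<Rightarrow> complex) \<Rightarrow> bool" where
  "glob_separable n d \<sigma> \<longleftrightarrow>
     (\<exists>(m::nat) (p :: nat \<Rightarrow> real) (s :: nat \<Rightarrow> nat \<Rightarrow> nat \<Rightarrow> nat \<Rightarrow> complex).
        (\<forall>z<m. p z \<ge> 0) \<and> (\<Sum>z<m. p z) = 1 \<and>
        (\<forall>z<m. \<forall>i<n. density_on {..<d} (s z i)) \<and>
        \<sigma> = (\<lambda>x y. if x \<in> cfg n d \<and> y \<in> cfg n d
                 then (\<Sum>z<m. complex_of_real (p z) * (\<Prod>i<n. s z i (x i) (y i)))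
                 else 0))"

end

theory Submission
  imports "HOL-Analysis.Analysis" Defs
begin

text \<open>Measure every site in a set \<open>C\<close> with a complex projective 2-design and let \<open>\<sigma>\<close> be the mixture,
  over the outcomes, of the products of the conditional single-site states. For sites
  \<open>i, j \<notin> C\<close> the conditional correlation between \<open>i\<close> and \<open>j\<close> is, up to a factor \<open>d + 1\<close> coming from
  inverting the design measurement on \<open>j\<close>, the average change of the state of \<open>i\<close> when \<open>j\<close> is
  measured too, and a Pinsker-type inequality bounds this change by the drop of the conditional entropy
  of \<open>i\<close>. A set \<open>C\<close> minimising the total conditional entropy of the unmeasured sites plus a penalty
  \<open>ln d / \<kappa>\<close> per measured site, with \<open>\<kappa> = (d\<^sup>2 ln d / D)\<^bsup>1/3\<^esup>\<close>, has at most \<open>\<kappa> n\<close> elements, and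
  measuring one more site lowers the total by at most the penalty. Edges meeting \<open>C\<close> then
  contribute \<open>4 \<kappa>\<close> to the average and the other edges \<open>3 \<kappa>\<close>.\<close>

section \<open>The spectral theorem over a finite index set\<close>

text \<open>The gain of \<open>1 / D\<close> comes from comparing two counts: the entropy drops of
  \<open>i\<close> caused by measuring \<open>j\<close>, summed over all ordered pairs and not only
  over edges, are at most \<open>n * lam\<close>, whereas there are \<open>D * n\<close> ordered
  edges. With \<open>L = ln d\<close>, an average edge therefore sees a drop of at most
  \<open>L / (\<kappa> * D)\<close>, and optimising \<open>(d + 1) * (c + drop / c)\<close> over
  \<open>c\<close> gives the order \<open>d * sqrt (L / (\<kappa> * D))\<close>. Equating this with
  the fraction \<kappa> of measured sites produces the cube root. A design suits the purpose because
  its inversion formula consists of rank-one terms: sandwiching a two-site contraction between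
  copies of a unit vector at \<open>j\<close> leaves a contraction at \<open>i\<close>, so
  correlations are controlled by single-site quantities. The trace norm is given through a definite
  description of a matrix square root. Evaluating it requires a spectral theorem for matrices over a
  finite index set, which the same diagonalisations then supply to the entropy estimates.\<close>

definition ip :: "'a set \<Rightarrow> ('a \<Rightarrow> complex) \<Rightarrow> ('a \<Rightarrow> complex) \<Rightarrow> complex" where
  "ip S u v = (\<Sum>x\<in>S. cnj (u x) * v x)"

definition nsq :: "'a set \<Rightarrow> ('a \<Rightarrow> complex) \<Rightarrow> real" where
  "nsq S v = (\<Sum>x\<in>S. (cmod (v x))\<^sup>2)"

definition mv :: "'a set \<Rightarrow> ('a \<Rightarrow> 'a \<Rightarrow> complex) \<Rightarrow> ('a \<Rightarrow> complex) \<Rightarrow> ('a \<Rightarrow> complex)" where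
  "mv S A v = (\<lambda>x. \<Sum>y\<in>S. A x y * v y)"

definition herm_on :: "'a set \<Rightarrow> ('a \<Rightarrow> 'a \<Rightarrow> complex) \<Rightarrow> bool" where
  "herm_on S A \<longleftrightarrow> (\<forall>x\<in>S. \<forall>y\<in>S. A y x = cnj (A x y))"

lemma cnj_mult_self: "cnj z * z = of_real ((cmod z)\<^sup>2)"
  by (simp only: complex_norm_square mult.commute)

lemma ip_self: "ip S v v = of_real (nsq S v)"
  by (simp only: ip_def nsq_def cnj_mult_self of_real_sum)

lemma nsq_nonneg [simp]: "nsq S v \<ge> 0"
  by (simp add: nsq_def sum_nonneg)

lemma nsq_eq_0_iff: "finite S \<Longrightarrow> nsq S v = 0 \<longleftrightarrow> (\<forall>x\<in>S. v x = 0)"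
  by (simp add: nsq_def sum_nonneg_eq_0_iff)

lemma ip_cnj: "cnj (ip S u v) = ip S v u"
  by (simp add: ip_def mult.commute)

lemma ip_add_right: "ip S u (\<lambda>x. v x + w x) = ip S u v + ip S u w"
  by (simp add: ip_def distrib_left sum.distrib)

lemma ip_add_left: "ip S (\<lambda>x. v x + w x) u = ip S v u + ip S w u"
  by (simp add: ip_def distrib_right sum.distrib)

lemma ip_diff_right: "ip S u (\<lambda>x. v x - w x) = ip S u v - ip S u w"
  by (simp add: ip_def right_diff_distrib sum_subtractf)

lemma ip_diff_left: "ip S (\<lambda>x. v x - w x) u = ip S v u - ip S w u"
  by (simp add: ip_def left_diff_distrib sum_subtractf)

lemma ip_scale_right: "ip S u (\<lambda>x. c * v x) = c * ip S u v"
  by (simp add: ip_def sum_distrib_left algebra_simps)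

lemma ip_scale_left: "ip S (\<lambda>x. c * v x) u = cnj c * ip S v u"
  by (simp add: ip_def sum_distrib_left algebra_simps)

lemma ip_sum_right: "ip S u (\<lambda>x. \<Sum>k\<in>K. f k x) = (\<Sum>k\<in>K. ip S u (f k))"
  unfolding ip_def sum_distrib_left by (rule sum.swap)

lemma ip_sum_left: "ip S (\<lambda>x. \<Sum>k\<in>K. f k x) u = (\<Sum>k\<in>K. ip S (f k) u)"
  unfolding ip_def cnj_sum sum_distrib_right by (rule sum.swap)

lemma nsq_scale: "nsq S (\<lambda>x. c * v x) = (cmod c)\<^sup>2 * nsq S v"
  by (simp add: nsq_def norm_mult power_mult_distrib sum_distrib_left)

lemma ip_cong: "(\<And>x. x \<in> S \<Longrightarrow> u x = u' x) \<Longrightarrow> (\<And>x. x \<in> S \<Longrightarrow> v x = v' x) \<Longrightarrow> ip S u v = ip S u' v'"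
  by (simp add: ip_def)

lemma ip_mv: "ip S u (mv S A v) = (\<Sum>x\<in>S. \<Sum>y\<in>S. cnj (u x) * A x y * v y)"
  by (simp add: ip_def mv_def sum_distrib_left mult.assoc)

lemma ip_mv_herm:
  assumes "herm_on S A"
  shows "ip S (mv S A u) v = ip S u (mv S A v)"
proof -
  have "ip S (mv S A u) v = (\<Sum>x\<in>S. \<Sum>y\<in>S. cnj (A x y) * cnj (u y) * v x)"
    by (simp add: ip_def mv_def sum_distrib_right)
  also have "\<dots> = (\<Sum>y\<in>S. \<Sum>x\<in>S. cnj (A x y) * cnj (u y) * v x)"
    by (rule sum.swap)
  also have "\<dots> = (\<Sum>y\<in>S. \<Sum>x\<in>S. cnj (u y) * A y x * v x)"
    using assms by (intro sum.cong refl) (metis herm_on_def mult.commute)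
  finally show ?thesis by (simp add: ip_mv)
qed

lemma mv_add: "mv S A (\<lambda>x. v x + w x) = (\<lambda>x. mv S A v x + mv S A w x)"
  by (auto simp: mv_def distrib_left sum.distrib)

lemma mv_scale: "mv S A (\<lambda>x. c * v x) = (\<lambda>x. c * mv S A v x)"
  by (auto simp: mv_def sum_distrib_left algebra_simps)

lemma mv_sum: "mv S A (\<lambda>x. \<Sum>k\<in>K. f k x) = (\<lambda>x. \<Sum>k\<in>K. mv S A (f k) x)"
  unfolding mv_def sum_distrib_left by (intro ext sum.swap)

section \<open>Orthonormal systems and their extension by eigenvectors\<close>

definition orthonormal :: "'a set \<Rightarrow> nat \<Rightarrow> (nat \<Rightarrow> 'a \<Rightarrow> complex) \<Rightarrow> bool" where
  "orthonormal S m e \<longleftrightarrow> (\<forall>j<m. \<forall>k<m. ip S (e j) (e k) = of_bool (j = k))"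

text \<open>Bessel's inequality with its exact defect: removing the orthogonal projection splits the
  squared norm by Pythagoras.\<close>

lemma orthonormal_residual:
  assumes "orthonormal S m e"
  shows "nsq S (\<lambda>x. v x - (\<Sum>k<m. ip S (e k) v * e k x)) = nsq S v - (\<Sum>k<m. (cmod (ip S (e k) v))\<^sup>2)"
    and "j < m \<Longrightarrow> ip S (e j) (\<lambda>x. v x - (\<Sum>k<m. ip S (e k) v * e k x)) = 0"
proof -
  let ?P = "\<lambda>x. \<Sum>k<m. ip S (e k) v * e k x"
  have *: "ip S (e j) ?P = ip S (e j) v" if "j < m" for j
  proof -
    have "ip S (e j) ?P = (\<Sum>k<m. if k = j then ip S (e j) v else 0)"
      unfolding ip_sum_right ip_scale_right
      using assms that by (intro sum.cong) (auto simp: orthonormal_def)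
    thus ?thesis using that by simp
  qed
  show "j < m \<Longrightarrow> ip S (e j) (\<lambda>x. v x - ?P x) = 0"
    by (simp add: ip_diff_right *)
  note sq = cnj_mult_self
  have PP: "ip S ?P ?P = (\<Sum>k<m. of_real ((cmod (ip S (e k) v))\<^sup>2))"
    unfolding ip_sum_left ip_scale_left
    by (intro sum.cong refl) (simp only: * lessThan_iff sq)
  have Pv: "ip S ?P v = (\<Sum>k<m. of_real ((cmod (ip S (e k) v))\<^sup>2))"
    unfolding ip_sum_left ip_scale_left
    by (intro sum.cong refl) (simp only: sq)
  have vP: "ip S v ?P = (\<Sum>k<m. of_real ((cmod (ip S (e k) v))\<^sup>2))"
    unfolding ip_sum_right ip_scale_right
    by (intro sum.cong refl) (simp only: sq ip_cnj[of S "e _" v, symmetric] mult.commute[of _ "cnj _"])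
  have "complex_of_real (nsq S (\<lambda>x. v x - ?P x)) = of_real (nsq S v - (\<Sum>k<m. (cmod (ip S (e k) v))\<^sup>2))"
    unfolding ip_self[symmetric] ip_diff_left ip_diff_right PP Pv vP
    by (simp add: ip_self)
  thus "nsq S (\<lambda>x. v x - ?P x) = nsq S v - (\<Sum>k<m. (cmod (ip S (e k) v))\<^sup>2)"
    by (simp only: of_real_eq_iff)
qed

text \<open>The left side is the trace of the projection onto the orthogonal complement of the span,
  hence the dimension of that complement. It stands in for dimension theory: a positive value for
  \<open>m < card S\<close> yields an orthogonal vector, and the value 0 for
  \<open>m = card S\<close> yields completeness.\<close>

lemma delta_residual:
  assumes "orthonormal S m e" "finite S"
  shows "(\<Sum>s\<in>S. nsq S (\<lambda>x. of_bool (x = s) - (\<Sum>k<m. cnj (e k s) * e k x))) = real (card S) - real m"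
proof -
  have d: "ip S (e k) (\<lambda>x. of_bool (x = s)) = cnj (e k s)" if "s \<in> S" for k s
    using that assms(2) by (simp add: ip_def)
  have n1: "nsq S (\<lambda>x. of_bool (x = s)) = 1" if "s \<in> S" for s
    proof -
    have "nsq S (\<lambda>x. of_bool (x = s)) = (\<Sum>x\<in>S. if x = s then 1 else 0)"
      unfolding nsq_def by (intro sum.cong) auto
    thus ?thesis using that assms(2) by simp
  qed
  have "(\<Sum>s\<in>S. nsq S (\<lambda>x. of_bool (x = s) - (\<Sum>k<m. cnj (e k s) * e k x)))
      = (\<Sum>s\<in>S. 1 - (\<Sum>k<m. (cmod (e k s))\<^sup>2))"
  proof (intro sum.cong refl)
    fix s assume s: "s \<in> S"
    show "nsq S (\<lambda>x. of_bool (x = s) - (\<Sum>k<m. cnj (e k s) * e k x)) = 1 - (\<Sum>k<m. (cmod (e k s))\<^sup>2)"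
      using orthonormal_residual(1)[OF assms(1), of "\<lambda>x. of_bool (x = s)"]
      unfolding d[OF s] n1[OF s] by simp
  qed
  also have "\<dots> = real (card S) - (\<Sum>k<m. nsq S (e k))"
    by (simp add: sum_subtractf nsq_def sum.swap[of _ S])
  also have "(\<Sum>k<m. nsq S (e k)) = (\<Sum>k<m. 1)"
  proof (intro sum.cong refl)
    fix k assume "k \<in> {..<m}"
    hence "complex_of_real (nsq S (e k)) = of_real 1"
      using assms(1) by (simp add: orthonormal_def flip: ip_self)
    thus "nsq S (e k) = 1" by (simp only: of_real_eq_iff)
  qed
  finally show ?thesis by simp
qed

lemma exists_orthogonal_vector:
  assumes "orthonormal S m e" "finite S" "m < card S"
  obtains v where "\<And>x. x \<notin> S \<Longrightarrow> v x = 0" "nsq S v = 1" "\<And>k. k < m \<Longrightarrow> ip S (e k) v = 0"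
proof -
  define r where "r = (\<lambda>s x. of_bool (x = s) - (\<Sum>k<m. cnj (e k s) * e k x))"
  have "(\<Sum>s\<in>S. nsq S (r s)) > 0"
    using delta_residual[OF assms(1,2)] assms(3) by (simp add: r_def)
  then obtain s where s: "s \<in> S" "nsq S (r s) > 0"
    by (meson not_le sum_nonpos)
  have orth: "ip S (e k) (r s) = 0" if "k < m" for k
  proof -
    have "ip S (e k) (\<lambda>x. of_bool (x = s)) = cnj (e k s)" for k
      using s assms(2) by (simp add: ip_def)
    thus ?thesis
      using orthonormal_residual(2)[OF assms(1) that, of "\<lambda>x. of_bool (x = s)"]
      by (simp add: r_def)
  qed
  define c where "c = complex_of_real (1 / sqrt (nsq S (r s)))"
  define v where "v = (\<lambda>x. if x \<in> S then c * r s x else 0)"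
  have "nsq S v = nsq S (\<lambda>x. c * r s x)" by (simp add: nsq_def v_def)
  also have "\<dots> = 1" unfolding nsq_scale c_def using s by (simp add: power_divide norm_divide)
  finally have 1: "nsq S v = 1" .
  have "ip S (e k) v = ip S (e k) (\<lambda>x. c * r s x)" for k
    by (rule ip_cong) (auto simp: v_def)
  hence "ip S (e k) v = 0" if "k < m" for k
    using orth[OF that] by (simp add: ip_scale_right)
  with 1 show ?thesis by (intro that[of v]) (auto simp: v_def)
qed

text \<open>The vectors are pinned to 0 outside \<open>S\<close>, so that the set is a closed part
  of a product of discs and single points, which is compact by Tychonoff's theorem.\<close>

lemma compact_constrained_sphere:
  fixes e :: "nat \<Rightarrow> 'a \<Rightarrow> complex"
  assumes "finite S"
  shows "compact {v. (\<forall>x. x \<notin> S \<longrightarrow> v x = 0) \<and> nsq S v = 1 \<and> (\<forall>k<m. ip S (e k) v = 0)}"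
    (is "compact ?K")
proof -
  let ?B = "PiE UNIV (\<lambda>x. if x \<in> S then cball (0::complex) 1 else {0})"
  have "compactin (product_topology (\<lambda>_. euclidean) UNIV) ?B"
    by (subst compactin_PiE) auto
  hence cB: "compact ?B"
    by (simp add: euclidean_product_topology)
  have c1: "continuous_on UNIV (\<lambda>v::'a \<Rightarrow> complex. nsq S v)"
    unfolding nsq_def by (intro continuous_intros continuous_on_product_coordinates)
  have c2: "continuous_on UNIV (\<lambda>v::'a \<Rightarrow> complex. ip S (e k) v)" for k
    unfolding ip_def by (intro continuous_intros continuous_on_product_coordinates)
  have "closed ((\<lambda>v::'a \<Rightarrow> complex. nsq S v) -` {1})"
    using c1 by (intro closed_vimage) auto
  moreover have "closed ((\<lambda>v::'a \<Rightarrow> complex. ip S (e k) v) -` {0})" for k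
    using c2[of k] by (intro closed_vimage) auto
  ultimately have "closed ((\<lambda>v. nsq S v) -` {1} \<inter> (\<Inter>k\<in>{..<m}. (\<lambda>v. ip S (e k) v) -` {0}))"
    by (intro closed_Int closed_INT) auto
  hence "compact (?B \<inter> ((\<lambda>v. nsq S v) -` {1} \<inter> (\<Inter>k\<in>{..<m}. (\<lambda>v. ip S (e k) v) -` {0})))"
    using cB by (rule compact_Int_closed[rotated])
  moreover have "?B \<inter> ((\<lambda>v. nsq S v) -` {1} \<inter> (\<Inter>k\<in>{..<m}. (\<lambda>v. ip S (e k) v) -` {0})) = ?K"
  proof -
    have "cmod (v x) \<le> 1" if "nsq S v = 1" "x \<in> S" for v x
    proof -
      have "(cmod (v x))\<^sup>2 \<le> nsq S v"
        unfolding nsq_def using that assms by (intro member_le_sum) auto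
      thus ?thesis using that by (simp add: power_le_one_iff abs_square_le_1)
    qed
    thus ?thesis by (auto simp: PiE_def Pi_def split: if_splits)
  qed
  ultimately show ?thesis by simp
qed

text \<open>Variational argument: the quadratic form attains a maximum \<open>c\<close> on the unit
  vectors orthogonal to the eigenvectors found so far. A maximiser \<open>v\<close> is an
  eigenvector for \<open>c\<close>, since otherwise moving it along the residual
  \<open>A v - c v\<close> would exceed the maximum.\<close>

lemma exists_orthogonal_eigenvector:
  assumes "herm_on S A" "orthonormal S m e" "finite S" "m < card S"
    and eig: "\<And>k x. k < m \<Longrightarrow> x \<in> S \<Longrightarrow> mv S A (e k) x = of_real (l k) * e k x"
  obtains v c where "nsq S v = 1" "\<And>k. k < m \<Longrightarrow> ip S (e k) v = 0"
    "\<And>x. x \<in> S \<Longrightarrow> mv S A v x = of_real c * v x"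
proof -
  let ?K = "{v. (\<forall>x. x \<notin> S \<longrightarrow> v x = 0) \<and> nsq S v = 1 \<and> (\<forall>k<m. ip S (e k) v = 0)}"
  let ?q = "\<lambda>v. Re (ip S v (mv S A v))"
  have ne: "?K \<noteq> {}"
  proof -
    obtain v where "\<And>x. x \<notin> S \<Longrightarrow> v x = 0" "nsq S v = 1" "\<And>k. k < m \<Longrightarrow> ip S (e k) v = 0"
      using exists_orthogonal_vector[OF assms(2-4)] by blast
    hence "v \<in> ?K" by simp
    thus ?thesis by blast
  qed
  have "continuous_on UNIV ?q"
    unfolding ip_mv by (intro continuous_intros continuous_on_product_coordinates)
  hence "continuous_on ?K ?q" by (rule continuous_on_subset) simp
  from continuous_attains_sup[OF compact_constrained_sphere[OF assms(3)] ne this]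
  obtain v where v: "v \<in> ?K" and max: "\<And>w. w \<in> ?K \<Longrightarrow> ?q w \<le> ?q v" by blast
  define c where "c = ?q v"
  have orthv: "ip S (e k) v = 0" if "k < m" for k using v that by auto
  have nv: "nsq S v = 1" using v by auto
  have bound: "?q w \<le> c * nsq S w" if orth: "\<And>k. k < m \<Longrightarrow> ip S (e k) w = 0" for w
  proof (cases "nsq S w = 0")
    case True
    hence "\<forall>x\<in>S. w x = 0" using nsq_eq_0_iff assms(3) by blast
    hence "ip S w (mv S A w) = 0" by (simp add: ip_def)
    thus ?thesis using True by simp
  next
    case False
    hence pos: "nsq S w > 0" by (simp add: order_less_le)
    define b where "b = complex_of_real (1 / sqrt (nsq S w))"
    define w' where "w' = (\<lambda>x. if x \<in> S then b * w x else 0)"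
    have bb: "(cmod b)\<^sup>2 = 1 / nsq S w" using pos by (simp add: b_def power_divide norm_divide)
    have eqv: "ip S u w' = ip S u (\<lambda>x. b * w x)" for u
      by (rule ip_cong) (auto simp: w'_def)
    have "nsq S w' = nsq S (\<lambda>x. b * w x)" by (simp add: nsq_def w'_def)
    also have "\<dots> = 1" unfolding nsq_scale bb using pos by simp
    finally have "w' \<in> ?K" using orth by (auto simp: eqv ip_scale_right) (auto simp: w'_def)
    from max[OF this] have "?q w' \<le> c" by (simp add: c_def)
    moreover have "ip S w' (mv S A w') = of_real (1 / nsq S w) * ip S w (mv S A w)"
    proof -
      have "mv S A w' = mv S A (\<lambda>x. b * w x)" by (auto simp: mv_def w'_def)
      hence "ip S w' (mv S A w') = ip S (\<lambda>x. b * w x) (mv S A (\<lambda>x. b * w x))"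
        by (intro ip_cong) (auto simp: w'_def)
      also have "\<dots> = (cnj b * b) * ip S w (mv S A w)"
        by (simp add: mv_scale ip_scale_left ip_scale_right)
      also have "cnj b * b = of_real ((cmod b)\<^sup>2)" by (rule cnj_mult_self)
      finally show ?thesis by (simp only: bb)
    qed
    ultimately have "?q w / nsq S w \<le> c" by simp
    thus ?thesis using pos by (simp add: field_simps)
  qed
  \<comment> \<open>Moving along \<open>w\<close> respects the constraints: \<open>A\<close> is
    Hermitian and each \<open>e k\<close> is an eigenvector, so \<open>A v\<close> is again
    orthogonal to \<open>e k\<close>.\<close>
  define w where "w = (\<lambda>x. mv S A v x - of_real c * v x)"
  have orthw: "ip S (e k) w = 0" if "k < m" for k
  proof -
    have "ip S (e k) (mv S A v) = ip S (mv S A (e k)) v" by (rule ip_mv_herm[OF assms(1), symmetric])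
    also have "\<dots> = ip S (\<lambda>x. of_real (l k) * e k x) v"
      by (rule ip_cong) (auto simp: eig[OF that])
    finally show ?thesis using orthv[OF that]
      by (simp add: w_def ip_diff_right ip_scale_right ip_scale_left)
  qed
  have nw: "ip S w (mv S A v) - of_real c * ip S w v = of_real (nsq S w)"
    by (simp add: ip_self[symmetric] w_def ip_diff_right ip_scale_right)
  have key: "0 \<le> - 2 * t * nsq S w + t\<^sup>2 * (c * nsq S w - ?q w)" for t :: real
  proof -
    let ?u = "\<lambda>x. v x + of_real t * w x"
    have "?q ?u \<le> c * nsq S ?u"
      by (rule bound) (simp add: ip_add_right ip_scale_right orthv orthw)
    moreover have "ip S v (mv S A w) = cnj (ip S w (mv S A v))"
      using ip_mv_herm[OF assms(1), of v w] by (simp add: ip_cnj)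
    hence "?q ?u = c + 2 * t * Re (ip S w (mv S A v)) + t\<^sup>2 * ?q w"
      by (simp add: mv_add mv_scale ip_add_left ip_add_right ip_scale_left ip_scale_right c_def
        power2_eq_square algebra_simps)
    moreover have "ip S v w = cnj (ip S w v)" by (simp add: ip_cnj)
    hence "Re (ip S ?u ?u) = 1 + 2 * t * Re (ip S w v) + t\<^sup>2 * nsq S w"
      by (simp add: ip_add_left ip_add_right ip_scale_left ip_scale_right ip_self nv
         power2_eq_square algebra_simps)
    hence "nsq S ?u = 1 + 2 * t * Re (ip S w v) + t\<^sup>2 * nsq S w" by (simp add: ip_self)
    moreover have "Re (ip S w (mv S A v)) - c * Re (ip S w v) = nsq S w"
      using arg_cong[OF nw, of Re] by simp
    ultimately have "c + 2 * t * Re (ip S w (mv S A v)) + t\<^sup>2 * ?q w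
        \<le> c * (1 + 2 * t * Re (ip S w v) + t\<^sup>2 * nsq S w)"
      and *: "Re (ip S w (mv S A v)) = nsq S w + c * Re (ip S w v)" by simp_all
    thus ?thesis unfolding * by (simp add: algebra_simps)
  qed
  have "nsq S w = 0"
  proof (rule ccontr)
    assume "nsq S w \<noteq> 0"
    hence pos: "nsq S w > 0" by (simp add: order_less_le)
    define Q where "Q = \<bar>c * nsq S w - ?q w\<bar> + 1"
    have Q: "Q > 0" "c * nsq S w - ?q w \<le> Q" by (auto simp: Q_def)
    \<comment> \<open>With this step size the quadratic term is at most \<open>t * nsq S w\<close>,
      half of the linear term \<open>2 * t * nsq S w\<close>, which contradicts
      \<open>key\<close>.\<close>
    define t where "t = nsq S w / Q"
    have "t > 0" using pos Q by (simp add: t_def)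
    have "t\<^sup>2 * (c * nsq S w - ?q w) \<le> t\<^sup>2 * Q" using Q by (intro mult_left_mono) auto
    also have "\<dots> = t * nsq S w" using Q by (simp add: t_def power2_eq_square)
    finally have "0 \<le> - (t * nsq S w)" using key[of t] by linarith
    thus False using \<open>t > 0\<close> pos by (simp add: mult_le_0_iff)
  qed
  hence "\<forall>x\<in>S. w x = 0" using nsq_eq_0_iff assms(3) by blast
  thus ?thesis using that[OF nv orthv, of c] by (auto simp: w_def)
qed

lemma partial_eigenbasis:
  assumes "herm_on S A" "finite S" "m \<le> card S"
  shows "\<exists>e (l :: nat \<Rightarrow> real). orthonormal S m e \<and> (\<forall>k<m. \<forall>x\<in>S. mv S A (e k) x = of_real (l k) * e k x)"
  using assms(3)
proof (induction m)
  case 0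
  show ?case by (simp add: orthonormal_def)
next
  case (Suc m)
  then obtain e and l :: "nat \<Rightarrow> real" where e: "orthonormal S m e"
    "\<And>k x. k < m \<Longrightarrow> x \<in> S \<Longrightarrow> mv S A (e k) x = of_real (l k) * e k x" by auto
  obtain v c where v: "nsq S v = 1" "\<And>k. k < m \<Longrightarrow> ip S (e k) v = 0"
    "\<And>x. x \<in> S \<Longrightarrow> mv S A v x = of_real c * v x"
    using exists_orthogonal_eigenvector[OF assms(1) e(1) assms(2) _ e(2)] Suc.prems by auto
  have "ip S v (e k) = 0" if "k < m" for k
    using ip_cnj[of S "e k" v] v(2)[OF that] by simp
  hence "orthonormal S (Suc m) (e(m := v))"
    using e(1) v(1,2) by (auto simp: orthonormal_def less_Suc_eq ip_self)
  thus ?case using e(2) v(3)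
    by (intro exI[of _ "e(m := v)"] exI[of _ "l(m := c)"]) (auto simp: less_Suc_eq simp del: fun_upd_apply, auto)
qed

section \<open>Complete orthonormal bases and spectral decompositions\<close>

definition onb :: "'a set \<Rightarrow> (nat \<Rightarrow> 'a \<Rightarrow> complex) \<Rightarrow> bool" where
  "onb S e \<longleftrightarrow> orthonormal S (card S) e \<and>
     (\<forall>x\<in>S. \<forall>y\<in>S. (\<Sum>k<card S. e k x * cnj (e k y)) = of_bool (x = y))"

text \<open>By \<open>delta_residual\<close> every standard basis vector has residual 0; written out
  in coordinates, this is the resolution of the identity.\<close>

lemma orthonormal_imp_onb:
  assumes "orthonormal S (card S) e" "finite S"
  shows "onb S e"
proof -
  have "(\<Sum>s\<in>S. nsq S (\<lambda>x. of_bool (x = s) - (\<Sum>k<card S. cnj (e k s) * e k x))) = 0"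
    using delta_residual[OF assms] by simp
  hence "\<forall>s\<in>S. \<forall>x\<in>S. of_bool (x = s) - (\<Sum>k<card S. cnj (e k s) * e k x) = 0"
    using assms(2) by (subst (asm) sum_nonneg_eq_0_iff) (auto simp: nsq_eq_0_iff)
  thus ?thesis using assms(1) by (auto simp: onb_def mult.commute)
qed

lemma onb_expand:
  assumes "onb S e" "finite S" "x \<in> S"
  shows "v x = (\<Sum>k<card S. ip S (e k) v * e k x)"
proof -
  have "(\<Sum>k<card S. ip S (e k) v * e k x) = (\<Sum>k<card S. \<Sum>y\<in>S. (e k x * cnj (e k y)) * v y)"
    by (simp add: ip_def sum_distrib_left mult.assoc mult.commute[of _ "e _ x"])
  also have "\<dots> = (\<Sum>y\<in>S. (\<Sum>k<card S. e k x * cnj (e k y)) * v y)"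
    by (subst sum.swap) (simp add: sum_distrib_right)
  also have "\<dots> = (\<Sum>y\<in>S. of_bool (x = y) * v y)"
    using assms by (intro sum.cong) (auto simp: onb_def)
  finally show ?thesis using assms by simp
qed

lemma onb_parseval_ip:
  assumes "onb S e" "finite S"
  shows "(\<Sum>k<card S. ip S u (e k) * ip S (e k) v) = ip S u v"
proof -
  have "ip S u v = ip S u (\<lambda>x. \<Sum>k<card S. ip S (e k) v * e k x)"
    by (rule ip_cong) (auto intro: onb_expand assms)
  thus ?thesis by (simp add: ip_sum_right ip_scale_right mult.commute[of "ip S u _"])
qed

lemma onb_parseval:
  assumes "onb S e" "finite S"
  shows "(\<Sum>k<card S. (cmod (ip S (e k) v))\<^sup>2) = nsq S v"
    and "(\<Sum>k<card S. (cmod (ip S v (e k)))\<^sup>2) = nsq S v"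
proof -
  have *: "ip S v (e k) * ip S (e k) v = of_real ((cmod (ip S (e k) v))\<^sup>2)" for k
    unfolding ip_cnj[of S "e k" v, symmetric] by (rule cnj_mult_self)
  have "complex_of_real (\<Sum>k<card S. (cmod (ip S (e k) v))\<^sup>2) = of_real (nsq S v)"
    using onb_parseval_ip[OF assms, of v v] by (simp only: * ip_self of_real_sum)
  thus 1: "(\<Sum>k<card S. (cmod (ip S (e k) v))\<^sup>2) = nsq S v" by (simp only: of_real_eq_iff)
  have "cmod (ip S v (e k)) = cmod (ip S (e k) v)" for k
    unfolding ip_cnj[of S "e k" v, symmetric] by simp
  thus "(\<Sum>k<card S. (cmod (ip S v (e k)))\<^sup>2) = nsq S v" using 1 by simp
qed

lemma onb_nsq: "onb S e \<Longrightarrow> k < card S \<Longrightarrow> nsq S (e k) = 1"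
proof -
  assume "onb S e" "k < card S"
  hence "complex_of_real (nsq S (e k)) = of_real 1"
    by (simp add: onb_def orthonormal_def flip: ip_self)
  thus ?thesis by (simp only: of_real_eq_iff)
qed

definition spectral :: "'a set \<Rightarrow> ('a \<Rightarrow> 'a \<Rightarrow> complex) \<Rightarrow> (nat \<Rightarrow> 'a \<Rightarrow> complex) \<Rightarrow> (nat \<Rightarrow> real) \<Rightarrow> bool" where
  "spectral S A e l \<longleftrightarrow> onb S e \<and>
     (\<forall>x\<in>S. \<forall>y\<in>S. A x y = (\<Sum>k<card S. of_real (l k) * e k x * cnj (e k y)))"

theorem spectral_theorem:
  assumes "herm_on S A" "finite S"
  shows "\<exists>e l. spectral S A e l"
proof -
  obtain e and l :: "nat \<Rightarrow> real" where e: "orthonormal S (card S) e"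
    "\<And>k x. k < card S \<Longrightarrow> x \<in> S \<Longrightarrow> mv S A (e k) x = of_real (l k) * e k x"
    using partial_eigenbasis[OF assms order_refl] by auto
  have onb: "onb S e" using e(1) assms(2) by (rule orthonormal_imp_onb)
  have "A x y = (\<Sum>k<card S. of_real (l k) * e k x * cnj (e k y))" if "x \<in> S" "y \<in> S" for x y
  proof -
    have "A x y = (\<Sum>z\<in>S. A x z * of_bool (z = y))" using that assms(2) by simp
    also have "\<dots> = (\<Sum>z\<in>S. A x z * (\<Sum>k<card S. e k z * cnj (e k y)))"
      using onb that by (intro sum.cong) (auto simp: onb_def)
    also have "\<dots> = (\<Sum>k<card S. mv S A (e k) x * cnj (e k y))"
      unfolding mv_def sum_distrib_left sum_distrib_right by (subst sum.swap) (simp add: mult.assoc)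
    finally show ?thesis using e(2) that by simp
  qed
  with onb show ?thesis by (auto simp: spectral_def)
qed

section \<open>Positive semidefinite matrices and the trace norm\<close>

lemma psd_on_ip: "psd_on S A \<longleftrightarrow> (\<forall>v. Im (ip S v (mv S A v)) = 0 \<and> Re (ip S v (mv S A v)) \<ge> 0)"
  by (simp add: psd_on_def ip_mv)

lemma ip_mv_delta:
  assumes "finite S" "x \<in> S" "y \<in> S"
  shows "ip S (\<lambda>z. of_bool (z = x)) (mv S A (\<lambda>z. of_bool (z = y))) = A x y"
proof -
  have "cnj (of_bool P) = of_bool P" for P by (cases P) auto
  thus ?thesis using assms by (simp add: ip_def mv_def)
qed

text \<open>Polarisation: the form is real at the unit vector at \<open>x\<close> plus
  \<open>c\<close> times the one at \<open>y\<close>. The choice \<open>c = 1\<close> makes the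
  imaginary parts of \<open>A x y\<close> and \<open>A y x\<close> opposite, and
  \<open>c = \<i>\<close> makes their real parts equal.\<close>

lemma psd_on_imp_herm_on:
  assumes "psd_on S A" "finite S"
  shows "herm_on S A"
  unfolding herm_on_def
proof (intro ballI)
  fix x y assume xy: "x \<in> S" "y \<in> S"
  let ?B = "\<lambda>u v. ip S u (mv S A v)"
  let ?u = "\<lambda>z. of_bool (z = x) :: complex" and ?v = "\<lambda>z. of_bool (z = y) :: complex"
  have im: "Im (?B v v) = 0" for v using assms(1) by (simp add: psd_on_ip)
  have "Im (c * A x y + cnj c * A y x) = 0" for c
  proof -
    have "?B (\<lambda>z. ?u z + c * ?v z) (\<lambda>z. ?u z + c * ?v z)
        = ?B ?u ?u + (c * A x y + cnj c * A y x) + (cnj c * c) * ?B ?v ?v"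
      by (simp only: mv_add mv_scale ip_add_left ip_add_right ip_scale_left ip_scale_right
          ip_mv_delta[OF assms(2)] xy algebra_simps)
    hence "Im (c * A x y + cnj c * A y x) + Im ((cnj c * c) * ?B ?v ?v) = 0"
      using im[of "\<lambda>z. ?u z + c * ?v z"] im[of ?u] by (simp only: plus_complex.simps)
    moreover have "Im ((cnj c * c) * ?B ?v ?v) = 0"
      unfolding cnj_mult_self using im[of ?v] by simp
    ultimately show ?thesis by linarith
  qed
  from this[of 1] this[of \<i>] show "A y x = cnj (A x y)"
    by (simp add: complex_eq_iff)
qed

lemma spectral_ip_mv:
  assumes "spectral S A e l"
  shows "ip S u (mv S A v) = (\<Sum>k<card S. of_real (l k) * ip S u (e k) * ip S (e k) v)"
proof -
  have "ip S u (mv S A v) = (\<Sum>x\<in>S. \<Sum>y\<in>S. \<Sum>k<card S. cnj (u x) * (of_real (l k) * e k x * cnj (e k y)) * v y)"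
    unfolding ip_mv using assms
    by (intro sum.cong refl) (auto simp: spectral_def sum_distrib_left sum_distrib_right)
  also have "\<dots> = (\<Sum>x\<in>S. \<Sum>k<card S. \<Sum>y\<in>S. cnj (u x) * (of_real (l k) * e k x * cnj (e k y)) * v y)"
    by (intro sum.cong refl sum.swap)
  also have "\<dots> = (\<Sum>k<card S. \<Sum>x\<in>S. \<Sum>y\<in>S. cnj (u x) * (of_real (l k) * e k x * cnj (e k y)) * v y)"
    by (rule sum.swap)
  finally show ?thesis
    by (simp add: ip_def sum_distrib_left sum_distrib_right mult_ac)
qed

lemma spectral_mv:
  assumes "spectral S A e l" "k < card S" "x \<in> S"
  shows "mv S A (e k) x = of_real (l k) * e k x"
proof -
  have "mv S A (e k) x = (\<Sum>y\<in>S. \<Sum>j<card S. of_real (l j) * e j x * cnj (e j y) * e k y)"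
    unfolding mv_def using assms
    by (intro sum.cong refl) (auto simp: spectral_def sum_distrib_left sum_distrib_right)
  also have "\<dots> = (\<Sum>j<card S. of_real (l j) * e j x * ip S (e j) (e k))"
    by (subst sum.swap) (simp add: ip_def sum_distrib_left mult_ac)
  also have "\<dots> = (\<Sum>j<card S. if j = k then of_real (l k) * e k x else 0)"
    using assms by (intro sum.cong) (auto simp: spectral_def onb_def orthonormal_def)
  finally show ?thesis using assms(2) by simp
qed

lemma spectral_eigenvalue:
  assumes "spectral S A e l" "k < card S"
  shows "ip S (e k) (mv S A (e k)) = of_real (l k)"
proof -
  have "ip S (e k) (mv S A (e k)) = ip S (e k) (\<lambda>x. of_real (l k) * e k x)"
    by (rule ip_cong) (auto simp: spectral_mv[OF assms])
  thus ?thesis using assms by (simp add: ip_scale_right ip_self onb_nsq spectral_def)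
qed

lemma onb_mtrace:
  assumes "onb S e" "finite S"
  shows "(\<Sum>k<card S. ip S (e k) (mv S A (e k))) = mtrace S A"
proof -
  have "(\<Sum>k<card S. ip S (e k) (mv S A (e k))) = (\<Sum>k<card S. \<Sum>x\<in>S. \<Sum>y\<in>S. A x y * (e k y * cnj (e k x)))"
    by (simp add: ip_mv mult_ac)
  also have "\<dots> = (\<Sum>x\<in>S. \<Sum>k<card S. \<Sum>y\<in>S. A x y * (e k y * cnj (e k x)))"
    by (rule sum.swap)
  also have "\<dots> = (\<Sum>x\<in>S. \<Sum>y\<in>S. \<Sum>k<card S. A x y * (e k y * cnj (e k x)))"
    by (intro sum.cong refl sum.swap)
  also have "\<dots> = (\<Sum>x\<in>S. \<Sum>y\<in>S. A x y * of_bool (y = x))"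
    using assms by (intro sum.cong refl) (auto simp: onb_def simp flip: sum_distrib_left)
  also have "\<dots> = mtrace S A"
    using assms(2) by (simp add: mtrace_def)
  finally show ?thesis .
qed

lemma spectral_mtrace:
  assumes "spectral S A e l" "finite S"
  shows "mtrace S A = of_real (\<Sum>k<card S. l k)"
proof -
  have "mtrace S A = (\<Sum>k<card S. ip S (e k) (mv S A (e k)))"
    using assms by (intro onb_mtrace[symmetric]) (auto simp: spectral_def)
  also have "\<dots> = (\<Sum>k<card S. of_real (l k))"
    by (intro sum.cong) (auto simp: spectral_eigenvalue[OF assms(1)])
  finally show ?thesis by simp
qed

lemma spectral_psd_nonneg:
  assumes "spectral S A e l" "psd_on S A" "k < card S"
  shows "l k \<ge> 0"
  using assms(2) spectral_eigenvalue[OF assms(1,3)] unfolding psd_on_ip by (metis Re_complex_of_real)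

lemma spectral_psdI:
  assumes "spectral S A e l" "\<And>k. k < card S \<Longrightarrow> l k \<ge> 0"
  shows "psd_on S A"
  unfolding psd_on_ip
proof (intro allI)
  fix v
  have *: "of_real (l k) * ip S v (e k) * ip S (e k) v = of_real (l k * (cmod (ip S (e k) v))\<^sup>2)" for k
    unfolding ip_cnj[of S "e k" v, symmetric] of_real_mult cnj_mult_self[symmetric] by (simp add: mult.assoc)
  have "ip S v (mv S A v) = of_real (\<Sum>k<card S. l k * (cmod (ip S (e k) v))\<^sup>2)"
    unfolding spectral_ip_mv[OF assms(1)] * by (simp only: of_real_sum)
  moreover have "(\<Sum>k<card S. l k * (cmod (ip S (e k) v))\<^sup>2) \<ge> 0"
    using assms(2) by (intro sum_nonneg) auto
  ultimately show "Im (ip S v (mv S A v)) = 0 \<and> 0 \<le> Re (ip S v (mv S A v))"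
    by (metis Im_complex_of_real Re_complex_of_real)
qed

lemma psd_spectral:
  assumes "psd_on S A" "finite S"
  obtains e l where "spectral S A e l" "\<And>k. k < card S \<Longrightarrow> l k \<ge> 0"
  using spectral_theorem[OF psd_on_imp_herm_on[OF assms] assms(2)] spectral_psd_nonneg assms(1)
  by metis

lemma psd_mtrace:
  assumes "psd_on S A" "finite S"
  shows "mtrace S A = of_real (Re (mtrace S A))" "Re (mtrace S A) \<ge> 0"
proof -
  obtain e l where s: "spectral S A e l" "\<And>k. k < card S \<Longrightarrow> l k \<ge> 0"
    using psd_spectral[OF assms] by blast
  show "mtrace S A = of_real (Re (mtrace S A))" "Re (mtrace S A) \<ge> 0"
    unfolding spectral_mtrace[OF s(1) assms(2)] using s(2) by (auto intro: sum_nonneg)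
qed

text \<open>Nonnegative eigenvalues with sum 0 all vanish. This settles outcomes of probability 0,
  whose conditional matrices have trace 0.\<close>

lemma psd_zero_trace:
  assumes "psd_on S A" "finite S" "Re (mtrace S A) = 0" "x \<in> S" "y \<in> S"
  shows "A x y = 0"
proof -
  obtain e l where s: "spectral S A e l" "\<And>k. k < card S \<Longrightarrow> l k \<ge> 0"
    using psd_spectral[OF assms(1,2)] by blast
  have "(\<Sum>k<card S. l k) = 0" using assms(3) spectral_mtrace[OF s(1) assms(2)] by simp
  hence "\<forall>k\<in>{..<card S}. l k = 0" by (subst (asm) sum_nonneg_eq_0_iff) (auto simp: s(2))
  thus ?thesis using s(1) assms(4,5) by (auto simp: spectral_def)
qed

definition of_spectrum :: "'a set \<Rightarrow> (nat \<Rightarrow> 'a \<Rightarrow> complex) \<Rightarrow> (nat \<Rightarrow> real) \<Rightarrow> 'a \<Rightarrow> 'a \<Rightarrow> complex" where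
  "of_spectrum S e l = (\<lambda>x y. if x \<in> S \<and> y \<in> S then \<Sum>k<card S. of_real (l k) * e k x * cnj (e k y) else 0)"

lemma spectral_of_spectrum: "onb S e \<Longrightarrow> spectral S (of_spectrum S e l) e l"
  by (simp add: spectral_def of_spectrum_def)

lemma mmult_spectral:
  assumes "spectral S A e l" "spectral S B e m"
  shows "mmult S A B = of_spectrum S e (\<lambda>k. l k * m k)"
proof (intro ext)
  fix x y
  show "mmult S A B x y = of_spectrum S e (\<lambda>k. l k * m k) x y"
  proof (cases "x \<in> S \<and> y \<in> S")
    case True
    have "(\<Sum>z\<in>S. A x z * B z y) = (\<Sum>z\<in>S. A x z * (\<Sum>k<card S. of_real (m k) * e k z * cnj (e k y)))"
      using assms(2) True by (intro sum.cong) (auto simp: spectral_def)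
    also have "\<dots> = (\<Sum>k<card S. of_real (m k) * mv S A (e k) x * cnj (e k y))"
      unfolding mv_def sum_distrib_left sum_distrib_right by (subst sum.swap) (simp add: mult_ac)
    also have "\<dots> = (\<Sum>k<card S. of_real (l k * m k) * e k x * cnj (e k y))"
      using True by (intro sum.cong refl) (simp add: spectral_mv[OF assms(1)])
    finally show ?thesis using True by (simp add: mmult_def of_spectrum_def)
  qed (auto simp: mmult_def of_spectrum_def)
qed

text \<open>Compare \<open>B\<close> and \<open>C\<close> between an eigenvector \<open>e j\<close>
  of \<open>B\<close> and an eigenvector \<open>f k\<close> of \<open>C\<close>. Equality of the
  squares forces \<open>b j\<close> and \<open>c k\<close> to have equal squares whenever the two
  vectors overlap, hence to be equal since both are nonnegative; without overlap both entries are
  0.\<close>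

lemma psd_sqrt_unique:
  assumes "finite S" "mat_on S B" "psd_on S B" "mat_on S C" "psd_on S C" "mmult S B B = mmult S C C"
  shows "B = C"
proof -
  obtain e b where B: "spectral S B e b" "\<And>k. k < card S \<Longrightarrow> b k \<ge> 0"
    using psd_spectral[OF assms(3,1)] by blast
  obtain f c where C: "spectral S C f c" "\<And>k. k < card S \<Longrightarrow> c k \<ge> 0"
    using psd_spectral[OF assms(5,1)] by blast
  have onb: "onb S e" "onb S f" using B(1) C(1) by (auto simp: spectral_def)
  have herm: "herm_on S B" "herm_on S C" using psd_on_imp_herm_on assms by blast+
  have eq: "of_spectrum S e (\<lambda>k. b k * b k) = of_spectrum S f (\<lambda>k. c k * c k)" (is "?P = ?Q")
    using assms(6) mmult_spectral[OF B(1) B(1)] mmult_spectral[OF C(1) C(1)] by simp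
  have sP: "spectral S ?P e (\<lambda>k. b k * b k)" and sQ: "spectral S ?Q f (\<lambda>k. c k * c k)"
    using onb by (auto intro: spectral_of_spectrum)
  have hP: "herm_on S ?P"
    using spectral_psdI[OF sP] psd_on_imp_herm_on assms(1) by auto
  have BC: "ip S (e j) (mv S B (f k)) = ip S (e j) (mv S C (f k))" if "j < card S" "k < card S" for j k
  proof -
    have 1: "ip S (e j) (mv S ?P (f k)) = of_real (b j * b j) * ip S (e j) (f k)"
    proof -
      have "ip S (e j) (mv S ?P (f k)) = ip S (mv S ?P (e j)) (f k)" using ip_mv_herm[OF hP] by simp
      also have "\<dots> = ip S (\<lambda>x. of_real (b j * b j) * e j x) (f k)"
        by (rule ip_cong) (auto simp: spectral_mv[OF sP that(1)])
      finally show ?thesis by (simp only: ip_scale_left complex_cnj_complex_of_real)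
    qed
    have 2: "ip S (e j) (mv S ?P (f k)) = of_real (c k * c k) * ip S (e j) (f k)"
    proof -
      have "ip S (e j) (mv S ?P (f k)) = ip S (e j) (\<lambda>x. of_real (c k * c k) * f k x)"
        unfolding eq by (rule ip_cong) (auto simp: spectral_mv[OF sQ that(2)])
      thus ?thesis by (simp only: ip_scale_right)
    qed
    have 3: "ip S (e j) (mv S B (f k)) = of_real (b j) * ip S (e j) (f k)"
    proof -
      have "ip S (e j) (mv S B (f k)) = ip S (mv S B (e j)) (f k)" using ip_mv_herm[OF herm(1)] by simp
      also have "\<dots> = ip S (\<lambda>x. of_real (b j) * e j x) (f k)"
        by (rule ip_cong) (auto simp: spectral_mv[OF B(1) that(1)])
      finally show ?thesis by (simp only: ip_scale_left complex_cnj_complex_of_real)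
    qed
    have 4: "ip S (e j) (mv S C (f k)) = of_real (c k) * ip S (e j) (f k)"
    proof -
      have "ip S (e j) (mv S C (f k)) = ip S (e j) (\<lambda>x. of_real (c k) * f k x)"
        by (rule ip_cong) (auto simp: spectral_mv[OF C(1) that(2)])
      thus ?thesis by (simp only: ip_scale_right)
    qed
    show ?thesis
    proof (cases "ip S (e j) (f k) = 0")
      case False
      hence "complex_of_real (b j * b j) = of_real (c k * c k)" using 1 2 by simp
      hence "b j * b j = c k * c k" by (simp only: of_real_eq_iff)
      hence "b j = c k" using B(2)[OF that(1)] C(2)[OF that(2)]
        by (metis abs_of_nonneg real_sqrt_abs2)
      thus ?thesis using 3 4 by simp
    qed (simp add: 3 4)
  qed
  have exp: "mv S B (f k) x = mv S C (f k) x" if "x \<in> S" "k < card S" for x k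
    using onb_expand[OF onb(1) assms(1) that(1), of "mv S B (f k)"]
      onb_expand[OF onb(1) assms(1) that(1), of "mv S C (f k)"] BC that by simp
  have expand: "A x y = (\<Sum>k<card S. mv S A (f k) x * cnj (f k y))" if "x \<in> S" "y \<in> S" for A :: "'a \<Rightarrow> 'a \<Rightarrow> complex" and x y
  proof -
    have "(\<Sum>k<card S. mv S A (f k) x * cnj (f k y)) = (\<Sum>z\<in>S. A x z * (\<Sum>k<card S. f k z * cnj (f k y)))"
      unfolding mv_def sum_distrib_left sum_distrib_right by (subst sum.swap) (simp add: mult_ac)
    also have "\<dots> = (\<Sum>z\<in>S. A x z * of_bool (z = y))"
      using onb(2) that by (intro sum.cong) (auto simp: onb_def)
    finally show ?thesis using that assms(1) by simp
  qed
  show "B = C"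
  proof (intro ext)
    fix x y show "B x y = C x y"
      using assms(2,4) expand[of x y B] expand[of x y C] exp
      by (cases "x \<in> S \<and> y \<in> S") (auto simp: mat_on_def)
  qed
qed

text \<open>This discharges the definite description in \<open>psd_sqrt\<close>: the matrix with
  eigenvalues \<open>\<bar>l k\<bar>\<close> in the same basis is a root of the required kind, and
  \<open>psd_sqrt_unique\<close> makes it the only one.\<close>

lemma trace_norm_spectral:
  assumes "spectral S X e l" "finite S"
  shows "trace_norm S X = (\<Sum>k<card S. \<bar>l k\<bar>)"
proof -
  have onb: "onb S e" using assms(1) by (simp add: spectral_def)
  have "spectral S (adjoint X) e l"
    using assms(1) by (auto simp: spectral_def adjoint_def mult_ac)
  hence XX: "mmult S (adjoint X) X = of_spectrum S e (\<lambda>k. l k * l k)"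
    using assms(1) by (rule mmult_spectral)
  define R where "R = of_spectrum S e (\<lambda>k. \<bar>l k\<bar>)"
  have sR: "spectral S R e (\<lambda>k. \<bar>l k\<bar>)" unfolding R_def by (rule spectral_of_spectrum[OF onb])
  have R: "mat_on S R" "psd_on S R" "mmult S R R = mmult S (adjoint X) X"
    using spectral_psdI[OF sR] mmult_spectral[OF sR sR]
    by (auto simp: XX R_def of_spectrum_def mat_on_def)
  have "psd_sqrt S (mmult S (adjoint X) X) = R"
    unfolding psd_sqrt_def
    using R psd_sqrt_unique[OF assms(2)] by (intro the_equality) metis+
  thus ?thesis using spectral_mtrace[OF sR assms(2)] by (simp add: trace_norm_def)
qed

section \<open>Contractions as dual witnesses for the trace norm\<close>

definition contraction :: "'a set \<Rightarrow> ('a \<Rightarrow> 'a \<Rightarrow> complex) \<Rightarrow> bool" where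
  "contraction S W \<longleftrightarrow> (\<forall>u v. (cmod (ip S u (mv S W v)))\<^sup>2 \<le> nsq S u * nsq S v)"

definition trace_prod :: "'a set \<Rightarrow> ('a \<Rightarrow> 'a \<Rightarrow> complex) \<Rightarrow> ('a \<Rightarrow> 'a \<Rightarrow> complex) \<Rightarrow> complex" where
  "trace_prod S W X = (\<Sum>x\<in>S. \<Sum>y\<in>S. W y x * X x y)"

lemma trace_prod_diff: "trace_prod S W (\<lambda>x y. X x y - Y x y) = trace_prod S W X - trace_prod S W Y"
  by (simp add: trace_prod_def algebra_simps sum_subtractf)

lemma trace_prod_scale: "trace_prod S W (\<lambda>x y. c * X x y) = c * trace_prod S W X"
  by (simp add: trace_prod_def sum_distrib_left mult_ac)

lemma trace_prod_sum: "trace_prod S W (\<lambda>x y. \<Sum>k\<in>K. X k x y) = (\<Sum>k\<in>K. trace_prod S W (X k))"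
proof -
  have "trace_prod S W (\<lambda>x y. \<Sum>k\<in>K. X k x y) = (\<Sum>x\<in>S. \<Sum>k\<in>K. \<Sum>y\<in>S. W y x * X k x y)"
    unfolding trace_prod_def sum_distrib_left by (intro sum.cong refl sum.swap)
  also have "\<dots> = (\<Sum>k\<in>K. trace_prod S W (X k))" unfolding trace_prod_def by (rule sum.swap)
  finally show ?thesis .
qed

lemma trace_prod_cong: "(\<And>x y. x \<in> S \<Longrightarrow> y \<in> S \<Longrightarrow> X x y = Y x y) \<Longrightarrow> trace_prod S W X = trace_prod S W Y"
  by (simp add: trace_prod_def)

lemma trace_prod_spectral:
  assumes "spectral S X e l"
  shows "trace_prod S W X = (\<Sum>k<card S. of_real (l k) * ip S (e k) (mv S W (e k)))"
proof -
  have "trace_prod S W X = trace_prod S W (\<lambda>x y. \<Sum>k<card S. of_real (l k) * (e k x * cnj (e k y)))"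
    using assms by (intro trace_prod_cong) (simp add: spectral_def mult.assoc)
  also have "\<dots> = (\<Sum>k<card S. of_real (l k) * ip S (e k) (mv S W (e k)))"
    unfolding trace_prod_sum trace_prod_scale
    by (intro sum.cong refl arg_cong2[of _ _ _ _ "(*)"])
      (simp add: trace_prod_def ip_mv mult_ac, subst sum.swap, simp)
  finally show ?thesis .
qed

lemma contraction_unit:
  assumes "contraction S W" "nsq S u = 1" "nsq S v = 1"
  shows "cmod (ip S u (mv S W v)) \<le> 1"
proof -
  have "(cmod (ip S u (mv S W v)))\<^sup>2 \<le> 1"
    using assms unfolding contraction_def by (metis mult_1)
  thus ?thesis by (simp add: abs_square_le_1)
qed

text \<open>The witness is the sign of \<open>X\<close> in its eigenbasis. It turns the trace norm
  into the value of a linear functional, so that the terms of a decomposition of \<open>X\<close>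
  can be bounded one by one with the same \<open>W\<close>.\<close>

lemma trace_norm_witness:
  assumes "herm_on S X" "finite S"
  obtains W where "contraction S W" "trace_norm S X = Re (trace_prod S W X)"
proof -
  obtain e l where s: "spectral S X e l" using spectral_theorem[OF assms] by blast
  have onb: "onb S e" using s by (simp add: spectral_def)
  define W where "W = of_spectrum S e (\<lambda>k. sgn (l k))"
  have sW: "spectral S W e (\<lambda>k. sgn (l k))" unfolding W_def by (rule spectral_of_spectrum[OF onb])
  have "contraction S W"
    unfolding contraction_def
  proof (intro allI)
    fix u v
    have "cmod (ip S u (mv S W v)) \<le> (\<Sum>k<card S. cmod (ip S u (e k)) * cmod (ip S (e k) v))"
      unfolding spectral_ip_mv[OF sW]
      by (rule order.trans[OF norm_sum]) (auto intro!: sum_mono simp: norm_mult sgn_if)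
    hence "(cmod (ip S u (mv S W v)))\<^sup>2 \<le> (\<Sum>k<card S. cmod (ip S u (e k)) * cmod (ip S (e k) v))\<^sup>2"
      by (intro power_mono) auto
    also have "\<dots> \<le> (\<Sum>k<card S. (cmod (ip S u (e k)))\<^sup>2) * (\<Sum>k<card S. (cmod (ip S (e k) v))\<^sup>2)"
      by (rule Cauchy_Schwarz_ineq_sum)
    also have "\<dots> = nsq S u * nsq S v"
      by (simp only: onb_parseval[OF onb assms(2)])
    finally show "(cmod (ip S u (mv S W v)))\<^sup>2 \<le> nsq S u * nsq S v" .
  qed
  moreover have "trace_norm S X = Re (trace_prod S W X)"
  proof -
    have "trace_prod S W X = (\<Sum>k<card S. of_real (l k) * of_real (sgn (l k)))"
      unfolding trace_prod_spectral[OF s]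
      by (intro sum.cong refl) (auto simp: spectral_eigenvalue[OF sW])
    thus ?thesis by (simp add: trace_norm_spectral[OF s assms(2)] abs_sgn)
  qed
  ultimately show ?thesis by (rule that)
qed

lemma contraction_psd_bound:
  assumes "contraction S W" "psd_on S A" "finite S"
  shows "cmod (trace_prod S W A) \<le> Re (mtrace S A)"
proof -
  obtain e l where s: "spectral S A e l" "\<And>k. k < card S \<Longrightarrow> l k \<ge> 0"
    using psd_spectral[OF assms(2,3)] by blast
  have onb: "onb S e" using s by (simp add: spectral_def)
  have "cmod (trace_prod S W A) \<le> (\<Sum>k<card S. l k * 1)"
    unfolding trace_prod_spectral[OF s(1)]
  proof (intro order.trans[OF norm_sum] sum_mono)
    fix k assume k: "k \<in> {..<card S}"
    thus "cmod (of_real (l k) * ip S (e k) (mv S W (e k))) \<le> l k * 1"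
      unfolding norm_mult using s(2)[of k] contraction_unit[OF assms(1)] onb_nsq[OF onb, of k]
      by (intro mult_mono) auto
  qed
  thus ?thesis by (simp add: spectral_mtrace[OF s(1) assms(3)])
qed

section \<open>Entropy and a Pinsker-type inequality\<close>

lemma mv_cong: "(\<And>x. x \<in> S \<Longrightarrow> u x = v x) \<Longrightarrow> mv S A u = mv S A v"
  by (simp add: mv_def)

text \<open>A resolution of the identity is inserted between \<open>W\<close> and \<open>X\<close>.
  With \<open>e\<close> taken from \<open>A\<close> and \<open>f\<close> from \<open>B\<close>, the
  entries of \<open>B - lam A\<close> become an eigenvalue difference times an overlap.\<close>

lemma trace_prod_two_bases:
  assumes "onb S e" "onb S f" "finite S"
  shows "trace_prod S W X = (\<Sum>b<card S. \<Sum>a<card S. ip S (f b) (mv S W (e a)) * ip S (e a) (mv S X (f b)))"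
proof -
  have "(\<Sum>a<card S. ip S (f b) (mv S W (e a)) * ip S (e a) (mv S X (f b))) = ip S (f b) (mv S W (mv S X (f b)))" for b
  proof -
    have "mv S W (mv S X (f b)) = mv S W (\<lambda>x. \<Sum>a<card S. ip S (e a) (mv S X (f b)) * e a x)"
      by (rule mv_cong) (rule onb_expand[OF assms(1,3)])
    thus ?thesis by (simp add: mv_sum mv_scale ip_sum_right ip_scale_right mult.commute[of "ip S (f b) _"])
  qed
  moreover have "mv S W (mv S X v) = mv S (\<lambda>x y. \<Sum>z\<in>S. W x z * X z y) v" for v
    unfolding mv_def sum_distrib_left sum_distrib_right by (subst sum.swap) (simp add: mult_ac)
  ultimately have "(\<Sum>b<card S. \<Sum>a<card S. ip S (f b) (mv S W (e a)) * ip S (e a) (mv S X (f b)))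
      = mtrace S (\<lambda>x y. \<Sum>z\<in>S. W x z * X z y)"
    by (simp add: onb_mtrace[OF assms(2,3)])
  also have "\<dots> = trace_prod S W X"
    unfolding mtrace_def trace_prod_def by (rule sum.swap)
  finally show ?thesis by simp
qed

lemma contraction_mv:
  assumes "contraction S W"
  shows "nsq S (mv S W v) \<le> nsq S v"
proof -
  let ?N = "nsq S (mv S W v)"
  have "(cmod (ip S (mv S W v) (mv S W v)))\<^sup>2 \<le> ?N * nsq S v"
    using assms by (simp add: contraction_def)
  hence "?N * ?N \<le> ?N * nsq S v" by (simp add: ip_self power2_eq_square)
  thus ?thesis by (cases "?N = 0") (auto simp: order_less_le mult_le_cancel_left)
qed

lemma ip_mv_adjoint: "ip S u (mv S W v) = ip S (mv S (adjoint W) u) v"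
proof -
  have "ip S (mv S (adjoint W) u) v = (\<Sum>x\<in>S. \<Sum>y\<in>S. cnj (u y) * W y x * v x)"
    by (simp add: ip_def mv_def adjoint_def sum_distrib_left sum_distrib_right mult_ac)
  also have "\<dots> = ip S u (mv S W v)" unfolding ip_mv by (rule sum.swap)
  finally show ?thesis by simp
qed

lemma contraction_adjoint:
  assumes "contraction S W"
  shows "contraction S (adjoint W)"
  unfolding contraction_def
proof (intro allI)
  fix u v
  have "ip S u (mv S (adjoint W) v) = cnj (ip S v (mv S W u))"
    by (simp add: ip_mv_adjoint[of S v] ip_cnj)
  thus "(cmod (ip S u (mv S (adjoint W) v)))\<^sup>2 \<le> nsq S u * nsq S v"
    using assms unfolding contraction_def by (metis complex_mod_cnj mult.commute)
qed

text \<open>Parseval's identity combined with \<open>contraction_mv\<close>, once for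
  \<open>W\<close> and once for its adjoint.\<close>

lemma contraction_row_sum:
  assumes "contraction S W" "onb S e" "finite S" "nsq S v = 1"
  shows "(\<Sum>b<card S. (cmod (ip S (e b) (mv S W v)))\<^sup>2) \<le> 1"
    and "(\<Sum>a<card S. (cmod (ip S v (mv S W (e a))))\<^sup>2) \<le> 1"
  using contraction_mv[OF assms(1), of v] contraction_mv[OF contraction_adjoint[OF assms(1)], of v] assms(4)
  by (simp_all only: onb_parseval[OF assms(2,3)] ip_mv_adjoint[of S v])

text \<open>Apply \<open>ln x \<le> x - 1\<close> at \<open>x = sqrt (r / t)\<close>. The correction
  \<open>r - t\<close> makes each scalar term nonnegative by itself, so that the terms can later be
  weighted by squared overlaps.\<close>

lemma relative_entropy_ge:
  fixes t r :: real
  assumes "t \<ge> 0" "r \<ge> 0" "t > 0 \<Longrightarrow> r > 0"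
  shows "(sqrt t - sqrt r)\<^sup>2 \<le> t * ln t - t * ln r - t + r"
proof (cases "t = 0")
  case True
  thus ?thesis using assms by simp
next
  case False
  hence pos: "t > 0" "r > 0" using assms by auto
  have "ln (sqrt (r / t)) \<le> sqrt (r / t) - 1" using pos by (intro ln_le_minus_one) simp
  hence "ln r - ln t \<le> 2 * (sqrt (r / t) - 1)" using pos by (simp add: ln_sqrt ln_div)
  hence "t * (ln r - ln t) \<le> t * (2 * (sqrt (r / t) - 1))" using pos by (intro mult_left_mono) auto
  also have "t * sqrt (r / t) = sqrt t * sqrt r"
    using pos by (simp add: real_sqrt_divide field_simps)
  hence "t * (2 * (sqrt (r / t) - 1)) = 2 * (sqrt t * sqrt r) - 2 * t" by (simp add: algebra_simps)
  finally show ?thesis using pos by (simp add: power2_diff algebra_simps)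
qed

text \<open>Factor \<open>t - r\<close> into the difference and the sum of the square roots, and
  separate the two factors by the AM-GM inequality with balance \<open>c\<close>. Later
  \<open>w\<close> is an entry of a contraction and \<open>g\<close> an overlap of eigenvectors,
  which is why positivity of \<open>r\<close> is asked only where \<open>g\<close> is
  positive.\<close>

lemma weighted_diff_bound:
  fixes t r w g c :: real
  assumes "t \<ge> 0" "r \<ge> 0" "c > 0" "w \<ge> 0" "g \<ge> 0" "t > 0 \<Longrightarrow> g > 0 \<Longrightarrow> r > 0"
  shows "w * (g * \<bar>t - r\<bar>) \<le> c * (w\<^sup>2 * (t + r)) / 2 + g\<^sup>2 * (t * ln t - t * ln r - t + r) / c"
proof (cases "g = 0")
  case True
  thus ?thesis using assms by simp
next
  case False
  hence *: "(sqrt t - sqrt r)\<^sup>2 \<le> t * ln t - t * ln r - t + r"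
    using assms by (intro relative_entropy_ge) auto
  define s where "s = sqrt t + sqrt r"
  define q where "q = \<bar>sqrt t - sqrt r\<bar>"
  have "\<bar>t - r\<bar> = \<bar>(sqrt t - sqrt r) * s\<bar>"
    using assms(1,2) by (simp add: s_def algebra_simps)
  also have "\<dots> = q * s" using assms(1,2) by (simp add: abs_mult q_def s_def)
  finally have tr: "\<bar>t - r\<bar> = q * s" .
  have "0 \<le> (sqrt t - sqrt r)\<^sup>2" by simp
  hence ss: "s\<^sup>2 \<le> 2 * (t + r)"
    using assms(1,2) by (simp add: s_def power2_sum power2_diff)
  have rearrange: "c\<^sup>2 * w\<^sup>2 * (2 * (t + r)) / 4 + g\<^sup>2 * P = c * (c * (w\<^sup>2 * (t + r)) / 2 + g\<^sup>2 * P / c)" for P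
    using assms(3) by (simp add: field_simps power2_eq_square)
  have "0 \<le> (w * s * c / 2 - g * q)\<^sup>2" by simp
  hence "c * (w * (g * (q * s))) \<le> c\<^sup>2 * w\<^sup>2 * s\<^sup>2 / 4 + g\<^sup>2 * q\<^sup>2"
    by (simp add: power2_eq_square algebra_simps)
  also have "c\<^sup>2 * w\<^sup>2 * s\<^sup>2 / 4 \<le> c\<^sup>2 * w\<^sup>2 * (2 * (t + r)) / 4"
    using ss by (intro divide_right_mono mult_left_mono) auto
  also have "g\<^sup>2 * q\<^sup>2 \<le> g\<^sup>2 * (t * ln t - t * ln r - t + r)"
    using * by (intro mult_left_mono) (auto simp: q_def)
  also have "c\<^sup>2 * w\<^sup>2 * (2 * (t + r)) / 4 + g\<^sup>2 * (t * ln t - t * ln r - t + r)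
      = c * (c * (w\<^sup>2 * (t + r)) / 2 + g\<^sup>2 * (t * ln t - t * ln r - t + r) / c)"
    by (rule rearrange)
  finally have "c * (w * (g * (q * s))) \<le> c * (c * (w\<^sup>2 * (t + r)) / 2 + g\<^sup>2 * (t * ln t - t * ln r - t + r) / c)"
    by simp
  thus ?thesis unfolding tr using assms(3) by (rule mult_left_le_imp_le)
qed

lemma onb_overlap_sum:
  assumes "onb S e" "onb S f" "finite S"
  shows "k < card S \<Longrightarrow> (\<Sum>b<card S. (cmod (ip S (e k) (f b)))\<^sup>2) = 1"
    and "k < card S \<Longrightarrow> (\<Sum>a<card S. (cmod (ip S (e a) (f k)))\<^sup>2) = 1"
  by (simp_all add: onb_parseval assms onb_nsq)

text \<open>Since \<open>\<langle>e\<^sub>a, (B - \<lambda>A) f\<^sub>b\<rangle> = (t\<^sub>b - \<lambda> r\<^sub>a) \<langle>e\<^sub>a, f\<^sub>b\<rangle>\<close> in the eigenbases of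
  \<open>A\<close> and \<open>B\<close>, the quantum Pinsker inequality reduces to a scalar one. It is kept linear in the
  relative entropy by a free parameter \<open>c\<close>, so that it can be averaged without concavity
  arguments.\<close>

lemma pinsker_pair:
  assumes A: "spectral S A e r" "\<And>k. k < card S \<Longrightarrow> r k \<ge> 0"
    and B: "spectral S B f t" "\<And>k. k < card S \<Longrightarrow> t k \<ge> 0"
    and fin: "finite S" and W: "contraction S W" and lam: "lam \<ge> 0" and c: "c > 0"
    and supp: "\<And>a b. a < card S \<Longrightarrow> b < card S \<Longrightarrow> t b > 0 \<Longrightarrow> ip S (e a) (f b) \<noteq> 0 \<Longrightarrow> lam * r a > 0"
  shows "cmod (trace_prod S W (\<lambda>x y. B x y - of_real lam * A x y))
    \<le> c * ((\<Sum>b<card S. t b) + lam * (\<Sum>a<card S. r a)) / 2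
     + ((\<Sum>b<card S. t b * ln (t b)) - (\<Sum>a<card S. ln (lam * r a) * Re (ip S (e a) (mv S B (e a))))
        - (\<Sum>b<card S. t b) + lam * (\<Sum>a<card S. r a)) / c"
proof -
  let ?N = "card S"
  have onb: "onb S e" "onb S f" using A(1) B(1) by (auto simp: spectral_def)
  have hA: "herm_on S A" using spectral_psdI[OF A] psd_on_imp_herm_on fin by blast
  define g where "g = (\<lambda>a b. cmod (ip S (e a) (f b)))"
  define w where "w = (\<lambda>a b. cmod (ip S (f b) (mv S W (e a))))"
  let ?X = "\<lambda>x y. B x y - of_real lam * A x y"
  let ?\<phi> = "\<lambda>a b. t b * ln (t b) - t b * ln (lam * r a) - t b + lam * r a"
  have entry: "ip S (e a) (mv S ?X (f b)) = of_real (t b - lam * r a) * ip S (e a) (f b)"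
    if "a < ?N" "b < ?N" for a b
  proof -
    have "mv S ?X (f b) = (\<lambda>x. mv S B (f b) x - of_real lam * mv S A (f b) x)"
      by (simp add: mv_def left_diff_distrib sum_subtractf sum_distrib_left mult.assoc)
    moreover have "ip S (e a) (mv S B (f b)) = ip S (e a) (\<lambda>x. of_real (t b) * f b x)"
      by (rule ip_cong) (auto simp: spectral_mv[OF B(1) that(2)])
    moreover have "ip S (e a) (mv S A (f b)) = ip S (\<lambda>x. of_real (r a) * e a x) (f b)"
      unfolding ip_mv_herm[OF hA, symmetric]
      by (rule ip_cong) (auto simp: spectral_mv[OF A(1) that(1)])
    ultimately show ?thesis
      by (simp add: ip_diff_right ip_scale_right ip_scale_left algebra_simps)
  qed
  have "cmod (trace_prod S W ?X) \<le> (\<Sum>b<?N. \<Sum>a<?N. w a b * (g a b * \<bar>t b - lam * r a\<bar>))"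
    unfolding trace_prod_two_bases[OF onb fin]
  proof (intro order.trans[OF norm_sum] sum_mono)
    fix b a assume "b \<in> {..<?N}" "a \<in> {..<?N}"
    thus "cmod (ip S (f b) (mv S W (e a)) * ip S (e a) (mv S ?X (f b))) \<le> w a b * (g a b * \<bar>t b - lam * r a\<bar>)"
      by (simp only: lessThan_iff entry norm_mult norm_of_real) (simp add: w_def g_def mult_ac)
  qed
  also have "\<dots> \<le> (\<Sum>b<?N. \<Sum>a<?N. c * ((w a b)\<^sup>2 * (t b + lam * r a)) / 2 + (g a b)\<^sup>2 * ?\<phi> a b / c)"
    using A(2) B(2) lam c supp
    by (intro sum_mono weighted_diff_bound) (auto simp: w_def g_def)
  also have "\<dots> = c * ((\<Sum>b<?N. \<Sum>a<?N. (w a b)\<^sup>2 * t b) + (\<Sum>b<?N. \<Sum>a<?N. (w a b)\<^sup>2 * (lam * r a))) / 2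
      + (\<Sum>b<?N. \<Sum>a<?N. (g a b)\<^sup>2 * ?\<phi> a b) / c"
    by (simp add: sum.distrib sum_distrib_left sum_divide_distrib distrib_left add_divide_distrib)
  finally have main: "cmod (trace_prod S W ?X) \<le> c * ((\<Sum>b<?N. \<Sum>a<?N. (w a b)\<^sup>2 * t b) + (\<Sum>b<?N. \<Sum>a<?N. (w a b)\<^sup>2 * (lam * r a))) / 2
      + (\<Sum>b<?N. \<Sum>a<?N. (g a b)\<^sup>2 * ?\<phi> a b) / c" .
  \<comment> \<open>The entries of \<open>W\<close> between two orthonormal bases have rows and
    columns of square sum at most 1, so these weights leave at most the two traces.\<close>
  have 1: "(\<Sum>b<?N. \<Sum>a<?N. (w a b)\<^sup>2 * t b) \<le> (\<Sum>b<?N. 1 * t b)"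
    unfolding sum_distrib_right[symmetric] w_def using B(2)
    by (intro sum_mono mult_right_mono contraction_row_sum(2)[OF W onb(1) fin] onb_nsq[OF onb(2)]) auto
  have "(\<Sum>b<?N. \<Sum>a<?N. (w a b)\<^sup>2 * (lam * r a)) = (\<Sum>a<?N. \<Sum>b<?N. (w a b)\<^sup>2 * (lam * r a))"
    by (rule sum.swap)
  also have "\<dots> \<le> (\<Sum>a<?N. 1 * (lam * r a))"
    unfolding sum_distrib_right[symmetric] w_def using A(2) lam
    by (intro sum_mono mult_right_mono contraction_row_sum(1)[OF W onb(2) fin] onb_nsq[OF onb(1)]) auto
  finally have 2: "(\<Sum>b<?N. \<Sum>a<?N. (w a b)\<^sup>2 * (lam * r a)) \<le> lam * (\<Sum>a<?N. r a)"
    by (simp add: sum_distrib_left)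
  \<comment> \<open>The squared overlaps are doubly stochastic, and averaging \<open>t\<close>
    against them gives the diagonal of \<open>B\<close> in the eigenbasis of \<open>A\<close>. The
    total is the relative entropy of \<open>B\<close> with respect to \<open>lam A\<close>,
    including the trace correction.\<close>
  have 3: "(\<Sum>b<?N. \<Sum>a<?N. (g a b)\<^sup>2 * ?\<phi> a b) = ((\<Sum>b<?N. t b * ln (t b)) - (\<Sum>a<?N. ln (lam * r a) * Re (ip S (e a) (mv S B (e a))))
        - (\<Sum>b<?N. t b) + lam * (\<Sum>a<?N. r a))"
  proof -
    have Be: "Re (ip S (e a) (mv S B (e a))) = (\<Sum>b<?N. t b * (g a b)\<^sup>2)" for a
    proof -
      have "of_real (t b) * ip S (e a) (f b) * ip S (f b) (e a) = of_real (t b * (g a b)\<^sup>2)" for b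
        unfolding ip_cnj[of S "e a" "f b", symmetric] g_def complex_norm_square of_real_mult by simp
      hence "ip S (e a) (mv S B (e a)) = of_real (\<Sum>b<?N. t b * (g a b)\<^sup>2)"
        unfolding spectral_ip_mv[OF B(1)] by (simp only: of_real_sum)
      thus ?thesis by (simp only: Re_complex_of_real)
    qed
    have "(\<Sum>b<?N. \<Sum>a<?N. (g a b)\<^sup>2 * ?\<phi> a b) =
        (\<Sum>b<?N. \<Sum>a<?N. (g a b)\<^sup>2 * (t b * ln (t b) - t b))
        - (\<Sum>b<?N. \<Sum>a<?N. ln (lam * r a) * (t b * (g a b)\<^sup>2))
        + (\<Sum>b<?N. \<Sum>a<?N. (g a b)\<^sup>2 * (lam * r a))"
      by (simp add: sum.distrib sum_subtractf algebra_simps)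
    also have "(\<Sum>b<?N. \<Sum>a<?N. (g a b)\<^sup>2 * (t b * ln (t b) - t b)) = (\<Sum>b<?N. 1 * (t b * ln (t b) - t b))"
      unfolding sum_distrib_right[symmetric] g_def
      by (intro sum.cong refl) (simp add: onb_overlap_sum[OF onb fin])
    also have "(\<Sum>b<?N. \<Sum>a<?N. ln (lam * r a) * (t b * (g a b)\<^sup>2)) = (\<Sum>a<?N. ln (lam * r a) * Re (ip S (e a) (mv S B (e a))))"
      unfolding Be sum_distrib_left by (rule sum.swap)
    also have "(\<Sum>b<?N. \<Sum>a<?N. (g a b)\<^sup>2 * (lam * r a)) = (\<Sum>a<?N. \<Sum>b<?N. (g a b)\<^sup>2 * (lam * r a))"
      by (rule sum.swap)
    also have "\<dots> = (\<Sum>a<?N. 1 * (lam * r a))"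
      unfolding sum_distrib_right[symmetric] g_def
      by (intro sum.cong refl) (simp add: onb_overlap_sum[OF onb fin])
    finally show ?thesis by (simp add: sum_subtractf sum_distrib_left)
  qed
  have "c * ((\<Sum>b<?N. \<Sum>a<?N. (w a b)\<^sup>2 * t b) + (\<Sum>b<?N. \<Sum>a<?N. (w a b)\<^sup>2 * (lam * r a))) / 2
      \<le> c * ((\<Sum>b<?N. t b) + lam * (\<Sum>a<?N. r a)) / 2"
    using 1 2 c by (intro divide_right_mono mult_left_mono add_mono) auto
  thus ?thesis using main unfolding 3 by linarith
qed

section \<open>Entropies of unnormalised states\<close>

definition eta :: "real \<Rightarrow> real" where "eta t = t * ln t"

text \<open>An unnormalised entropy: for \<open>tr A = p > 0\<close> it equals \<open>p\<close> times the von Neumann entropy of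
  \<open>A / p\<close>.\<close>

definition ent :: "'a set \<Rightarrow> ('a \<Rightarrow> 'a \<Rightarrow> complex) \<Rightarrow> real" where
  "ent S A = (let l = (SOME l. \<exists>e. spectral S A e l) in
     eta (\<Sum>k<card S. l k) - (\<Sum>k<card S. eta (l k)))"

text \<open>\<open>ent\<close> picks its spectrum by \<open>SOME\<close>. This lemma exposes the
  picked eigenvalues together with an eigenbasis, and the bounds on \<open>ent\<close> are derived
  from it.\<close>

lemma ent_spectral:
  assumes "psd_on S A" "finite S"
  obtains e l where "spectral S A e l" "\<And>k. k < card S \<Longrightarrow> l k \<ge> 0"
    "Re (mtrace S A) = (\<Sum>k<card S. l k)"
    "ent S A = eta (Re (mtrace S A)) - (\<Sum>k<card S. eta (l k))"
proof -
  define l where "l = (SOME l. \<exists>e. spectral S A e l)"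
  have "\<exists>l e. spectral S A e l" using psd_spectral[OF assms] by metis
  hence "\<exists>e. spectral S A e l" unfolding l_def by (rule someI_ex)
  then obtain e where e: "spectral S A e l" ..
  show ?thesis
    using spectral_psd_nonneg[OF e assms(1)] spectral_mtrace[OF e assms(2)]
    by (intro that[OF e]) (auto simp: ent_def Let_def l_def)
qed

text \<open>Each eigenvalue is at most the trace, and \<open>ln\<close> is monotone.\<close>

lemma ent_nonneg:
  assumes "psd_on S A" "finite S"
  shows "ent S A \<ge> 0"
proof -
  obtain e l where l: "spectral S A e l" "\<And>k. k < card S \<Longrightarrow> l k \<ge> 0"
    "Re (mtrace S A) = (\<Sum>k<card S. l k)"
    "ent S A = eta (Re (mtrace S A)) - (\<Sum>k<card S. eta (l k))"
    using ent_spectral[OF assms] by metis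
  have "(\<Sum>k<card S. eta (l k)) \<le> (\<Sum>k<card S. l k * ln (\<Sum>k<card S. l k))"
  proof (intro sum_mono)
    fix k assume k: "k \<in> {..<card S}"
    have le: "l k \<le> (\<Sum>k<card S. l k)" using k l(2) by (intro member_le_sum) auto
    show "eta (l k) \<le> l k * ln (\<Sum>k<card S. l k)"
    proof (cases "l k = 0")
      case False
      hence "l k > 0" using l(2) k by (simp add: order_less_le)
      thus ?thesis using le by (auto simp: eta_def intro!: mult_left_mono)
    qed (simp add: eta_def)
  qed
  thus ?thesis unfolding l(3,4) by (simp add: eta_def sum_distrib_right)
qed

text \<open>Gibbs' inequality against the uniform distribution, that is,
  \<open>ln x \<le> x - 1\<close> at \<open>x = 1 / (l k * card S)\<close>.\<close>

lemma ent_le_ln_card: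
  assumes "psd_on S A" "finite S" "Re (mtrace S A) = 1"
  shows "ent S A \<le> ln (card S)"
proof -
  obtain e l where l: "spectral S A e l" "\<And>k. k < card S \<Longrightarrow> l k \<ge> 0"
    "Re (mtrace S A) = (\<Sum>k<card S. l k)"
    "ent S A = eta (Re (mtrace S A)) - (\<Sum>k<card S. eta (l k))"
    using ent_spectral[OF assms(1,2)] by metis
  have pos: "card S > 0" using l(3) assms(3) by (cases "card S = 0") auto
  have "(\<Sum>k<card S. - eta (l k) - l k * ln (card S)) \<le> (\<Sum>k<card S. 1 / card S - l k)"
  proof (intro sum_mono)
    fix k assume k: "k \<in> {..<card S}"
    show "- eta (l k) - l k * ln (card S) \<le> 1 / card S - l k"
    proof (cases "l k = 0")
      case False
      hence lk: "l k > 0" using l(2) k by (simp add: order_less_le)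
      have "l k * ln (1 / (l k * card S)) \<le> l k * (1 / (l k * card S) - 1)"
        using lk pos by (intro mult_left_mono ln_le_minus_one) auto
      also have "l k * (1 / (l k * card S) - 1) = 1 / card S - l k"
        using lk pos by (simp add: right_diff_distrib)
      also have "ln (1 / (l k * card S)) = - ln (l k) - ln (card S)"
        using lk pos by (simp add: ln_div ln_mult)
      finally show ?thesis by (simp add: eta_def algebra_simps)
    qed (simp add: eta_def)
  qed
  thus ?thesis using l(3) assms(3) pos unfolding l(4)
    by (simp add: sum_subtractf sum_negf eta_def flip: sum_distrib_right)
qed

text \<open>Each \<open>B x\<close> is compared with its share of \<open>A\<close>, the multiple of
  \<open>A\<close> that has the same trace. The relative entropies add up to exactly the entropy
  gap, because only the diagonals of the \<open>B x\<close> in the eigenbasis of \<open>A\<close>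
  enter and these sum to the eigenvalues of \<open>A\<close>. The bound of
  \<open>pinsker_pair\<close> is linear in the relative entropy and so survives the
  summation.\<close>

lemma entropy_gap:
  assumes A: "psd_on S A" and fin: "finite S" "finite X"
    and B: "\<And>x. x \<in> X \<Longrightarrow> psd_on S (B x)"
    and sum: "\<And>u v. u \<in> S \<Longrightarrow> v \<in> S \<Longrightarrow> A u v = (\<Sum>x\<in>X. B x u v)"
    and W: "\<And>x. x \<in> X \<Longrightarrow> contraction S (W x)" and c: "c > 0"
  shows "(\<Sum>x\<in>X. cmod (trace_prod S (W x) (\<lambda>u v. B x u v - of_real (Re (mtrace S (B x)) / Re (mtrace S A)) * A u v)))
    \<le> c * Re (mtrace S A) + (ent S A - (\<Sum>x\<in>X. ent S (B x))) / c"
proof -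
  let ?N = "card S"
  define p where "p = Re (mtrace S A)"
  define q where "q = (\<lambda>x. Re (mtrace S (B x)))"
  obtain e r where r: "spectral S A e r" "\<And>k. k < ?N \<Longrightarrow> r k \<ge> 0"
    "p = (\<Sum>k<?N. r k)" "ent S A = eta p - (\<Sum>k<?N. eta (r k))"
    unfolding p_def using ent_spectral[OF A fin(1)] by metis
  have onb: "onb S e" using r(1) by (simp add: spectral_def)
  define \<beta> where "\<beta> = (\<lambda>x a. Re (ip S (e a) (mv S (B x) (e a))))"
  have \<beta>0: "\<beta> x a \<ge> 0" if "x \<in> X" for x a
    using B[OF that] by (simp add: \<beta>_def psd_on_ip)
  have q\<beta>: "q x = (\<Sum>a<?N. \<beta> x a)" for x
    using arg_cong[OF onb_mtrace[OF onb fin(1), of "B x"], of Re] by (simp add: q_def \<beta>_def)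
  have r\<beta>: "r a = (\<Sum>x\<in>X. \<beta> x a)" if "a < ?N" for a
  proof -
    have "ip S (e a) (mv S A (e a)) = ip S (e a) (mv S (\<lambda>u v. \<Sum>x\<in>X. B x u v) (e a))"
      by (rule ip_cong) (auto simp: mv_def sum)
    also have "mv S (\<lambda>u v. \<Sum>x\<in>X. B x u v) (e a) = (\<lambda>u. \<Sum>x\<in>X. mv S (B x) (e a) u)"
      unfolding mv_def sum_distrib_right by (intro ext sum.swap)
    finally have "of_real (r a) = (\<Sum>x\<in>X. ip S (e a) (mv S (B x) (e a)))"
      by (simp add: ip_sum_right spectral_eigenvalue[OF r(1) that])
    thus ?thesis unfolding \<beta>_def by (metis Re_complex_of_real Re_sum)
  qed
  have q0: "q x \<ge> 0" if "x \<in> X" for x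
    unfolding q\<beta> using \<beta>0[OF that] by (intro sum_nonneg) auto
  have pq: "p = (\<Sum>x\<in>X. q x)"
    unfolding q\<beta> r(3) by (subst sum.swap) (simp add: r\<beta>)
  have qp: "q x \<le> p" if "x \<in> X" for x
    unfolding pq using that q0 fin(2) by (intro member_le_sum) auto
  \<comment> \<open>If \<open>p = 0\<close>, the convention on division gives
    \<open>lam x = 0\<close>, and \<open>q x \<le> p\<close> keeps \<open>lam x * p = q x\<close>
    true.\<close>
  define lam where "lam = (\<lambda>x. q x / p)"
  have lam: "lam x \<ge> 0" "lam x * p = q x" if "x \<in> X" for x
    using q0[OF that] qp[OF that] by (auto simp: lam_def)
  have each: "cmod (trace_prod S (W x) (\<lambda>u v. B x u v - of_real (lam x) * A u v))
     \<le> c * q x + (- ent S (B x) + q x * ln p - (\<Sum>a<?N. ln (r a) * \<beta> x a)) / c" if x: "x \<in> X" for x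
  proof -
    obtain f t where t: "spectral S (B x) f t" "\<And>k. k < ?N \<Longrightarrow> t k \<ge> 0"
      "q x = (\<Sum>k<?N. t k)" "ent S (B x) = eta (q x) - (\<Sum>k<?N. eta (t k))"
      unfolding q_def using ent_spectral[OF B[OF x] fin(1)] by metis
    \<comment> \<open>A diagonal entry of \<open>B x\<close> is dominated by that of
      \<open>A\<close> and by the trace of \<open>B x\<close>; this yields the support condition of
      \<open>pinsker_pair\<close>.\<close>
    have \<beta>pos: "lam x > 0 \<and> r a > 0" if "\<beta> x a > 0" "a < ?N" for a
    proof -
      have "\<beta> x a \<le> q x" unfolding q\<beta> using that \<beta>0[OF x] by (intro member_le_sum) auto
      moreover have "\<beta> x a \<le> r a" unfolding r\<beta>[OF that(2)] using x \<beta>0 fin(2)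
        by (intro member_le_sum) auto
      ultimately show ?thesis using that(1) qp[OF x] by (auto simp: lam_def)
    qed
    have \<beta>t: "\<beta> x a = (\<Sum>b<?N. t b * (cmod (ip S (e a) (f b)))\<^sup>2)" for a
    proof -
      have "of_real (t b) * ip S (e a) (f b) * ip S (f b) (e a) = of_real (t b * (cmod (ip S (e a) (f b)))\<^sup>2)" for b
        unfolding ip_cnj[of S "e a" "f b", symmetric] complex_norm_square of_real_mult by simp
      hence "ip S (e a) (mv S (B x) (e a)) = of_real (\<Sum>b<?N. t b * (cmod (ip S (e a) (f b)))\<^sup>2)"
        unfolding spectral_ip_mv[OF t(1)] by (simp only: of_real_sum)
      thus ?thesis by (simp only: \<beta>_def Re_complex_of_real)
    qed
    have supp: "lam x * r a > 0" if "a < ?N" "b < ?N" "t b > 0" "ip S (e a) (f b) \<noteq> 0" for a b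
    proof -
      have "0 < t b * (cmod (ip S (e a) (f b)))\<^sup>2" using that by simp
      also have "\<dots> \<le> \<beta> x a" unfolding \<beta>t using that t(2) by (intro member_le_sum) auto
      finally show ?thesis using \<beta>pos that by simp
    qed
    have "cmod (trace_prod S (W x) (\<lambda>u v. B x u v - of_real (lam x) * A u v))
      \<le> c * (q x + lam x * p) / 2 + ((\<Sum>b<?N. eta (t b)) - (\<Sum>a<?N. ln (lam x * r a) * \<beta> x a)
        - q x + lam x * p) / c"
      using pinsker_pair[OF r(1,2) t(1,2) fin(1) W[OF x] lam(1)[OF x] c supp]
      unfolding r(3) t(3) \<beta>_def eta_def by simp
    also have "(\<Sum>a<?N. ln (lam x * r a) * \<beta> x a) = (\<Sum>a<?N. ln (lam x) * \<beta> x a + ln (r a) * \<beta> x a)"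
    proof (intro sum.cong refl)
      fix a assume a: "a \<in> {..<?N}"
      show "ln (lam x * r a) * \<beta> x a = ln (lam x) * \<beta> x a + ln (r a) * \<beta> x a"
      proof (cases "\<beta> x a = 0")
        case False
        hence "\<beta> x a > 0" using \<beta>0[OF x, of a] by linarith
        thus ?thesis using \<beta>pos[of a] a by (simp add: ln_mult algebra_simps)
      qed simp
    qed
    also have "\<dots> = q x * ln (lam x) + (\<Sum>a<?N. ln (r a) * \<beta> x a)"
      by (simp add: sum.distrib q\<beta> mult.commute flip: sum_distrib_left)
    also have "q x * ln (lam x) = eta (q x) - q x * ln p"
    proof (cases "q x = 0")
      case False
      hence "q x > 0" "p > 0" using q0[OF x] qp[OF x] by auto
      thus ?thesis by (simp add: lam_def ln_div eta_def algebra_simps)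
    qed (simp add: eta_def)
    finally show ?thesis unfolding t(4) lam(2)[OF x] by (simp add: algebra_simps)
  qed
  have "(\<Sum>x\<in>X. cmod (trace_prod S (W x) (\<lambda>u v. B x u v - of_real (lam x) * A u v)))
     \<le> (\<Sum>x\<in>X. c * q x + (- ent S (B x) + q x * ln p - (\<Sum>a<?N. ln (r a) * \<beta> x a)) / c)"
    by (intro sum_mono each)
  also have "\<dots> = c * p + (- (\<Sum>x\<in>X. ent S (B x)) + p * ln p - (\<Sum>x\<in>X. \<Sum>a<?N. ln (r a) * \<beta> x a)) / c"
    by (simp add: sum.distrib sum_subtractf sum_negf pq sum_distrib_left sum_distrib_right flip: sum_divide_distrib)
  \<comment> \<open>Here the diagonals are summed over \<open>x\<close>, and the cross terms with
    \<open>ln (r a)\<close> assemble to the entropy of \<open>A\<close>.\<close>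
  also have "(\<Sum>x\<in>X. \<Sum>a<?N. ln (r a) * \<beta> x a) = (\<Sum>a<?N. eta (r a))"
  proof (subst sum.swap, intro sum.cong refl)
    fix a assume "a \<in> {..<?N}"
    hence ra: "r a = (\<Sum>x\<in>X. \<beta> x a)" using r\<beta> by simp
    show "(\<Sum>x\<in>X. ln (r a) * \<beta> x a) = eta (r a)"
      by (simp only: sum_distrib_left[symmetric] ra[symmetric] eta_def mult.commute)
  qed
  finally show ?thesis unfolding r(4) lam_def p_def q_def eta_def by (simp add: algebra_simps)
qed

text \<open>Taking \<open>W = 0\<close> in \<open>entropy_gap\<close> gives
  \<open>0 \<le> c * p + gap / c\<close> for every \<open>c > 0\<close>; a small \<open>c\<close>
  rules out a negative gap.\<close>

lemma entropy_superadditive: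
  assumes "psd_on S A" "finite S" "finite X" "\<And>x. x \<in> X \<Longrightarrow> psd_on S (B x)"
    and "\<And>u v. u \<in> S \<Longrightarrow> v \<in> S \<Longrightarrow> A u v = (\<Sum>x\<in>X. B x u v)"
  shows "(\<Sum>x\<in>X. ent S (B x)) \<le> ent S A"
proof -
  define p where "p = Re (mtrace S A)"
  have p0: "p \<ge> 0" unfolding p_def using psd_mtrace(2)[OF assms(1,2)] .
  have c0: "contraction S (\<lambda>x y. 0)" by (simp add: contraction_def ip_def mv_def)
  have "0 \<le> c * p + (ent S A - (\<Sum>x\<in>X. ent S (B x))) / c" if "c > 0" for c
    unfolding p_def
    by (rule order.trans[OF _ entropy_gap[where W = "\<lambda>x. \<lambda>u v. 0", OF assms c0 that]])
      (auto intro: sum_nonneg)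
  note key = this
  show ?thesis
  proof (rule ccontr)
    assume not_le: "\<not> ?thesis"
    define g where "g = (\<Sum>x\<in>X. ent S (B x)) - ent S A"
    have g: "g > 0" using not_le by (simp add: g_def)
    \<comment> \<open>Small enough for \<open>c * p < g\<close>, and at most 1 so that
      \<open>g \<le> g / c\<close>.\<close>
    define c where "c = min 1 (g / (2 * (p + 1)))"
    have c: "c > 0" "c \<le> 1" "c \<le> g / (2 * (p + 1))" using g p0 by (auto simp: c_def)
    have "c * p \<le> g / (2 * (p + 1)) * p" using c p0 by (intro mult_right_mono) auto
    also have "\<dots> < g" using g p0 by (simp add: field_simps) (simp add: add_nonneg_pos)
    also have "g \<le> g / c" using c g by (simp add: field_simps)
    finally have "c * p < g / c" .
    moreover have "(ent S A - (\<Sum>x\<in>X. ent S (B x))) / c = - (g / c)" unfolding g_def minus_divide_left by simp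
    ultimately show False using key[OF c(1)] by linarith
  qed
qed

section \<open>A projective 2-design\<close>

text \<open>If \<open>a\<close> or \<open>c\<close> is 0, parity together with size determines the
  rest. Otherwise the sum is even and at least 4, so \<open>b\<close> and \<open>e\<close> are
  positive too, and a factor 2 can be cancelled from both sides.\<close>

lemma sum_two_powers_eq_iff:
  "(2::nat) ^ a + 2 ^ c = 2 ^ b + 2 ^ e \<longleftrightarrow> a = b \<and> c = e \<or> a = e \<and> c = b"
proof
  assume "(2::nat) ^ a + 2 ^ c = 2 ^ b + 2 ^ e"
  thus "a = b \<and> c = e \<or> a = e \<and> c = b"
  proof (induction a arbitrary: b c e)
    case 0
    show ?case
    proof (cases c)
      case c: 0
      have "(2::nat) ^ b \<ge> 1" "(2::nat) ^ e \<ge> 1" by simp_all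
      moreover have "(2::nat) ^ b + 2 ^ e = 2" using 0 c by simp
      ultimately have "(2::nat) ^ b = 1" "(2::nat) ^ e = 1" by linarith+
      thus ?thesis using c by simp
    next
      case (Suc c')
      hence odd: "odd ((2::nat) ^ b + 2 ^ e)" using 0 by (metis even_add even_power even_numeral odd_one power_0 zero_less_Suc)
      hence "b = 0 \<or> e = 0" by auto
      thus ?thesis using 0 by auto
    qed
  next
    case (Suc a)
    show ?case
    proof (cases c)
      case 0
      hence odd: "odd ((2::nat) ^ b + 2 ^ e)" using Suc.prems by (metis even_add even_power even_numeral odd_one power_0 zero_less_Suc)
      hence "b = 0 \<or> e = 0" by auto
      moreover have "(2::nat) ^ Suc a = 2 ^ k \<longleftrightarrow> Suc a = k" for k by (rule power_inject_exp) simp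
      ultimately show ?thesis using Suc.prems 0 by (auto simp del: power_Suc)
    next
      case c: (Suc c')
      have ge: "(2::nat) ^ Suc a + 2 ^ c \<ge> 4"
        unfolding c power_Suc using one_le_power[of "2::nat" a] one_le_power[of "2::nat" c'] by linarith
      have "even ((2::nat) ^ b + 2 ^ e)" using Suc.prems c by (metis even_add even_power even_numeral zero_less_Suc)
      hence be: "b = 0 \<longleftrightarrow> e = 0" by auto
      show ?thesis
      proof (cases b)
        case 0
        thus ?thesis using be ge Suc.prems by simp
      next
        case b: (Suc b')
        then obtain e' where e: "e = Suc e'" using be by (cases e) auto
        have "(2::nat) ^ a + 2 ^ c' = 2 ^ b' + 2 ^ e'" using Suc.prems b c e by simp
        from Suc.IH[OF this] show ?thesis using b c e by simp
      qed
    qed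
  qed
qed auto

text \<open>Since \<open>\<bar>k\<bar> < N\<close>, the root of unity differs from 1 unless
  \<open>k = 0\<close>, and then the geometric sum vanishes.\<close>

lemma sum_roots_of_unity:
  fixes k :: int and N :: nat
  assumes "\<bar>k\<bar> < int N"
  shows "(\<Sum>t<N. cis (2 * pi * real t * of_int k / real N)) = (if k = 0 then of_nat N else 0)"
proof (cases "k = 0")
  case False
  define \<omega> where "\<omega> = cis (2 * pi * of_int k / real N)"
  have N: "N > 0" using assms by simp
  have pow: "cis (2 * pi * real t * of_int k / real N) = \<omega> ^ t" for t
    unfolding \<omega>_def Complex.DeMoivre by (intro arg_cong[of _ _ cis]) (simp add: field_simps)
  have "\<omega> ^ N = cis (2 * pi * of_int k)" using N by (simp add: \<omega>_def Complex.DeMoivre)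
  also have "\<dots> = 1" by (rule cis_multiple_2pi) simp
  finally have "\<omega> ^ N = 1" .
  have "\<omega> \<noteq> 1"
  proof
    assume "\<omega> = 1"
    hence "cos (2 * pi * of_int k / real N) = 1" by (simp add: \<omega>_def complex_eq_iff)
    then obtain m :: int where "2 * pi * of_int k / real N = of_int m * 2 * pi"
      using cos_one_2pi_int by blast
    hence "real_of_int k = of_int m * real N" using N by (simp add: field_simps)
    hence km: "k = m * int N" by (metis of_int_eq_iff of_int_mult of_int_of_nat_eq)
    hence "m \<noteq> 0" using False by auto
    hence "\<bar>m\<bar> * int N \<ge> 1 * int N" by (intro mult_right_mono) auto
    thus False using assms km by (simp add: abs_mult)
  qed
  have "(\<Sum>t<N. \<omega> ^ t) = 0"
    using geometric_sum[OF \<open>\<omega> \<noteq> 1\<close>, of N] \<open>\<omega> ^ N = 1\<close> by simp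
  thus ?thesis using False by (simp add: pow)
qed simp

text \<open>A weighted complex projective 2-design with \<open>d + 2\<^sup>d\<close> elements: the computational basis,
  together with the phase vectors \<open>d\<^sup>-\<^sup>1\<^sup>/\<^sup>2 \<Sum>\<^sub>a \<omega>\<^bsup>t 2\<^sup>a\<^esup> |a\<rangle>\<close> for \<open>t < 2\<^sup>d\<close>, \<open>\<omega>\<close> a primitive \<open>2\<^sup>d\<close>-th root of
  unity. The powers of 2 form a Sidon set, which gives the fourth moments of the phases.\<close>

definition design_vec :: "nat \<Rightarrow> nat \<Rightarrow> nat \<Rightarrow> complex" where
  "design_vec d x a = (if x < d then of_bool (a = x)
     else cis (2 * pi * real (x - d) * 2 ^ a / 2 ^ d) / of_real (sqrt (real d)))"

text \<open>The phase vectors alone produce \<open>1 / (d + 1)\<close> whenever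
  \<open>{a, c}\<close> and \<open>{b, e}\<close> agree as multisets, which is one unit too few when
  all four indices coincide, since both pairings hold there. The basis vectors, with weight
  \<open>1 / (d + 1)\<close>, supply exactly this missing unit.\<close>

definition design_weight :: "nat \<Rightarrow> nat \<Rightarrow> real" where
  "design_weight d x = (if x < d then 1 / (real d + 1) else (real d)\<^sup>2 / ((real d + 1) * 2 ^ d))"

abbreviation outcomes :: "nat \<Rightarrow> nat set" where
  "outcomes d \<equiv> {..<d + 2 ^ d}"

lemma sum_outcomes: "(\<Sum>x\<in>outcomes d. f x) = (\<Sum>x<d. f x) + (\<Sum>t<2 ^ d. f (d + t))"
  by (simp add: sum.nat_group[symmetric] lessThan_atLeast0 sum.atLeastLessThan_concat[symmetric, of 0 d "d + 2 ^ d"]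
      sum.shift_bounds_nat_ivl[of f 0 d "2 ^ d", simplified add.commute[of _ d], simplified])

lemma design_weight_pos: "d > 0 \<Longrightarrow> design_weight d x > 0"
  by (simp add: design_weight_def)

lemma nsq_design_vec:
  assumes "d > 0"
  shows "x \<in> outcomes d \<Longrightarrow> nsq {..<d} (design_vec d x) = 1"
proof -
  have "(cmod (design_vec d x a))\<^sup>2 = (if x < d then of_bool (a = x) else 1 / d)" for a
    using assms by (auto simp: design_vec_def norm_divide power_divide)
  thus ?thesis using assms by (cases "x < d") (simp_all add: nsq_def)
qed

lemma design_fourth_moment:
  assumes "a < d" "b < d" "c < d" "e < d"
  shows "(\<Sum>x\<in>outcomes d. of_real (design_weight d x) * (design_vec d x a * cnj (design_vec d x b) * (design_vec d x c * cnj (design_vec d x e))))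
    = (of_bool (a = b \<and> c = e) + of_bool (a = e \<and> c = b)) / (of_nat d + 1)"
proof -
  have d: "d > 0" using assms by simp
  have "(\<Sum>x<d. of_real (design_weight d x) * (design_vec d x a * cnj (design_vec d x b) * (design_vec d x c * cnj (design_vec d x e))))
      = (\<Sum>x<d. if x = a then of_bool (a = b \<and> c = a \<and> e = a) / (of_nat d + 1) else 0)"
    by (intro sum.cong) (auto simp: design_weight_def design_vec_def)
  also have "\<dots> = of_bool (a = b \<and> c = a \<and> e = a) / (of_nat d + 1)"
    using assms by simp
  finally have 1: "(\<Sum>x<d. of_real (design_weight d x) * (design_vec d x a * cnj (design_vec d x b) * (design_vec d x c * cnj (design_vec d x e)))) = \<dots>" .
  \<comment> \<open>The frequency left after multiplying the four phases. Each power of 2 is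
    positive and at most \<open>2 ^ (d - 1)\<close>, so \<open>\<bar>k\<bar> < 2 ^ d\<close>, and
    the sum over \<open>t\<close> detects exactly \<open>k = 0\<close>.\<close>
  define k where "k = (2::int) ^ a + 2 ^ c - 2 ^ b - 2 ^ e"
  have le: "(2::int) ^ j \<le> 2 ^ (d - 1)" "(2::int) ^ j > 0" if "j < d" for j
    using that by (auto intro!: power_increasing)
  have pd: "int (2 ^ d) = 2 * 2 ^ (d - 1)" using d by (cases d) auto
  have k: "\<bar>k\<bar> < int (2 ^ d)"
    unfolding pd k_def abs_less_iff
    using le[OF assms(1)] le[OF assms(2)] le[OF assms(3)] le[OF assms(4)] by linarith
  have "k = 0 \<longleftrightarrow> int (2 ^ a + 2 ^ c) = int (2 ^ b + 2 ^ e)" by (auto simp: k_def)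
  also have "\<dots> \<longleftrightarrow> a = b \<and> c = e \<or> a = e \<and> c = b"
    unfolding of_nat_eq_iff by (rule sum_two_powers_eq_iff)
  finally have k0: "k = 0 \<longleftrightarrow> a = b \<and> c = e \<or> a = e \<and> c = b" .
  have sq: "complex_of_real (sqrt (real d)) * of_real (sqrt (real d)) = of_nat d"
    by (simp flip: of_real_mult)
  have "design_vec d (d + t) a * cnj (design_vec d (d + t) b) * (design_vec d (d + t) c * cnj (design_vec d (d + t) e))
      = cis (2 * pi * real t * of_int k / real (2 ^ d)) / (of_nat d)\<^sup>2" for t
  proof -
    have "design_vec d (d + t) a * cnj (design_vec d (d + t) b) * (design_vec d (d + t) c * cnj (design_vec d (d + t) e))
      = cis (2 * pi * real t * 2 ^ a / 2 ^ d) * cis (- (2 * pi * real t * 2 ^ b / 2 ^ d)) *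
         (cis (2 * pi * real t * 2 ^ c / 2 ^ d) * cis (- (2 * pi * real t * 2 ^ e / 2 ^ d))) / (of_nat d * of_nat d)"
      unfolding sq[symmetric] by (simp add: design_vec_def cis_cnj)
    also have "\<dots> = cis (2 * pi * real t * of_int k / real (2 ^ d)) / (of_nat d * of_nat d)"
      by (simp add: cis_mult k_def algebra_simps add_divide_distrib diff_divide_distrib)
    finally show ?thesis by (simp add: power2_eq_square)
  qed
  hence "(\<Sum>t<2 ^ d. of_real (design_weight d (d + t)) * (design_vec d (d + t) a * cnj (design_vec d (d + t) b) * (design_vec d (d + t) c * cnj (design_vec d (d + t) e))))
      = of_nat d ^ 2 / ((of_nat d + 1) * 2 ^ d) * ((\<Sum>t<2 ^ d. cis (2 * pi * real t * of_int k / real (2 ^ d))) / (of_nat d)\<^sup>2)"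
    by (simp add: design_weight_def sum_distrib_left sum_divide_distrib)
  also have "\<dots> = of_bool (k = 0) / (of_nat d + 1)"
    unfolding sum_roots_of_unity[OF k] using d by simp
  finally have 2: "(\<Sum>t<2 ^ d. of_real (design_weight d (d + t)) * (design_vec d (d + t) a * cnj (design_vec d (d + t) b) * (design_vec d (d + t) c * cnj (design_vec d (d + t) e)))) = \<dots>" .
  show ?thesis unfolding sum_outcomes 1 2 k0 by (auto simp: add_divide_distrib)
qed

text \<open>A 2-design is a 1-design: insert the squared norm 1 of the design vectors and contract
  the fourth moment over the index \<open>c\<close>.\<close>

lemma design_second_moment:
  assumes "a < d" "b < d"
  shows "(\<Sum>x\<in>outcomes d. of_real (design_weight d x) * (design_vec d x a * cnj (design_vec d x b))) = of_bool (a = b)"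
proof -
  have d: "d > 0" using assms by simp
  have n: "(\<Sum>c<d. design_vec d x c * cnj (design_vec d x c)) = 1" if "x \<in> outcomes d" for x
    using ip_self[of "{..<d}" "design_vec d x"] nsq_design_vec[OF d that] by (simp add: ip_def mult.commute)
  have "(\<Sum>x\<in>outcomes d. of_real (design_weight d x) * (design_vec d x a * cnj (design_vec d x b)))
     = (\<Sum>x\<in>outcomes d. of_real (design_weight d x) * (design_vec d x a * cnj (design_vec d x b)) * (\<Sum>c<d. design_vec d x c * cnj (design_vec d x c)))"
    by (intro sum.cong refl) (simp only: n mult_1_right)
  also have "\<dots> = (\<Sum>c<d. \<Sum>x\<in>outcomes d. of_real (design_weight d x) * (design_vec d x a * cnj (design_vec d x b) * (design_vec d x c * cnj (design_vec d x c))))"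
    unfolding sum_distrib_left by (subst sum.swap) (simp add: mult.assoc)
  also have "\<dots> = (\<Sum>c<d. (of_bool (a = b) + of_bool (a = c \<and> c = b)) / (of_nat d + 1))"
    using assms by (intro sum.cong refl) (simp add: design_fourth_moment)
  also have "\<dots> = (\<Sum>c<d. of_bool (a = b) / (of_nat d + 1) + (if c = a then of_bool (a = b) / (of_nat d + 1) else 0))"
    by (intro sum.cong) (auto simp: add_divide_distrib)
  also have "\<dots> = (of_nat d + 1) * (of_bool (a = b) / (of_nat d + 1))"
  proof -
    define q :: complex where "q = of_bool (a = b) / (of_nat d + 1)"
    show ?thesis unfolding q_def[symmetric] using assms by (simp add: sum.distrib algebra_simps)
  qed
  also have "\<dots> = of_bool (a = b)"
    by (metis nonzero_mult_div_cancel_left of_nat_Suc of_nat_neq_0 times_divide_eq_right add.commute)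
  finally show ?thesis .
qed

section \<open>Conditional states\<close>

lemma sum_PiE_insert:
  assumes "j \<notin> C"
  shows "(\<Sum>z\<in>PiE (insert j C) (\<lambda>_. X). f z) = (\<Sum>z\<in>PiE C (\<lambda>_. X). \<Sum>s\<in>X. f (z(j := s)))"
proof -
  have "(\<Sum>z\<in>PiE (insert j C) (\<lambda>_. X). f z) = (\<Sum>(s, z)\<in>X \<times> PiE C (\<lambda>_. X). f (z(j := s)))"
    unfolding PiE_insert_eq
    by (subst sum.reindex[OF inj_combinator[OF assms]]) (auto intro!: sum.cong)
  also have "\<dots> = (\<Sum>s\<in>X. \<Sum>z\<in>PiE C (\<lambda>_. X). f (z(j := s)))"
    by (simp add: sum.cartesian_product)
  finally show ?thesis by (simp add: sum.swap[of _ X])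
qed

lemma cfg_0: "cfg 0 d = {\<lambda>_. 0}"
  by (auto simp: cfg_def)

lemma cfg_Suc: "bij_betw (\<lambda>(x, a). x(n := a)) (cfg n d \<times> {..<d}) (cfg (Suc n) d)"
  unfolding bij_betw_def
proof
  show "inj_on (\<lambda>(x, a). x(n := a)) (cfg n d \<times> {..<d})"
  proof (rule inj_onI, clarify)
    fix x a y b assume "x \<in> cfg n d" "y \<in> cfg n d" and eq: "x(n := a) = y(n := b)"
    moreover from eq have "a = b" by (metis fun_upd_same)
    moreover have "x k = y k" for k
    proof (cases "k = n")
      case True
      thus ?thesis using calculation(1,2) by (simp add: cfg_def)
    next
      case False
      thus ?thesis using fun_cong[OF eq, of k] by simp
    qed
    ultimately show "x = y \<and> a = b" by auto
  qed
  show "(\<lambda>(x, a). x(n := a)) ` (cfg n d \<times> {..<d}) = cfg (Suc n) d"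
  proof (intro equalityI subsetI)
    fix x assume x: "x \<in> cfg (Suc n) d"
    hence "x(n := 0) \<in> cfg n d" "x n < d" by (auto simp: cfg_def)
    moreover have "x = (x(n := 0))(n := x n)" by simp
    ultimately show "x \<in> (\<lambda>(x, a). x(n := a)) ` (cfg n d \<times> {..<d})"
      by (intro image_eqI[of _ _ "(x(n := 0), x n)"]) auto
  qed (auto simp: cfg_def)
qed

lemma finite_cfg: "finite (cfg n d)"
proof (induction n)
  case (Suc n)
  thus ?case using bij_betw_finite[OF cfg_Suc[of n d]] by simp
qed (simp add: cfg_0)

lemma sum_cfg_prod:
  fixes g :: "nat \<Rightarrow> nat \<Rightarrow> complex"
  shows "(\<Sum>x\<in>cfg n d. \<Prod>k<n. g k (x k)) = (\<Prod>k<n. \<Sum>a<d. g k a)"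
proof (induction n)
  case (Suc n)
  have "(\<Sum>x\<in>cfg (Suc n) d. \<Prod>k<Suc n. g k (x k))
      = (\<Sum>(x, a)\<in>cfg n d \<times> {..<d}. (\<Prod>k<n. g k (x k)) * g n a)"
    by (subst sum.reindex_bij_betw[OF cfg_Suc[of n d], symmetric]) (auto intro!: sum.cong)
  also have "\<dots> = (\<Sum>x\<in>cfg n d. \<Prod>k<n. g k (x k)) * (\<Sum>a<d. g n a)"
    by (simp add: sum.cartesian_product[symmetric] sum_product)
  finally show ?case by (simp add: Suc)
qed (simp add: cfg_0)

lemma cfg_less: "x \<in> cfg n d \<Longrightarrow> k < n \<Longrightarrow> x k < d"
  by (simp add: cfg_def)

text \<open>This is \<open>tr (\<rho> (A\<^sub>0 \<otimes> \<dots> \<otimes> A\<^bsub>n-1\<^esub>))\<close>.\<close>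

definition tensor_trace :: "nat \<Rightarrow> nat \<Rightarrow> ((nat \<Rightarrow> nat) \<Rightarrow> (nat \<Rightarrow> nat) \<Rightarrow> complex) \<Rightarrow>
    (nat \<Rightarrow> nat \<Rightarrow> nat \<Rightarrow> complex) \<Rightarrow> complex" where
  "tensor_trace n d \<rho> A = (\<Sum>x\<in>cfg n d. \<Sum>y\<in>cfg n d. \<rho> x y * (\<Prod>k<n. A k (y k) (x k)))"

lemma tensor_trace_cong:
  assumes "\<And>k y x. k < n \<Longrightarrow> y < d \<Longrightarrow> x < d \<Longrightarrow> A k y x = B k y x"
  shows "tensor_trace n d \<rho> A = tensor_trace n d \<rho> B"
  unfolding tensor_trace_def using assms
  by (intro sum.cong refl arg_cong2[of _ _ _ _ "(*)"] prod.cong) (auto intro: cfg_less)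

lemma tensor_trace_upd:
  assumes "j < n"
  shows "tensor_trace n d \<rho> (A(j := B)) = (\<Sum>x\<in>cfg n d. \<Sum>y\<in>cfg n d. B (y j) (x j) * (\<rho> x y * (\<Prod>k\<in>{..<n} - {j}. A k (y k) (x k))))"
proof -
  have "(\<Prod>k<n. (A(j := B)) k (y k) (x k)) = B (y j) (x j) * (\<Prod>k\<in>{..<n} - {j}. A k (y k) (x k))" for x y
    using assms by (subst prod.remove[of _ j]) (auto intro!: prod.cong)
  thus ?thesis by (simp add: tensor_trace_def mult_ac)
qed

lemma tensor_trace_linear:
  assumes "j < n"
  shows "tensor_trace n d \<rho> (A(j := \<lambda>y x. \<Sum>s\<in>X. c s * B s y x)) = (\<Sum>s\<in>X. c s * tensor_trace n d \<rho> (A(j := B s)))"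
proof -
  let ?P = "\<lambda>x y. \<rho> x y * (\<Prod>k\<in>{..<n} - {j}. A k (y k) (x k))"
  have "tensor_trace n d \<rho> (A(j := \<lambda>y x. \<Sum>s\<in>X. c s * B s y x))
    = (\<Sum>x\<in>cfg n d. \<Sum>y\<in>cfg n d. \<Sum>s\<in>X. c s * (B s (y j) (x j) * ?P x y))"
    by (simp add: tensor_trace_upd[OF assms] sum_distrib_left sum_distrib_right mult_ac)
  also have "\<dots> = (\<Sum>x\<in>cfg n d. \<Sum>s\<in>X. \<Sum>y\<in>cfg n d. c s * (B s (y j) (x j) * ?P x y))"
    by (intro sum.cong refl sum.swap)
  also have "\<dots> = (\<Sum>s\<in>X. \<Sum>x\<in>cfg n d. \<Sum>y\<in>cfg n d. c s * (B s (y j) (x j) * ?P x y))"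
    by (rule sum.swap)
  finally show ?thesis by (simp add: tensor_trace_upd[OF assms] sum_distrib_left)
qed

section \<open>Positivity of tensor traces\<close>

lemma tensor_trace_rank_one_nonneg:
  assumes "psd_on (cfg n d) \<rho>"
    and "\<And>k y x. k < n \<Longrightarrow> y < d \<Longrightarrow> x < d \<Longrightarrow> A k y x = v k y * cnj (v k x)"
  shows "Im (tensor_trace n d \<rho> A) = 0 \<and> Re (tensor_trace n d \<rho> A) \<ge> 0"
proof -
  define V where "V = (\<lambda>x :: nat \<Rightarrow> nat. \<Prod>k<n. v k (x k))"
  have "tensor_trace n d \<rho> A = tensor_trace n d \<rho> (\<lambda>k y x. v k y * cnj (v k x))"
    by (rule tensor_trace_cong) (rule assms(2))
  also have "\<dots> = (\<Sum>x\<in>cfg n d. \<Sum>y\<in>cfg n d. cnj (V x) * \<rho> x y * V y)"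
    by (simp add: tensor_trace_def V_def prod.distrib mult_ac)
  finally show ?thesis using assms(1) by (simp add: psd_on_def)
qed

text \<open>By linearity in each site, the trace splits into traces against products of rank-one
  operators, and each of those is the quadratic form of \<open>\<rho>\<close> at a product
  vector.\<close>

lemma tensor_trace_nonneg:
  assumes psd: "psd_on (cfg n d) \<rho>"
    and A: "\<And>k. k < n \<Longrightarrow> \<exists>(X :: nat set) v. \<forall>y<d. \<forall>x<d. A k y x = (\<Sum>s\<in>X. v s y * cnj (v s x))"
  shows "Im (tensor_trace n d \<rho> A) = 0 \<and> Re (tensor_trace n d \<rho> A) \<ge> 0"
proof -
  \<comment> \<open>Generalised for the induction: only the first \<open>m\<close> sites may still
    carry sums of rank-one operators, and the others are rank one already.\<close>
  have "Im (tensor_trace n d \<rho> A) = 0 \<and> Re (tensor_trace n d \<rho> A) \<ge> 0"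
    if "m \<le> n" "\<And>k. k < m \<Longrightarrow> \<exists>(X :: nat set) v. \<forall>y<d. \<forall>x<d. A k y x = (\<Sum>s\<in>X. v s y * cnj (v s x))"
      "\<And>k. m \<le> k \<Longrightarrow> k < n \<Longrightarrow> \<exists>v. \<forall>y<d. \<forall>x<d. A k y x = v y * cnj (v x)" for m A
    using that
  proof (induction m arbitrary: A)
    case 0
    then obtain v where "\<And>k y x. k < n \<Longrightarrow> y < d \<Longrightarrow> x < d \<Longrightarrow> A k y x = v k y * cnj (v k x)"
      by (metis le0)
    thus ?case by (rule tensor_trace_rank_one_nonneg[OF psd])
  next
    case (Suc m)
    obtain X :: "nat set" and v where v: "\<And>y x. y < d \<Longrightarrow> x < d \<Longrightarrow> A m y x = (\<Sum>s\<in>X. v s y * cnj (v s x))"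
      using Suc.prems(2)[of m] by auto
    have "tensor_trace n d \<rho> A = tensor_trace n d \<rho> (A(m := \<lambda>y x. \<Sum>s\<in>X. 1 * (v s y * cnj (v s x))))"
      by (rule tensor_trace_cong) (auto simp: v)
    also have "\<dots> = (\<Sum>s\<in>X. 1 * tensor_trace n d \<rho> (A(m := \<lambda>y x. v s y * cnj (v s x))))"
      using Suc.prems(1) by (intro tensor_trace_linear) auto
    finally have eq: "tensor_trace n d \<rho> A = (\<Sum>s\<in>X. tensor_trace n d \<rho> (A(m := \<lambda>y x. v s y * cnj (v s x))))" by simp
    have "Im (tensor_trace n d \<rho> (A(m := \<lambda>y x. v s y * cnj (v s x)))) = 0 \<and> Re (tensor_trace n d \<rho> (A(m := \<lambda>y x. v s y * cnj (v s x)))) \<ge> 0" for s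
    proof (rule Suc.IH)
      show "\<exists>v'. \<forall>y<d. \<forall>x<d. (A(m := \<lambda>y x. v s y * cnj (v s x))) k y x = v' y * cnj (v' x)" if "m \<le> k" "k < n" for k
        using Suc.prems(3)[of k] that by (cases "k = m") auto
    qed (use Suc.prems in auto)
    thus ?case unfolding eq by (simp add: sum_nonneg)
  qed
  from this[of n A] A show ?thesis by auto
qed

section \<open>Measurement operators on single sites\<close>

definition idm :: "nat \<Rightarrow> nat \<Rightarrow> complex" where
  "idm y x = of_bool (y = x)"

text \<open>The measurement effect of outcome \<open>s\<close>; the weight is included so that, by
  \<open>design_second_moment\<close>, the effects sum to the identity.\<close>

definition meas :: "nat \<Rightarrow> nat \<Rightarrow> nat \<Rightarrow> nat \<Rightarrow> complex" where
  "meas d s y x = of_real (design_weight d s) * (design_vec d s y * cnj (design_vec d s x))"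

text \<open>The matrix unit \<open>|a'\<rangle>\<langle>a|\<close>, with its indices swapped so that tracing against it reads off the entry
  \<open>(a, a')\<close>.\<close>

definition unit_mat :: "nat \<Rightarrow> nat \<Rightarrow> nat \<Rightarrow> nat \<Rightarrow> complex" where
  "unit_mat a a' y x = of_bool (x = a \<and> y = a')"

definition measured :: "nat \<Rightarrow> nat set \<Rightarrow> (nat \<Rightarrow> nat) \<Rightarrow> (nat \<Rightarrow> nat \<Rightarrow> nat \<Rightarrow> complex) \<Rightarrow> nat \<Rightarrow> nat \<Rightarrow> nat \<Rightarrow> complex" where
  "measured d C z A = (\<lambda>k. if k \<in> C then meas d (z k) else A k)"

lemma measured_insert: "j \<notin> C \<Longrightarrow> measured d (insert j C) (z(j := s)) A = measured d C z (A(j := meas d s))"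
  by (auto simp: measured_def fun_eq_iff)

lemma measured_upd: "i \<notin> C \<Longrightarrow> measured d C z (A(i := B)) = (measured d C z A)(i := B)"
  by (auto simp: measured_def fun_eq_iff)

lemma tensor_trace_meas_sum:
  assumes "j < n"
  shows "(\<Sum>s\<in>outcomes d. tensor_trace n d \<rho> (A(j := meas d s))) = tensor_trace n d \<rho> (A(j := idm))"
proof -
  have "(\<Sum>s\<in>outcomes d. 1 * tensor_trace n d \<rho> (A(j := meas d s))) = tensor_trace n d \<rho> (A(j := \<lambda>y x. \<Sum>s\<in>outcomes d. 1 * meas d s y x))"
    by (rule tensor_trace_linear[OF assms, symmetric])
  also have "\<dots> = tensor_trace n d \<rho> (A(j := idm))"
    by (rule tensor_trace_cong) (simp add: meas_def idm_def design_second_moment)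
  finally show ?thesis by simp
qed

lemma tensor_trace_measured_total:
  assumes "finite C" "C \<subseteq> {..<n}"
  shows "(\<Sum>z\<in>PiE C (\<lambda>_. outcomes d). tensor_trace n d \<rho> (measured d C z A)) = tensor_trace n d \<rho> (\<lambda>k. if k \<in> C then idm else A k)"
  using assms
proof (induction C arbitrary: A)
  case empty
  show ?case by (simp add: measured_def)
next
  case (insert j C)
  have "(\<Sum>z\<in>PiE (insert j C) (\<lambda>_. outcomes d). tensor_trace n d \<rho> (measured d (insert j C) z A))
     = (\<Sum>z\<in>PiE C (\<lambda>_. outcomes d). \<Sum>s\<in>outcomes d. tensor_trace n d \<rho> ((measured d C z A)(j := meas d s)))"
    unfolding sum_PiE_insert[OF insert.hyps(2)] measured_insert[OF insert.hyps(2)] measured_upd[OF insert.hyps(2)] ..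
  also have "\<dots> = (\<Sum>z\<in>PiE C (\<lambda>_. outcomes d). tensor_trace n d \<rho> (measured d C z (A(j := idm))))"
    using insert.prems by (simp add: tensor_trace_meas_sum measured_upd[OF insert.hyps(2)])
  also have "\<dots> = tensor_trace n d \<rho> (\<lambda>k. if k \<in> C then idm else (A(j := idm)) k)"
    using insert.prems by (intro insert.IH) auto
  also have "(\<lambda>k. if k \<in> C then idm else (A(j := idm)) k) = (\<lambda>k. if k \<in> insert j C then idm else A k)"
    by auto
  finally show ?case .
qed

lemma tensor_trace_add:
  assumes "j < n"
  shows "tensor_trace n d \<rho> (A(j := \<lambda>y x. c * B y x + D y x)) = c * tensor_trace n d \<rho> (A(j := B)) + tensor_trace n d \<rho> (A(j := D))"
  by (simp add: tensor_trace_upd[OF assms] sum.distrib sum_distrib_left algebra_simps)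

text \<open>By the fourth moment, summing \<open>meas d s\<close> against the \<open>(b, b')\<close>
  entries of the design projectors gives
  \<open>(unit_mat b b' + of_bool (b = b') * idm) / (d + 1)\<close>. Solving for
  \<open>unit_mat b b'\<close> inverts the measurement.\<close>

lemma tensor_trace_reconstruct:
  assumes "j < n" "b < d" "b' < d"
  shows "tensor_trace n d \<rho> (A(j := unit_mat b b'))
    = (of_nat d + 1) * (\<Sum>s\<in>outcomes d. design_vec d s b * cnj (design_vec d s b') * tensor_trace n d \<rho> (A(j := meas d s)))
      - of_bool (b = b') * tensor_trace n d \<rho> (A(j := idm))"
proof -
  have nz: "(of_nat d :: complex) + 1 \<noteq> 0" by (metis of_nat_Suc of_nat_neq_0 add.commute)
  let ?c = "\<lambda>s. (of_nat d + 1) * (design_vec d s b * cnj (design_vec d s b'))"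
  have "(\<Sum>s\<in>outcomes d. ?c s * tensor_trace n d \<rho> (A(j := meas d s))) = tensor_trace n d \<rho> (A(j := \<lambda>y x. \<Sum>s\<in>outcomes d. ?c s * meas d s y x))"
    by (rule tensor_trace_linear[OF assms(1), symmetric])
  also have "\<dots> = tensor_trace n d \<rho> (A(j := \<lambda>y x. of_bool (b = b') * idm y x + unit_mat b b' y x))"
  proof (rule tensor_trace_cong)
    fix k y x assume yx: "y < d" "x < d"
    have "(\<Sum>s\<in>outcomes d. ?c s * meas d s y x) = (of_nat d + 1) *
        (\<Sum>s\<in>outcomes d. of_real (design_weight d s) * (design_vec d s b * cnj (design_vec d s b') * (design_vec d s y * cnj (design_vec d s x))))"
      unfolding sum_distrib_left by (intro sum.cong refl) (simp add: meas_def mult_ac)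
    also have "\<dots> = of_bool (b = b') * idm y x + unit_mat b b' y x"
    proof -
      have cancel: "(of_nat d + 1) * (q / (of_nat d + 1)) = q" for q :: complex using nz by simp
      show ?thesis
        unfolding design_fourth_moment[OF assms(2,3) yx] idm_def unit_mat_def cancel
        by (cases "b = b'"; cases "y = x"; cases "b = x"; cases "y = b'") simp_all
    qed
    finally show "(A(j := \<lambda>y x. \<Sum>s\<in>outcomes d. ?c s * meas d s y x)) k y x
        = (A(j := \<lambda>y x. of_bool (b = b') * idm y x + unit_mat b b' y x)) k y x"
      by simp
  qed
  also have "\<dots> = of_bool (b = b') * tensor_trace n d \<rho> (A(j := idm)) + tensor_trace n d \<rho> (A(j := unit_mat b b'))"
    by (rule tensor_trace_add[OF assms(1)])
  finally show ?thesis by (simp add: sum_distrib_left algebra_simps)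
qed

text \<open>The conditional states given outcomes \<open>z\<close> on \<open>C\<close> are kept unnormalised: their trace is the
  probability of \<open>z\<close>.\<close>

definition cond_mat :: "nat \<Rightarrow> nat \<Rightarrow> ((nat \<Rightarrow> nat) \<Rightarrow> (nat \<Rightarrow> nat) \<Rightarrow> complex) \<Rightarrow> nat set \<Rightarrow> (nat \<Rightarrow> nat) \<Rightarrow> nat \<Rightarrow> nat \<Rightarrow> nat \<Rightarrow> complex" where
  "cond_mat n d \<rho> C z i = (\<lambda>a a'. tensor_trace n d \<rho> (measured d C z ((\<lambda>_. idm)(i := unit_mat a a'))))"

definition outcome_prob :: "nat \<Rightarrow> nat \<Rightarrow> ((nat \<Rightarrow> nat) \<Rightarrow> (nat \<Rightarrow> nat) \<Rightarrow> complex) \<Rightarrow> nat set \<Rightarrow> (nat \<Rightarrow> nat) \<Rightarrow> complex" where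
  "outcome_prob n d \<rho> C z = tensor_trace n d \<rho> (measured d C z (\<lambda>_. idm))"

definition cond_mat2 :: "nat \<Rightarrow> nat \<Rightarrow> ((nat \<Rightarrow> nat) \<Rightarrow> (nat \<Rightarrow> nat) \<Rightarrow> complex) \<Rightarrow> nat set \<Rightarrow> (nat \<Rightarrow> nat) \<Rightarrow> nat \<Rightarrow> nat \<Rightarrow> nat \<times> nat \<Rightarrow> nat \<times> nat \<Rightarrow> complex" where
  "cond_mat2 n d \<rho> C z i j = (\<lambda>u v. tensor_trace n d \<rho> (measured d C z ((\<lambda>_. idm)(i := unit_mat (fst u) (fst v), j := unit_mat (snd u) (snd v)))))"

lemma idm_sum_rank_one: "y < d \<Longrightarrow> x < d \<Longrightarrow> idm y x = (\<Sum>s<d. of_bool (y = s) * cnj (of_bool (x = s)))"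
proof -
  assume "y < d" "x < d"
  have "(\<Sum>s<d. of_bool (y = s) * cnj (of_bool (x = s))) = (\<Sum>s<d. if s = y then idm y x else 0)"
    by (intro sum.cong) (auto simp: idm_def)
  thus ?thesis using \<open>y < d\<close> by simp
qed

lemma meas_rank_one: "d > 0 \<Longrightarrow> meas d s y x = (of_real (sqrt (design_weight d s)) * design_vec d s y) * cnj (of_real (sqrt (design_weight d s)) * design_vec d s x)"
proof -
  assume "d > 0"
  have "complex_of_real (design_weight d s) = of_real (sqrt (design_weight d s)) * of_real (sqrt (design_weight d s))"
    using design_weight_pos[OF \<open>d > 0\<close>, of s] by (simp flip: of_real_mult)
  thus ?thesis by (simp add: meas_def mult_ac)
qed

lemma measured_rank_one:
  assumes "d > 0" "\<exists>(X :: nat set) v. \<forall>y<d. \<forall>x<d. A k y x = (\<Sum>s\<in>X. v s y * cnj (v s x))"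
  shows "\<exists>(X :: nat set) v. \<forall>y<d. \<forall>x<d. measured d C z A k y x = (\<Sum>s\<in>X. v s y * cnj (v s x))"
proof (cases "k \<in> C")
  case True
  thus ?thesis using meas_rank_one[OF assms(1), of "z k"]
    by (intro exI[of _ "{0}"] exI[of _ "\<lambda>_ y. of_real (sqrt (design_weight d (z k))) * design_vec d (z k) y"])
      (simp add: measured_def)
next
  case False
  thus ?thesis using assms(2) by (simp add: measured_def)
qed

lemma idm_rank_one: "\<exists>(X :: nat set) v. \<forall>y<d. \<forall>x<d. idm y x = (\<Sum>s\<in>X. v s y * cnj (v s x))"
  using idm_sum_rank_one by (intro exI[of _ "{..<d}"] exI[of _ "\<lambda>s y. of_bool (y = s)"]) auto

lemma outcome_prob_nonneg:
  assumes "psd_on (cfg n d) \<rho>" "d > 0"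
  shows "outcome_prob n d \<rho> C z = of_real (Re (outcome_prob n d \<rho> C z))" "Re (outcome_prob n d \<rho> C z) \<ge> 0"
  using tensor_trace_nonneg[OF assms(1), of "measured d C z (\<lambda>_. idm)"] measured_rank_one[OF assms(2) idm_rank_one]
  by (auto simp: outcome_prob_def complex_eq_iff)

lemma tensor_trace_unit_sum:
  assumes "i < n"
  shows "(\<Sum>a<d. \<Sum>a'<d. c a a' * tensor_trace n d \<rho> (A(i := unit_mat a a'))) = tensor_trace n d \<rho> (A(i := \<lambda>y x. c x y))"
proof -
  have "tensor_trace n d \<rho> (A(i := \<lambda>y x. c x y)) = tensor_trace n d \<rho> (A(i := \<lambda>y x. \<Sum>u\<in>{..<d} \<times> {..<d}. c (fst u) (snd u) * unit_mat (fst u) (snd u) y x))"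
  proof (rule tensor_trace_cong)
    fix k y x assume yx: "y < d" "x < d"
    have "(\<Sum>u\<in>{..<d} \<times> {..<d}. c (fst u) (snd u) * unit_mat (fst u) (snd u) y x)
        = (\<Sum>u\<in>{..<d} \<times> {..<d}. if u = (x, y) then c x y else 0)"
      by (intro sum.cong) (auto simp: unit_mat_def)
    also have "\<dots> = c x y" using yx by simp
    finally show "(A(i := \<lambda>y x. c x y)) k y x = (A(i := \<lambda>y x. \<Sum>u\<in>{..<d} \<times> {..<d}. c (fst u) (snd u) * unit_mat (fst u) (snd u) y x)) k y x"
      by simp
  qed
  also have "\<dots> = (\<Sum>u\<in>{..<d} \<times> {..<d}. c (fst u) (snd u) * tensor_trace n d \<rho> (A(i := unit_mat (fst u) (snd u))))"
    by (rule tensor_trace_linear[OF assms])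
  finally show ?thesis by (simp add: sum.cartesian_product case_prod_unfold)
qed

text \<open>The quadratic form at \<open>v\<close> is a tensor trace with a rank-one operator built
  from \<open>v\<close> at site \<open>i\<close>, with effects on \<open>C\<close> and with
  identities elsewhere, so \<open>tensor_trace_nonneg\<close> applies.\<close>

lemma psd_cond_mat:
  assumes "psd_on (cfg n d) \<rho>" "d > 0" "i < n" "i \<notin> C"
  shows "psd_on {..<d} (cond_mat n d \<rho> C z i)"
  unfolding psd_on_def
proof (intro allI)
  fix v :: "nat \<Rightarrow> complex"
  have "(\<Sum>a<d. \<Sum>a'<d. cnj (v a) * cond_mat n d \<rho> C z i a a' * v a')
     = (\<Sum>a<d. \<Sum>a'<d. (cnj (v a) * v a') * tensor_trace n d \<rho> ((measured d C z (\<lambda>_. idm))(i := unit_mat a a')))"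
    by (simp add: cond_mat_def measured_upd[OF assms(4)] mult_ac)
  also have "\<dots> = tensor_trace n d \<rho> ((measured d C z (\<lambda>_. idm))(i := \<lambda>y x. cnj (v x) * v y))"
    by (rule tensor_trace_unit_sum[OF assms(3)])
  also have "\<dots> = tensor_trace n d \<rho> (measured d C z ((\<lambda>_. idm)(i := \<lambda>y x. v y * cnj (v x))))"
    by (simp add: measured_upd[OF assms(4)] mult.commute)
  finally have eq: "(\<Sum>a<d. \<Sum>a'<d. cnj (v a) * cond_mat n d \<rho> C z i a a' * v a') = \<dots>" .
  have "\<exists>(X :: nat set) u. \<forall>y<d. \<forall>x<d. ((\<lambda>_. idm)(i := \<lambda>y x. v y * cnj (v x))) k y x = (\<Sum>s\<in>X. u s y * cnj (u s x))" for k
    using idm_rank_one[of d] by (cases "k = i") (auto intro!: exI[of _ "{0}"] exI[of _ "\<lambda>_. v"])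
  hence "\<exists>(X :: nat set) u. \<forall>y<d. \<forall>x<d. measured d C z ((\<lambda>_. idm)(i := \<lambda>y x. v y * cnj (v x))) k y x = (\<Sum>s\<in>X. u s y * cnj (u s x))" for k
    by (rule measured_rank_one[OF assms(2)])
  from tensor_trace_nonneg[OF assms(1) this]
  show "Im (\<Sum>a<d. \<Sum>a'<d. cnj (v a) * cond_mat n d \<rho> C z i a a' * v a') = 0 \<and>
    0 \<le> Re (\<Sum>a<d. \<Sum>a'<d. cnj (v a) * cond_mat n d \<rho> C z i a a' * v a')"
    unfolding eq by simp
qed

lemma mtrace_cond_mat:
  assumes "i < n" "i \<notin> C"
  shows "mtrace {..<d} (cond_mat n d \<rho> C z i) = outcome_prob n d \<rho> C z"
proof -
  have "mtrace {..<d} (cond_mat n d \<rho> C z i) = (\<Sum>a<d. \<Sum>a'<d. of_bool (a = a') * tensor_trace n d \<rho> ((measured d C z (\<lambda>_. idm))(i := unit_mat a a')))"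
    by (simp add: mtrace_def cond_mat_def measured_upd[OF assms(2)])
  also have "\<dots> = tensor_trace n d \<rho> ((measured d C z (\<lambda>_. idm))(i := \<lambda>y x. of_bool (x = y)))"
    by (rule tensor_trace_unit_sum[OF assms(1)])
  also have "(measured d C z (\<lambda>_. idm))(i := \<lambda>y x. of_bool (x = y)) = measured d C z (\<lambda>_. idm)"
    using assms(2) by (auto simp: measured_def idm_def fun_eq_iff)
  finally show ?thesis by (simp add: outcome_prob_def)
qed

text \<open>The effects at \<open>j\<close> sum to the identity. This is the decomposition to which
  \<open>entropy_gap\<close> and \<open>entropy_superadditive\<close> are applied.\<close>

lemma cond_mat_insert:
  assumes "j < n" "i \<notin> C" "j \<notin> C" "i \<noteq> j"
  shows "(\<Sum>s\<in>outcomes d. cond_mat n d \<rho> (insert j C) (z(j := s)) i a a') = cond_mat n d \<rho> C z i a a'"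
proof -
  have "(\<lambda>_. idm)(i := unit_mat a a', j := idm) = (\<lambda>_. idm)(i := unit_mat a a')"
    using assms by (auto simp: fun_eq_iff)
  hence "(measured d C z ((\<lambda>_. idm)(i := unit_mat a a')))(j := idm) = measured d C z ((\<lambda>_. idm)(i := unit_mat a a'))"
    by (simp only: measured_upd[OF assms(3), symmetric])
  thus ?thesis
    by (simp only: cond_mat_def measured_insert[OF assms(3)] measured_upd[OF assms(3)] tensor_trace_meas_sum[OF assms(1)])
qed

lemma prod_of_bool: "finite S \<Longrightarrow> (\<Prod>k\<in>S. of_bool (P k) :: 'a :: comm_semiring_1) = of_bool (\<forall>k\<in>S. P k)"
  by (induction S rule: finite_induct) auto

lemma cfg_eq_iff:
  assumes "x \<in> cfg n d" "y \<in> cfg n d"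
  shows "x = y \<longleftrightarrow> (\<forall>k<n. x k = y k)"
proof
  assume eq: "\<forall>k<n. x k = y k"
  show "x = y"
  proof
    fix k
    show "x k = y k" using assms eq by (cases "k < n") (simp_all add: cfg_def)
  qed
qed simp

lemma tensor_trace_idm: "tensor_trace n d \<rho> (\<lambda>_. idm) = mtrace (cfg n d) \<rho>"
proof -
  have "tensor_trace n d \<rho> (\<lambda>_. idm) = (\<Sum>x\<in>cfg n d. \<Sum>y\<in>cfg n d. if y = x then \<rho> x y else 0)"
    unfolding tensor_trace_def idm_def by (intro sum.cong refl) (auto simp: prod_of_bool cfg_eq_iff)
  thus ?thesis by (simp add: mtrace_def finite_cfg)
qed

lemma outcome_prob_total:
  assumes "C \<subseteq> {..<n}"
  shows "(\<Sum>z\<in>PiE C (\<lambda>_. outcomes d). outcome_prob n d \<rho> C z) = mtrace (cfg n d) \<rho>"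
  using tensor_trace_measured_total[OF finite_subset[OF assms] assms, of d \<rho> "\<lambda>_. idm"]
  by (simp add: outcome_prob_def tensor_trace_idm)

text \<open>The average over outcomes has no explicit weights, because \<open>ent\<close> of an
  unnormalised conditional matrix already carries the probability of the outcome.\<close>

definition cond_ent :: "nat \<Rightarrow> nat \<Rightarrow> ((nat \<Rightarrow> nat) \<Rightarrow> (nat \<Rightarrow> nat) \<Rightarrow> complex) \<Rightarrow> nat set \<Rightarrow> nat \<Rightarrow> real" where
  "cond_ent n d \<rho> C i = (\<Sum>z\<in>PiE C (\<lambda>_. outcomes d). ent {..<d} (cond_mat n d \<rho> C z i))"

lemma cond_ent_nonneg:
  assumes "psd_on (cfg n d) \<rho>" "d > 0" "i < n" "i \<notin> C"
  shows "cond_ent n d \<rho> C i \<ge> 0"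
  unfolding cond_ent_def by (intro sum_nonneg ent_nonneg psd_cond_mat assms) simp

lemma cond_ent_empty_le:
  assumes "density_on (cfg n d) \<rho>" "d > 0" "i < n"
  shows "cond_ent n d \<rho> {} i \<le> ln d"
proof -
  have psd: "psd_on (cfg n d) \<rho>" and tr: "mtrace (cfg n d) \<rho> = 1" using assms(1) by (auto simp: density_on_def)
  have "ent {..<d} (cond_mat n d \<rho> {} (\<lambda>_. undefined) i) \<le> ln (card {..<d})"
    using assms(2,3) outcome_prob_total[of "{}" n d \<rho>] tr
    by (intro ent_le_ln_card psd_cond_mat[OF psd]) (auto simp: mtrace_cond_mat)
  thus ?thesis by (simp add: cond_ent_def)
qed

lemma cond_ent_insert:
  assumes "j \<notin> C"
  shows "cond_ent n d \<rho> (insert j C) i = (\<Sum>z\<in>PiE C (\<lambda>_. outcomes d). \<Sum>s\<in>outcomes d. ent {..<d} (cond_mat n d \<rho> (insert j C) (z(j := s)) i))"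
  unfolding cond_ent_def by (rule sum_PiE_insert[OF assms])

text \<open>Conditioning lowers entropy, here through \<open>entropy_superadditive\<close>. The sign
  of the drop matters when a sum over edges is enlarged to a sum over all pairs.\<close>

lemma cond_ent_insert_le:
  assumes "psd_on (cfg n d) \<rho>" "d > 0" "i < n" "j < n" "i \<notin> C" "j \<notin> C" "i \<noteq> j"
  shows "cond_ent n d \<rho> (insert j C) i \<le> cond_ent n d \<rho> C i"
  unfolding cond_ent_insert[OF assms(6)] unfolding cond_ent_def
  using assms by (intro sum_mono entropy_superadditive psd_cond_mat) (auto simp: cond_mat_insert)

section \<open>Correlations between two unmeasured sites\<close>

lemma sum_pairs: "(\<Sum>u\<in>pairs d. f u) = (\<Sum>a<d. \<Sum>b<d. f (a, b))"
  unfolding pairs_def by (simp add: sum.cartesian_product')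

text \<open>The form of the new matrix at \<open>u\<close> and \<open>v\<close> is the form of
  \<open>W\<close> at the product vectors of \<open>u\<close> and \<open>v\<close> with
  \<open>\<psi>\<close>, and multiplying by a unit vector preserves norms.\<close>

lemma contraction_partial:
  assumes "contraction (pairs d) W" "nsq {..<d} \<psi> = 1"
  shows "contraction {..<d} (\<lambda>a' a. \<Sum>b<d. \<Sum>b'<d. W (a', b') (a, b) * \<psi> b * cnj (\<psi> b'))"
  unfolding contraction_def
proof (intro allI)
  fix u v :: "nat \<Rightarrow> complex"
  let ?W = "\<lambda>a' a. \<Sum>b<d. \<Sum>b'<d. W (a', b') (a, b) * \<psi> b * cnj (\<psi> b')"
  let ?t = "\<lambda>(u :: nat \<Rightarrow> complex) (x, y). u x * \<psi> y"
  have "ip {..<d} u (mv {..<d} ?W v) = (\<Sum>a'<d. \<Sum>a<d. \<Sum>b<d. \<Sum>b'<d. cnj (u a' * \<psi> b') * W (a', b') (a, b) * (v a * \<psi> b))"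
    by (simp add: ip_mv sum_distrib_left sum_distrib_right mult_ac)
  also have "\<dots> = (\<Sum>a'<d. \<Sum>a<d. \<Sum>b'<d. \<Sum>b<d. cnj (u a' * \<psi> b') * W (a', b') (a, b) * (v a * \<psi> b))"
    by (intro sum.cong refl sum.swap)
  also have "\<dots> = (\<Sum>a'<d. \<Sum>b'<d. \<Sum>a<d. \<Sum>b<d. cnj (u a' * \<psi> b') * W (a', b') (a, b) * (v a * \<psi> b))"
    by (intro sum.cong refl sum.swap)
  also have "\<dots> = ip (pairs d) (?t u) (mv (pairs d) W (?t v))"
    by (simp add: ip_mv sum_pairs)
  finally have eq: "ip {..<d} u (mv {..<d} ?W v) = ip (pairs d) (?t u) (mv (pairs d) W (?t v))" .
  have "nsq (pairs d) (?t u) = nsq {..<d} u" for u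
  proof -
    have "nsq (pairs d) (?t u) = (\<Sum>a<d. \<Sum>b<d. (cmod (u a))\<^sup>2 * (cmod (\<psi> b))\<^sup>2)"
      by (simp add: nsq_def sum_pairs norm_mult power_mult_distrib)
    also have "\<dots> = nsq {..<d} u * nsq {..<d} \<psi>" by (simp add: nsq_def sum_product)
    finally show ?thesis using assms(2) by simp
  qed
  thus "(cmod (ip {..<d} u (mv {..<d} ?W v)))\<^sup>2 \<le> nsq {..<d} u * nsq {..<d} v"
    unfolding eq using assms(1) by (metis contraction_def)
qed

text \<open>Compression of \<open>W\<close> by \<open>\<psi>\<close> is dual to tensoring with the
  projector onto \<open>\<psi>\<close>. It moves a two-site estimate to site \<open>i\<close>, where
  \<open>entropy_gap\<close> applies.\<close>

lemma trace_prod_tensor: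
  "trace_prod (pairs d) W (\<lambda>u v. \<psi> (snd u) * cnj (\<psi> (snd v)) * X (fst u) (fst v))
    = trace_prod {..<d} (\<lambda>a' a. \<Sum>b<d. \<Sum>b'<d. W (a', b') (a, b) * \<psi> b * cnj (\<psi> b')) X"
proof -
  have "trace_prod (pairs d) W (\<lambda>u v. \<psi> (snd u) * cnj (\<psi> (snd v)) * X (fst u) (fst v))
    = (\<Sum>a<d. \<Sum>b<d. \<Sum>a'<d. \<Sum>b'<d. W (a', b') (a, b) * \<psi> b * cnj (\<psi> b') * X a a')"
    by (simp add: trace_prod_def sum_pairs mult_ac)
  also have "\<dots> = (\<Sum>a<d. \<Sum>a'<d. \<Sum>b<d. \<Sum>b'<d. W (a', b') (a, b) * \<psi> b * cnj (\<psi> b') * X a a')"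
    by (intro sum.cong refl sum.swap)
  finally show ?thesis by (simp add: trace_prod_def sum_distrib_right)
qed

text \<open>The terms with the identity in the design inversion formula cancel because the two sides
  have equal marginals on site \<open>i\<close>; this is why measuring one site only costs a factor \<open>d + 1\<close>.\<close>

lemma correlation_expansion:
  assumes "psd_on (cfg n d) \<rho>" "d > 0" "i < n" "j < n" "i \<notin> C" "j \<notin> C" "i \<noteq> j"
    and ab: "u \<in> pairs d" "v \<in> pairs d"
  shows "cond_mat2 n d \<rho> C z i j u v - cond_mat n d \<rho> C z i (fst u) (fst v) * cond_mat n d \<rho> C z j (snd u) (snd v) / of_real (Re (outcome_prob n d \<rho> C z))
    = (of_nat d + 1) * (\<Sum>s\<in>outcomes d. design_vec d s (snd u) * cnj (design_vec d s (snd v)) *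
        (cond_mat n d \<rho> (insert j C) (z(j := s)) i (fst u) (fst v)
         - of_real (Re (outcome_prob n d \<rho> (insert j C) (z(j := s))) / Re (outcome_prob n d \<rho> C z)) * cond_mat n d \<rho> C z i (fst u) (fst v)))"
proof -
  obtain a b a' b' where uv: "u = (a, b)" "v = (a', b')" "a < d" "b < d" "a' < d" "b' < d"
    using ab by (auto simp: pairs_def)
  define p where "p = Re (outcome_prob n d \<rho> C z)"
  define K where "K = cond_mat n d \<rho> C z i a a'"
  let ?g = "\<lambda>s. design_vec d s b * cnj (design_vec d s b')"
  have p: "outcome_prob n d \<rho> C z = of_real p" using outcome_prob_nonneg(1)[OF assms(1,2)] by (simp add: p_def)
  have id_upd: "(\<lambda>_. idm)(i := unit_mat a a', j := idm) = (\<lambda>_. idm)(i := unit_mat a a')"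
    using assms(7) by (auto simp: fun_eq_iff)
  have 1: "cond_mat2 n d \<rho> C z i j u v = (of_nat d + 1) * (\<Sum>s\<in>outcomes d. ?g s * cond_mat n d \<rho> (insert j C) (z(j := s)) i a a') - of_bool (b = b') * K"
    unfolding cond_mat2_def cond_mat_def measured_insert[OF assms(6)] uv fst_conv snd_conv K_def
    using tensor_trace_reconstruct[OF assms(4) uv(4,6), of \<rho> "measured d C z ((\<lambda>_. idm)(i := unit_mat a a'))"]
    by (simp only: measured_upd[OF assms(6), symmetric] id_upd)
  \<comment> \<open>The same inversion for the marginal at \<open>j\<close>, where the measured
    traces are just the probabilities of the extended outcomes.\<close>
  have 2: "cond_mat n d \<rho> C z j b b' = (of_nat d + 1) * (\<Sum>s\<in>outcomes d. ?g s * of_real (Re (outcome_prob n d \<rho> (insert j C) (z(j := s))))) - of_bool (b = b') * of_real p"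
  proof -
    have "cond_mat n d \<rho> C z j b b' = (of_nat d + 1) * (\<Sum>s\<in>outcomes d. ?g s * outcome_prob n d \<rho> (insert j C) (z(j := s))) - of_bool (b = b') * outcome_prob n d \<rho> C z"
      unfolding outcome_prob_def cond_mat_def measured_insert[OF assms(6)]
      using tensor_trace_reconstruct[OF assms(4) uv(4,6), of \<rho> "measured d C z (\<lambda>_. idm)"]
      by (simp only: measured_upd[OF assms(6), symmetric] fun_upd_idem)
    thus ?thesis by (simp only: p outcome_prob_nonneg(1)[OF assms(1,2), symmetric])
  qed
  \<comment> \<open>For an outcome of probability 0 the quotient by \<open>p\<close> is 0 by
    convention; \<open>K\<close> vanishes as well, being an entry of a positive semidefinite matrix
    of trace 0, so the term with \<open>of_bool (b = b')\<close> disappears in this case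
    too.\<close>
  have K0: "K = 0" if "p = 0"
    unfolding K_def using that uv assms
    by (intro psd_zero_trace[OF psd_cond_mat[OF assms(1-3,5)]]) (auto simp: mtrace_cond_mat p_def)
  have "cond_mat2 n d \<rho> C z i j u v - K * cond_mat n d \<rho> C z j b b' / of_real p
     = (of_nat d + 1) * ((\<Sum>s\<in>outcomes d. ?g s * cond_mat n d \<rho> (insert j C) (z(j := s)) i a a')
        - (\<Sum>s\<in>outcomes d. ?g s * of_real (Re (outcome_prob n d \<rho> (insert j C) (z(j := s))))) * (K / of_real p))"
  proof (cases "p = 0")
    case True
    thus ?thesis unfolding 1 using K0 by simp
  next
    case False
    have "(m * X - \<delta> * K) - K * (m * Y - \<delta> * of_real p) / of_real p = m * (X - Y * (K / of_real p))" for m X Y \<delta>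
      using False by (simp add: field_simps)
    thus ?thesis unfolding 1 2 .
  qed
  also have "\<dots> = (of_nat d + 1) * (\<Sum>s\<in>outcomes d. ?g s * (cond_mat n d \<rho> (insert j C) (z(j := s)) i a a'
     - of_real (Re (outcome_prob n d \<rho> (insert j C) (z(j := s))) / p) * K))"
    unfolding sum_distrib_right sum_subtractf[symmetric]
    by (intro arg_cong[of _ _ "\<lambda>t. _ * t"] sum.cong refl) (simp add: right_diff_distrib)
  finally show ?thesis by (simp add: uv K_def p_def)
qed

text \<open>For each outcome \<open>z\<close>, \<open>correlation_expansion\<close> and the
  compressions of \<open>W\<close> by the design vectors reduce the correlation to the changes of
  the state at \<open>i\<close>, and \<open>entropy_gap\<close> bounds them with the common
  parameter \<open>c\<close>. In the sum over \<open>z\<close> the probabilities add up to 1, and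
  the entropies give the drop of \<open>cond_ent\<close>.\<close>

lemma good_edge_bound:
  assumes "density_on (cfg n d) \<rho>" "d > 0" "i < n" "j < n" "i \<notin> C" "j \<notin> C" "i \<noteq> j" "C \<subseteq> {..<n}"
    and W: "contraction (pairs d) W" and c: "c > 0"
  shows "cmod (\<Sum>z\<in>PiE C (\<lambda>_. outcomes d). trace_prod (pairs d) W (\<lambda>u v. cond_mat2 n d \<rho> C z i j u v
      - cond_mat n d \<rho> C z i (fst u) (fst v) * cond_mat n d \<rho> C z j (snd u) (snd v) / of_real (Re (outcome_prob n d \<rho> C z))))
    \<le> (real d + 1) * (c + (cond_ent n d \<rho> C i - cond_ent n d \<rho> (insert j C) i) / c)"
proof -
  have psd: "psd_on (cfg n d) \<rho>" and tr: "mtrace (cfg n d) \<rho> = 1" using assms(1) by (auto simp: density_on_def)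
  let ?Z = "PiE C (\<lambda>_. outcomes d)"
  define Ws where "Ws = (\<lambda>s a' a. \<Sum>b<d. \<Sum>b'<d. W (a', b') (a, b) * design_vec d s b * cnj (design_vec d s b'))"
  have Ws: "contraction {..<d} (Ws s)" if "s \<in> outcomes d" for s
    unfolding Ws_def by (rule contraction_partial[OF W nsq_design_vec[OF assms(2) that]])
  define \<Delta> where "\<Delta> = (\<lambda>z s a a'. cond_mat n d \<rho> (insert j C) (z(j := s)) i a a'
     - of_real (Re (outcome_prob n d \<rho> (insert j C) (z(j := s))) / Re (outcome_prob n d \<rho> C z)) * cond_mat n d \<rho> C z i a a')"
  let ?\<xi> = "\<lambda>z u v. cond_mat2 n d \<rho> C z i j u v
      - cond_mat n d \<rho> C z i (fst u) (fst v) * cond_mat n d \<rho> C z j (snd u) (snd v) / of_real (Re (outcome_prob n d \<rho> C z))"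
  have each: "cmod (trace_prod (pairs d) W (?\<xi> z)) \<le> (real d + 1) * (c * Re (outcome_prob n d \<rho> C z)
      + (ent {..<d} (cond_mat n d \<rho> C z i) - (\<Sum>s\<in>outcomes d. ent {..<d} (cond_mat n d \<rho> (insert j C) (z(j := s)) i))) / c)" for z
  proof -
    have "trace_prod (pairs d) W (?\<xi> z) = trace_prod (pairs d) W (\<lambda>u v. (of_nat d + 1) * (\<Sum>s\<in>outcomes d. design_vec d s (snd u) * cnj (design_vec d s (snd v)) * \<Delta> z s (fst u) (fst v)))"
      unfolding \<Delta>_def by (rule trace_prod_cong) (rule correlation_expansion[OF psd assms(2-7)])
    also have "\<dots> = (of_nat d + 1) * (\<Sum>s\<in>outcomes d. trace_prod {..<d} (Ws s) (\<Delta> z s))"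
      unfolding trace_prod_scale trace_prod_sum trace_prod_tensor Ws_def ..
    finally have "cmod (trace_prod (pairs d) W (?\<xi> z)) = (real d + 1) * cmod (\<Sum>s\<in>outcomes d. trace_prod {..<d} (Ws s) (\<Delta> z s))"
      using norm_of_nat[of "Suc d", where 'a = complex] by (simp add: norm_mult add.commute)
    also have "\<dots> \<le> (real d + 1) * (\<Sum>s\<in>outcomes d. cmod (trace_prod {..<d} (Ws s) (\<Delta> z s)))"
      by (intro mult_left_mono norm_sum) auto
    also have "(\<Sum>s\<in>outcomes d. cmod (trace_prod {..<d} (Ws s) (\<Delta> z s))) \<le> c * Re (outcome_prob n d \<rho> C z)
      + (ent {..<d} (cond_mat n d \<rho> C z i) - (\<Sum>s\<in>outcomes d. ent {..<d} (cond_mat n d \<rho> (insert j C) (z(j := s)) i))) / c"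
    proof -
      have i': "i \<notin> insert j C" using assms(5,7) by simp
      show ?thesis
        using entropy_gap[OF psd_cond_mat[OF psd assms(2,3,5)] finite_lessThan finite_lessThan psd_cond_mat[OF psd assms(2,3) i']
            cond_mat_insert[OF assms(4-7), symmetric] Ws c]
        unfolding \<Delta>_def mtrace_cond_mat[OF assms(3,5)] mtrace_cond_mat[OF assms(3) i'] .
    qed
    finally show ?thesis by (simp add: mult_left_mono)
  qed
  have "cmod (\<Sum>z\<in>?Z. trace_prod (pairs d) W (?\<xi> z)) \<le> (\<Sum>z\<in>?Z. (real d + 1) * (c * Re (outcome_prob n d \<rho> C z)
      + (ent {..<d} (cond_mat n d \<rho> C z i) - (\<Sum>s\<in>outcomes d. ent {..<d} (cond_mat n d \<rho> (insert j C) (z(j := s)) i))) / c))"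
    by (intro order.trans[OF norm_sum] sum_mono each)
  also have "\<dots> = (real d + 1) * (c * Re (\<Sum>z\<in>?Z. outcome_prob n d \<rho> C z) + (cond_ent n d \<rho> C i - cond_ent n d \<rho> (insert j C) i) / c)"
    unfolding cond_ent_insert[OF assms(6)] unfolding cond_ent_def
    by (simp add: sum.distrib sum_subtractf sum_distrib_left sum_divide_distrib diff_divide_distrib distrib_left right_diff_distrib)
  also have "(\<Sum>z\<in>?Z. outcome_prob n d \<rho> C z) = 1" using outcome_prob_total[OF assms(8)] tr by simp
  finally show ?thesis by simp
qed

section \<open>Reduced states and mixtures of products\<close>

lemma reduced_eq_tensor_trace:
  assumes "i < n" "j < n" "i \<noteq> j" "u \<in> pairs d" "v \<in> pairs d"
  shows "reduced n d \<rho> i j u v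
    = tensor_trace n d \<rho> ((\<lambda>_. idm)(i := unit_mat (fst u) (fst v), j := unit_mat (snd u) (snd v)))"
proof -
  obtain a b a' b' where uv: "u = (a, b)" "v = (a', b')" by (metis surj_pair)
  let ?A = "(\<lambda>_. idm)(i := unit_mat a a', j := unit_mat b b')"
  let ?P = "\<lambda>x y k. if k = j then x j = b \<and> y j = b' else if k = i then x i = a \<and> y i = a' else y k = x k"
  have "(\<Prod>k<n. ?A k (y k) (x k)) = of_bool (\<forall>k\<in>{..<n}. ?P x y k)" for x y
    unfolding prod_of_bool[OF finite_lessThan, symmetric]
    by (intro prod.cong) (auto simp: idm_def unit_mat_def)
  moreover have "(\<forall>k\<in>{..<n}. ?P x y k) \<longleftrightarrow> x i = a \<and> x j = b \<and> y i = a' \<and> y j = b' \<and> (\<forall>k. k \<noteq> i \<and> k \<noteq> j \<longrightarrow> x k = y k)"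
    if "x \<in> cfg n d" "y \<in> cfg n d" for x y
  proof
    assume P: "\<forall>k\<in>{..<n}. ?P x y k"
    have "x k = y k" if "k \<noteq> i" "k \<noteq> j" for k
      using P that \<open>x \<in> cfg n d\<close> \<open>y \<in> cfg n d\<close> by (cases "k < n") (auto simp: cfg_def)
    moreover have "?P x y i" "?P x y j" using P assms(1,2) by blast+
    ultimately show "x i = a \<and> x j = b \<and> y i = a' \<and> y j = b' \<and> (\<forall>k. k \<noteq> i \<and> k \<noteq> j \<longrightarrow> x k = y k)"
      using assms(3) by simp
  qed auto
  ultimately show ?thesis
    using assms(4,5) unfolding uv reduced_def tensor_trace_def by (auto intro!: sum.cong)
qed

text \<open>The Kraus form of the partial trace: \<open>r\<close> is the configuration of the
  remaining sites, encoded with zeros at \<open>i\<close> and \<open>j\<close>, and each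
  \<open>r\<close> contributes one quadratic form of \<open>\<rho>\<close>. Other values of
  \<open>r\<close> contribute 0. Positivity of the reduced state follows at once.\<close>

lemma reduced_quadratic_form:
  fixes f :: "nat \<times> nat \<Rightarrow> complex"
  assumes "i < n" "j < n" "i \<noteq> j" "d > 0"
  shows "(\<Sum>u\<in>pairs d. \<Sum>v\<in>pairs d. cnj (f u) * reduced n d \<rho> i j u v * f v)
    = (\<Sum>r\<in>cfg n d. \<Sum>x\<in>cfg n d. \<Sum>y\<in>cfg n d. cnj (f (x i, x j) * of_bool (x(i := 0, j := 0) = r)) * \<rho> x y
        * (f (y i, y j) * of_bool (y(i := 0, j := 0) = r)))"
    (is "?L = ?R")
proof -
  let ?r = "\<lambda>x :: nat \<Rightarrow> nat. x(i := 0, j := 0)"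
  define G where "G = (\<lambda>x y. of_bool (?r x = ?r y) * \<rho> x y)"
  have fin: "finite (pairs d)" by (simp add: pairs_def)
  have r_eq: "(\<forall>k. k \<noteq> i \<and> k \<noteq> j \<longrightarrow> x k = y k) \<longleftrightarrow> ?r x = ?r y" for x y
    by (auto simp: fun_eq_iff)
  have red: "reduced n d \<rho> i j u v = (\<Sum>x\<in>cfg n d. \<Sum>y\<in>cfg n d. of_bool ((x i, x j) = u) * of_bool ((y i, y j) = v) * G x y)"
    if "u \<in> pairs d" "v \<in> pairs d" for u v
    using that unfolding reduced_def r_eq by (cases u; cases v) (auto intro!: sum.cong simp: G_def)
  have pick: "(\<Sum>u\<in>pairs d. g u * of_bool ((x i, x j) = u)) = g (x i, x j)" if "x \<in> cfg n d" for x and g :: "nat \<times> nat \<Rightarrow> complex"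
  proof -
    have "(x i, x j) \<in> pairs d" using that assms by (auto simp: pairs_def cfg_def)
    thus ?thesis using fin by simp
  qed
  have "?L = (\<Sum>u\<in>pairs d. \<Sum>v\<in>pairs d. \<Sum>x\<in>cfg n d. \<Sum>y\<in>cfg n d. (cnj (f u) * of_bool ((x i, x j) = u)) * (f v * of_bool ((y i, y j) = v)) * G x y)"
    by (intro sum.cong refl) (simp add: red sum_distrib_left sum_distrib_right mult_ac)
  also have "\<dots> = (\<Sum>(u, v)\<in>pairs d \<times> pairs d. \<Sum>(x, y)\<in>cfg n d \<times> cfg n d. (cnj (f u) * of_bool ((x i, x j) = u)) * (f v * of_bool ((y i, y j) = v)) * G x y)"
    by (simp only: sum.cartesian_product[symmetric])
  also have "\<dots> = (\<Sum>(x, y)\<in>cfg n d \<times> cfg n d. \<Sum>(u, v)\<in>pairs d \<times> pairs d. (cnj (f u) * of_bool ((x i, x j) = u)) * (f v * of_bool ((y i, y j) = v)) * G x y)"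
    unfolding case_prod_unfold by (rule sum.swap)
  also have "\<dots> = (\<Sum>x\<in>cfg n d. \<Sum>y\<in>cfg n d. (\<Sum>u\<in>pairs d. cnj (f u) * of_bool ((x i, x j) = u)) * (\<Sum>v\<in>pairs d. f v * of_bool ((y i, y j) = v)) * G x y)"
    unfolding sum.cartesian_product[symmetric] sum_product unfolding sum_distrib_right by (rule refl)
  also have "\<dots> = (\<Sum>x\<in>cfg n d. \<Sum>y\<in>cfg n d. cnj (f (x i, x j)) * f (y i, y j) * G x y)"
    using pick[of _ "\<lambda>u. cnj (f u)"] pick[of _ f] by (intro sum.cong refl) simp
  also have "\<dots> = (\<Sum>x\<in>cfg n d. \<Sum>y\<in>cfg n d. \<Sum>r\<in>cfg n d. cnj (f (x i, x j) * of_bool (?r x = r)) * \<rho> x y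
        * (f (y i, y j) * of_bool (?r y = r)))"
  proof (intro sum.cong refl)
    fix x y assume x: "x \<in> cfg n d" "y \<in> cfg n d"
    hence "?r x \<in> cfg n d" using assms by (auto simp: cfg_def)
    moreover have "(\<Sum>r\<in>cfg n d. cnj (f (x i, x j) * of_bool (?r x = r)) * \<rho> x y * (f (y i, y j) * of_bool (?r y = r)))
        = (\<Sum>r\<in>cfg n d. if r = ?r x then cnj (f (x i, x j)) * f (y i, y j) * G x y else 0)"
      by (intro sum.cong) (auto simp: G_def)
    ultimately show "cnj (f (x i, x j)) * f (y i, y j) * G x y
        = (\<Sum>r\<in>cfg n d. cnj (f (x i, x j) * of_bool (?r x = r)) * \<rho> x y * (f (y i, y j) * of_bool (?r y = r)))"
      by (simp add: finite_cfg)
  qed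
  also have "\<dots> = (\<Sum>x\<in>cfg n d. \<Sum>r\<in>cfg n d. \<Sum>y\<in>cfg n d. cnj (f (x i, x j) * of_bool (?r x = r)) * \<rho> x y
        * (f (y i, y j) * of_bool (?r y = r)))"
    by (intro sum.cong refl sum.swap)
  also have "\<dots> = ?R" by (rule sum.swap)
  finally show ?thesis .
qed

lemma psd_reduced:
  assumes "psd_on (cfg n d) \<rho>" "i < n" "j < n" "i \<noteq> j" "d > 0"
  shows "psd_on (pairs d) (reduced n d \<rho> i j)"
  unfolding psd_on_def
proof
  fix f :: "nat \<times> nat \<Rightarrow> complex"
  define g where "g = (\<lambda>r. \<Sum>x\<in>cfg n d. \<Sum>y\<in>cfg n d. cnj (f (x i, x j) * of_bool (x(i := 0, j := 0) = r)) * \<rho> x y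
        * (f (y i, y j) * of_bool (y(i := 0, j := 0) = r)))"
  have "Im (g r) = 0 \<and> Re (g r) \<ge> 0" for r
    unfolding g_def
    using assms(1)[unfolded psd_on_def, THEN spec, of "\<lambda>x. f (x i, x j) * of_bool (x(i := 0, j := 0) = r)"] .
  hence "Im (\<Sum>r\<in>cfg n d. g r) = 0 \<and> Re (\<Sum>r\<in>cfg n d. g r) \<ge> 0"
    by (simp add: sum_nonneg)
  thus "Im (\<Sum>u\<in>pairs d. \<Sum>v\<in>pairs d. cnj (f u) * reduced n d \<rho> i j u v * f v) = 0 \<and>
      0 \<le> Re (\<Sum>u\<in>pairs d. \<Sum>v\<in>pairs d. cnj (f u) * reduced n d \<rho> i j u v * f v)"
    unfolding reduced_quadratic_form[OF assms(2-5)] g_def .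
qed

lemma mtrace_reduced:
  assumes "i < n" "j < n" "i \<noteq> j"
  shows "mtrace (pairs d) (reduced n d \<rho> i j) = mtrace (cfg n d) \<rho>"
proof -
  have upd: "A(k := \<lambda>y x. of_bool (x = y)) = A" if "A k = idm" for A k
    using that by (auto simp: fun_eq_iff idm_def)
  have *: "(\<Sum>a<d. tensor_trace n d \<rho> (A(k := unit_mat a a))) = tensor_trace n d \<rho> A" if "k < n" "A k = idm" for A k
    using tensor_trace_unit_sum[OF that(1), of "\<lambda>a a'. of_bool (a = a')" d \<rho> A] upd[of A k, OF that(2)] by simp
  have "mtrace (pairs d) (reduced n d \<rho> i j) = (\<Sum>u\<in>pairs d. tensor_trace n d \<rho> ((\<lambda>_. idm)(i := unit_mat (fst u) (fst u), j := unit_mat (snd u) (snd u))))"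
    unfolding mtrace_def by (intro sum.cong refl reduced_eq_tensor_trace assms)
  also have "\<dots> = (\<Sum>a<d. \<Sum>b<d. tensor_trace n d \<rho> ((\<lambda>_. idm)(i := unit_mat a a, j := unit_mat b b)))"
    by (simp add: sum_pairs)
  also have "\<dots> = (\<Sum>a<d. tensor_trace n d \<rho> ((\<lambda>_. idm)(i := unit_mat a a)))"
    using assms by (intro sum.cong refl *) auto
  also have "\<dots> = tensor_trace n d \<rho> (\<lambda>_. idm)"
    using assms by (intro *) auto
  finally show ?thesis by (simp add: tensor_trace_idm)
qed

lemma psd_on_weighted_sum:
  assumes "\<And>z. z \<in> Z \<Longrightarrow> p z \<ge> 0" "\<And>z. z \<in> Z \<Longrightarrow> psd_on S (A z)"
  shows "psd_on S (\<lambda>x y. \<Sum>z\<in>Z. of_real (p z) * A z x y)"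
  unfolding psd_on_ip
proof
  fix v
  have "ip S v (mv S (\<lambda>x y. \<Sum>z\<in>Z. of_real (p z) * A z x y) v) = (\<Sum>z\<in>Z. of_real (p z) * ip S v (mv S (A z) v))"
  proof -
    have "mv S (\<lambda>x y. \<Sum>z\<in>Z. of_real (p z) * A z x y) v = (\<lambda>x. \<Sum>z\<in>Z. of_real (p z) * mv S (A z) v x)"
      unfolding mv_def sum_distrib_right sum_distrib_left by (subst sum.swap) (simp add: mult.assoc)
    thus ?thesis by (simp add: ip_sum_right ip_scale_right)
  qed
  thus "Im (ip S v (mv S (\<lambda>x y. \<Sum>z\<in>Z. of_real (p z) * A z x y) v)) = 0 \<and>
    0 \<le> Re (ip S v (mv S (\<lambda>x y. \<Sum>z\<in>Z. of_real (p z) * A z x y) v))"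
    using assms by (auto simp: psd_on_ip intro!: sum_nonneg)
qed

text \<open>Only \<open>A\<close> is diagonalised. For an eigenvector of \<open>A\<close>, the form
  of the product is the form of \<open>B\<close> at the vector obtained by contracting the first
  index with that eigenvector.\<close>

lemma psd_tensor:
  assumes "psd_on {..<d} A" "psd_on {..<d} B"
  shows "psd_on (pairs d) (\<lambda>u v. A (fst u) (fst v) * B (snd u) (snd v))"
proof -
  obtain e l where l: "spectral {..<d} A e l" "\<And>k. k < d \<Longrightarrow> l k \<ge> 0"
    using psd_spectral[OF assms(1) finite_lessThan] by (metis card_lessThan)
  have *: "psd_on (pairs d) (\<lambda>u v. e k (fst u) * cnj (e k (fst v)) * B (snd u) (snd v))" for k
    unfolding psd_on_def
  proof
    fix w :: "nat \<times> nat \<Rightarrow> complex"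
    let ?w = "\<lambda>b. \<Sum>a<d. cnj (e k a) * w (a, b)"
    have "(\<Sum>x\<in>pairs d. \<Sum>y\<in>pairs d. cnj (w x) * (e k (fst x) * cnj (e k (fst y)) * B (snd x) (snd y)) * w y)
      = (\<Sum>a<d. \<Sum>b<d. \<Sum>a'<d. \<Sum>b'<d. cnj (cnj (e k a) * w (a, b)) * B b b' * (cnj (e k a') * w (a', b')))"
      by (simp add: sum_pairs mult_ac)
    also have "\<dots> = (\<Sum>b<d. \<Sum>a<d. \<Sum>a'<d. \<Sum>b'<d. cnj (cnj (e k a) * w (a, b)) * B b b' * (cnj (e k a') * w (a', b')))"
      by (rule sum.swap)
    also have "\<dots> = (\<Sum>b<d. \<Sum>a<d. \<Sum>b'<d. \<Sum>a'<d. cnj (cnj (e k a) * w (a, b)) * B b b' * (cnj (e k a') * w (a', b')))"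
      by (intro sum.cong refl sum.swap)
    also have "\<dots> = (\<Sum>b<d. \<Sum>b'<d. \<Sum>a<d. \<Sum>a'<d. cnj (cnj (e k a) * w (a, b)) * B b b' * (cnj (e k a') * w (a', b')))"
      by (intro sum.cong refl sum.swap)
    also have "\<dots> = (\<Sum>b<d. \<Sum>b'<d. cnj (?w b) * B b b' * ?w b')"
      unfolding cnj_sum sum_distrib_left sum_distrib_right
      by (rule sum.cong[OF refl], rule sum.cong[OF refl], rule sum.swap)
    finally show "Im (\<Sum>x\<in>pairs d. \<Sum>y\<in>pairs d. cnj (w x) * (e k (fst x) * cnj (e k (fst y)) * B (snd x) (snd y)) * w y) = 0 \<and>
        0 \<le> Re (\<Sum>x\<in>pairs d. \<Sum>y\<in>pairs d. cnj (w x) * (e k (fst x) * cnj (e k (fst y)) * B (snd x) (snd y)) * w y)"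
      using assms(2) by (simp only: psd_on_def)
  qed
  have "psd_on (pairs d) (\<lambda>u v. \<Sum>k<d. of_real (l k) * (e k (fst u) * cnj (e k (fst v)) * B (snd u) (snd v)))"
    using l(2) by (intro psd_on_weighted_sum *) auto
  moreover have "A (fst u) (fst v) * B (snd u) (snd v) = (\<Sum>k<d. of_real (l k) * (e k (fst u) * cnj (e k (fst v)) * B (snd u) (snd v)))"
    if "u \<in> pairs d" "v \<in> pairs d" for u v
    using l(1) that by (auto simp: spectral_def pairs_def sum_distrib_right mult.assoc)
  ultimately show ?thesis by (simp add: psd_on_def)
qed

text \<open>The index type is arbitrary because outcomes are functions on \<open>C\<close>;
  \<open>glob_separable_mixture\<close> renumbers them by natural numbers, as
  \<open>glob_separable\<close> demands.\<close>

definition mixture :: "nat \<Rightarrow> nat \<Rightarrow> 'z set \<Rightarrow> ('z \<Rightarrow> real) \<Rightarrow> ('z \<Rightarrow> nat \<Rightarrow> nat \<Rightarrow> nat \<Rightarrow> complex) \<Rightarrow> (nat \<Rightarrow> nat) \<Rightarrow> (nat \<Rightarrow> nat) \<Rightarrow> complex" where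
  "mixture n d Z p s = (\<lambda>x y. if x \<in> cfg n d \<and> y \<in> cfg n d
     then (\<Sum>z\<in>Z. complex_of_real (p z) * (\<Prod>i<n. s z i (x i) (y i))) else 0)"

lemma glob_separable_mixture:
  assumes "finite Z" "\<And>z. z \<in> Z \<Longrightarrow> p z \<ge> 0" "(\<Sum>z\<in>Z. p z) = 1"
    "\<And>z i. z \<in> Z \<Longrightarrow> i < n \<Longrightarrow> density_on {..<d} (s z i)"
  shows "glob_separable n d (mixture n d Z p s)"
proof -
  obtain h where h: "bij_betw h {..<card Z} Z"
    using ex_bij_betw_nat_finite[OF assms(1)] by (auto simp: lessThan_atLeast0)
  have mem: "h k \<in> Z" if "k < card Z" for k using h that by (auto simp: bij_betw_def)
  have "(\<Sum>k<card Z. p (h k)) = 1"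
    using sum.reindex_bij_betw[OF h, of p] assms(3) by simp
  moreover have "mixture n d Z p s = (\<lambda>x y. if x \<in> cfg n d \<and> y \<in> cfg n d
     then (\<Sum>k<card Z. complex_of_real (p (h k)) * (\<Prod>i<n. s (h k) i (x i) (y i))) else 0)"
    unfolding mixture_def
    by (intro ext if_cong refl)
      (rule sum.reindex_bij_betw[OF h, of "\<lambda>z. complex_of_real (p z) * (\<Prod>i<n. s z i (_ i) (_ i))", symmetric])
  ultimately show ?thesis
    unfolding glob_separable_def using mem assms(2,4)
    by (intro exI[of _ "card Z"] exI[of _ "\<lambda>k. p (h k)"] exI[of _ "\<lambda>k. s (h k)"]) auto
qed

lemma tensor_trace_mixture:
  "tensor_trace n d (mixture n d Z p s) A = (\<Sum>z\<in>Z. of_real (p z) * (\<Prod>k<n. \<Sum>a<d. \<Sum>a'<d. s z k a a' * A k a' a))"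
proof -
  have "tensor_trace n d (mixture n d Z p s) A
     = (\<Sum>x\<in>cfg n d. \<Sum>y\<in>cfg n d. \<Sum>z\<in>Z. of_real (p z) * (\<Prod>k<n. s z k (x k) (y k) * A k (y k) (x k)))"
    unfolding tensor_trace_def mixture_def
    by (intro sum.cong refl) (simp add: sum_distrib_right prod.distrib mult.assoc)
  also have "\<dots> = (\<Sum>x\<in>cfg n d. \<Sum>z\<in>Z. \<Sum>y\<in>cfg n d. of_real (p z) * (\<Prod>k<n. s z k (x k) (y k) * A k (y k) (x k)))"
    by (intro sum.cong refl sum.swap)
  also have "\<dots> = (\<Sum>z\<in>Z. \<Sum>x\<in>cfg n d. \<Sum>y\<in>cfg n d. of_real (p z) * (\<Prod>k<n. s z k (x k) (y k) * A k (y k) (x k)))"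
    by (rule sum.swap)
  also have "\<dots> = (\<Sum>z\<in>Z. of_real (p z) * (\<Sum>x\<in>cfg n d. \<Prod>k<n. \<Sum>a'<d. s z k (x k) a' * A k a' (x k)))"
    unfolding sum_distrib_left[symmetric]
    by (intro sum.cong refl arg_cong2[of _ _ _ _ "(*)"]) (rule sum_cfg_prod)
  finally show ?thesis by (simp only: sum_cfg_prod[of "\<lambda>k a. \<Sum>a'<d. s _ k a a' * A k a' a"])
qed

text \<open>Every site other than \<open>i\<close> and \<open>j\<close> contributes the trace of its
  factor, which is 1.\<close>

lemma reduced_mixture:
  assumes "i < n" "j < n" "i \<noteq> j" "u \<in> pairs d" "v \<in> pairs d"
    and tr: "\<And>z k. z \<in> Z \<Longrightarrow> k < n \<Longrightarrow> mtrace {..<d} (s z k) = 1"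
  shows "reduced n d (mixture n d Z p s) i j u v = (\<Sum>z\<in>Z. of_real (p z) * (s z i (fst u) (fst v) * s z j (snd u) (snd v)))"
proof -
  let ?A = "(\<lambda>_. idm)(i := unit_mat (fst u) (fst v), j := unit_mat (snd u) (snd v))"
  have unit: "(\<Sum>a<d. \<Sum>a'<d. f a a' * unit_mat b b' a' a) = f b b'" if "b < d" "b' < d" for b b' and f :: "nat \<Rightarrow> nat \<Rightarrow> complex"
  proof -
    have "(\<Sum>a<d. \<Sum>a'<d. f a a' * unit_mat b b' a' a) = (\<Sum>a<d. if a = b then f b b' else 0)"
      using that(2) by (intro sum.cong refl) (auto simp: unit_mat_def)
    thus ?thesis using that(1) by simp
  qed
  have idm: "(\<Sum>a<d. \<Sum>a'<d. f a a' * idm a' a) = mtrace {..<d} f" for f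
    by (simp add: idm_def mtrace_def)
  have uv: "fst u < d" "snd u < d" "fst v < d" "snd v < d" using assms(4,5) by (auto simp: pairs_def)
  have factors: "(\<Prod>k<n. \<Sum>a<d. \<Sum>a'<d. s z k a a' * ?A k a' a) = s z i (fst u) (fst v) * s z j (snd u) (snd v)" if z: "z \<in> Z" for z
  proof -
    let ?F = "\<lambda>k. \<Sum>a<d. \<Sum>a'<d. s z k a a' * ?A k a' a"
    have "(\<Prod>k<n. ?F k) = ?F i * (?F j * (\<Prod>k\<in>{..<n} - {i} - {j}. ?F k))"
      using assms(1-3) by (subst prod.remove[of _ i], simp, simp, subst prod.remove[of _ j], auto)
    also have "(\<Prod>k\<in>{..<n} - {i} - {j}. ?F k) = 1"
      using tr[OF z] by (intro prod.neutral) (auto simp: idm)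
    also have "?F i = s z i (fst u) (fst v)" using assms(3) by (simp add: unit uv)
    also have "?F j = s z j (snd u) (snd v)" by (simp add: unit uv)
    finally show ?thesis by (simp only: mult_1_right)
  qed
  show ?thesis unfolding reduced_eq_tensor_trace[OF assms(1-5)] tensor_trace_mixture
    by (intro sum.cong refl) (simp only: factors)
qed

text \<open>The set \<open>C\<close> of measured sites is chosen to minimise the total conditional entropy of the
  remaining sites plus \<open>lam\<close> per measured site; minimality replaces the usual averaging over
  random measurement orders with the chain rule.\<close>

lemma exists_good_sites:
  fixes lam :: real
  assumes rho: "density_on (cfg n d) \<rho>" and d: "d > 0" and lam: "lam > 0"
  obtains C where "C \<subseteq> {..<n}" "lam * card C \<le> n * ln d"
    "\<And>j. j < n \<Longrightarrow> j \<notin> C \<Longrightarrow> (\<Sum>i\<in>{..<n} - insert j C. cond_ent n d \<rho> C i - cond_ent n d \<rho> (insert j C) i) \<le> lam"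
proof -
  have psd: "psd_on (cfg n d) \<rho>" using rho by (simp add: density_on_def)
  define F where "F = (\<lambda>C. (\<Sum>i\<in>{..<n} - C. cond_ent n d \<rho> C i) + lam * card C)"
  have fin: "finite (F ` Pow {..<n})" and ne: "F ` Pow {..<n} \<noteq> {}" by auto
  obtain C where C: "C \<subseteq> {..<n}" "F C = Min (F ` Pow {..<n})" using Min_in[OF fin ne] by auto
  have min: "F C \<le> F C'" if "C' \<subseteq> {..<n}" for C'
    unfolding C(2) using fin that by (intro Min_le) auto
  have finC: "finite C" using C(1) finite_subset by blast
  \<comment> \<open>Comparison with the empty set bounds the number of measured sites.\<close>
  have "lam * card C \<le> F C"
    unfolding F_def by (auto intro!: sum_nonneg cond_ent_nonneg[OF psd d])
  also have "\<dots> \<le> F {}" by (rule min) simp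
  also have "\<dots> = (\<Sum>i<n. cond_ent n d \<rho> {} i)" by (simp add: F_def)
  also have "\<dots> \<le> (\<Sum>i<n. ln d)"
    by (intro sum_mono cond_ent_empty_le[OF rho d]) simp
  finally have 1: "lam * card C \<le> n * ln d" by simp
  have "(\<Sum>i\<in>{..<n} - insert j C. cond_ent n d \<rho> C i - cond_ent n d \<rho> (insert j C) i) \<le> lam" if j: "j < n" "j \<notin> C" for j
  proof -
    have eq: "{..<n} - C = insert j ({..<n} - insert j C)" using j by auto
    have "F C = cond_ent n d \<rho> C j + (\<Sum>i\<in>{..<n} - insert j C. cond_ent n d \<rho> C i) + lam * card C"
      unfolding F_def eq by (subst sum.insert) auto
    moreover have "F (insert j C) = (\<Sum>i\<in>{..<n} - insert j C. cond_ent n d \<rho> (insert j C) i) + lam * card C + lam"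
      unfolding F_def using j finC by (simp add: algebra_simps)
    moreover have "F C \<le> F (insert j C)" using C(1) j by (intro min) auto
    \<comment> \<open>Measuring \<open>j\<close> also removes the entropy of \<open>j\<close> itself
      from the total; this nonnegative saving is discarded.\<close>
    moreover have "cond_ent n d \<rho> C j \<ge> 0" using cond_ent_nonneg[OF psd d j] .
    ultimately show ?thesis by (simp add: sum_subtractf)
  qed
  with C(1) 1 show ?thesis by (rule that)
qed


section \<open>Summing over the edges of a regular graph\<close>

locale regular_graph_state =
  fixes d D n :: nat
    and E :: "nat \<Rightarrow> nat \<Rightarrow> bool"
    and \<rho> :: "(nat \<Rightarrow> nat) \<Rightarrow> (nat \<Rightarrow> nat) \<Rightarrow> complex"
  assumes d: "d \<ge> 2" and D: "D \<ge> 1"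
    and E_less: "\<And>i j. E i j \<Longrightarrow> i < n \<and> j < n"
    and E_sym: "\<And>i j. E i j \<Longrightarrow> E j i"
    and E_irrefl: "\<And>i. \<not> E i i"
    and E_regular: "\<And>i. i < n \<Longrightarrow> card {j. E i j} = D"
    and rho: "density_on (cfg n d) \<rho>"
begin

lemma psd: "psd_on (cfg n d) \<rho>" and tr: "mtrace (cfg n d) \<rho> = 1"
  using rho by (auto simp: density_on_def)

text \<open>Ordered pairs: each undirected edge is counted in both directions, which leaves averages
  unchanged and gives \<open>D * n\<close> elements.\<close>

definition edges :: "(nat \<times> nat) set" where "edges = {(i, j). E i j}"

lemma edges_Sigma: "edges = Sigma {..<n} (\<lambda>i. {j. E i j})"
  using E_less by (auto simp: edges_def)

lemma finite_nbrs: "finite {j. E i j}"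
  by (rule finite_subset[of _ "{..<n}"]) (use E_less in auto)

lemma sum_edges: "(\<Sum>(i, j)\<in>edges. f i) = D * (\<Sum>i<n. f i :: real)"
proof -
  have "(\<Sum>(i, j)\<in>edges. f i) = (\<Sum>i<n. \<Sum>j\<in>{j. E i j}. f i)"
    unfolding edges_Sigma by (rule sum.Sigma[symmetric]) (auto simp: finite_nbrs)
  thus ?thesis by (simp add: E_regular sum_distrib_left)
qed

lemma sum_edges_swap: "(\<Sum>(i, j)\<in>edges. f j) = (\<Sum>(i, j)\<in>edges. f i :: real)"
  by (rule sum.reindex_bij_witness[of _ prod.swap prod.swap]) (auto simp: edges_def E_sym)

lemma card_edges: "real (card edges) = real D * real n"
  using sum_edges[of "\<lambda>_. 1"] by (simp add: case_prod_unfold)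

text \<open>Measured sites and outcomes of probability 0 get an arbitrary placeholder state.\<close>

definition cond_state :: "nat set \<Rightarrow> (nat \<Rightarrow> nat) \<Rightarrow> nat \<Rightarrow> nat \<Rightarrow> nat \<Rightarrow> complex" where
  "cond_state C z i = (if i \<notin> C \<and> Re (outcome_prob n d \<rho> C z) \<noteq> 0
     then (\<lambda>a a'. cond_mat n d \<rho> C z i a a' / of_real (Re (outcome_prob n d \<rho> C z)))
     else (\<lambda>a a'. of_bool (a = 0 \<and> a' = 0)))"

lemma density_cond_state:
  assumes "i < n"
  shows "density_on {..<d} (cond_state C z i)"
proof (cases "i \<notin> C \<and> Re (outcome_prob n d \<rho> C z) \<noteq> 0")
  case True
  have d0: "d > 0" using d by simp
  let ?p = "Re (outcome_prob n d \<rho> C z)"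
  have p: "?p > 0" "outcome_prob n d \<rho> C z = of_real ?p" using outcome_prob_nonneg[OF psd d0, of C z] True by auto
  \<comment> \<open>Normalisation is written as a weighted sum with one term, so that
    \<open>psd_on_weighted_sum\<close> gives positivity.\<close>
  have eq: "cond_state C z i = (\<lambda>a a'. \<Sum>k\<in>{0::nat}. of_real (1 / ?p) * cond_mat n d \<rho> C z i a a')"
    using True by (simp add: cond_state_def)
  have "psd_on {..<d} (cond_state C z i)"
    unfolding eq using psd_cond_mat[OF psd d0 assms] True p(1) by (intro psd_on_weighted_sum) auto
  moreover have "mtrace {..<d} (cond_state C z i) = 1"
  proof -
    have "mtrace {..<d} (cond_state C z i) = mtrace {..<d} (cond_mat n d \<rho> C z i) / of_real ?p"
      using True by (simp add: mtrace_def cond_state_def sum_divide_distrib)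
    also have "\<dots> = outcome_prob n d \<rho> C z / of_real ?p" using True mtrace_cond_mat[OF assms, of C d \<rho> z] by simp
    also have "\<dots> = 1" using p by (metis divide_self less_irrefl of_real_eq_0_iff)
    finally show ?thesis .
  qed
  ultimately show ?thesis by (simp add: density_on_def)
next
  case False
  hence eq: "cond_state C z i = (\<lambda>a a'. of_bool (a = 0 \<and> a' = 0))" unfolding cond_state_def by (rule if_not_P)
  have "(\<Sum>x<d. \<Sum>y<d. cnj (v x) * cond_state C z i x y * v y) = of_real ((cmod (v 0))\<^sup>2)" for v
  proof -
    have "(\<Sum>x<d. \<Sum>y<d. cnj (v x) * cond_state C z i x y * v y)
        = (\<Sum>x<d. \<Sum>y<d. if y = 0 then if x = 0 then cnj (v 0) * v 0 else 0 else 0)"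
      by (intro sum.cong refl) (auto simp: eq)
    also have "\<dots> = (\<Sum>x<d. if x = 0 then cnj (v 0) * v 0 else 0)"
      using d by (intro sum.cong refl) simp
    also have "\<dots> = cnj (v 0) * v 0" using d by simp
    finally have "(\<Sum>x<d. \<Sum>y<d. cnj (v x) * cond_state C z i x y * v y) = cnj (v 0) * v 0" .
    thus ?thesis by (simp only: cnj_mult_self)
  qed
  moreover have "mtrace {..<d} (cond_state C z i) = 1"
    using d by (simp add: mtrace_def eq)
  ultimately show ?thesis by (simp add: density_on_def psd_on_def del: of_real_power)
qed

definition sep_state :: "nat set \<Rightarrow> (nat \<Rightarrow> nat) \<Rightarrow> (nat \<Rightarrow> nat) \<Rightarrow> complex" where
  "sep_state C = mixture n d (PiE C (\<lambda>_. outcomes d)) (\<lambda>z. Re (outcome_prob n d \<rho> C z)) (cond_state C)"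

context
  fixes C assumes C: "C \<subseteq> {..<n}"
begin

lemma finite_results: "finite (PiE C (\<lambda>_. outcomes d))"
  using C finite_subset by (intro finite_PiE) auto

lemma results_total: "(\<Sum>z\<in>PiE C (\<lambda>_. outcomes d). Re (outcome_prob n d \<rho> C z)) = 1"
  using arg_cong[OF outcome_prob_total[OF C, of d \<rho>], of Re] tr by simp

lemma results_nonneg: "Re (outcome_prob n d \<rho> C z) \<ge> 0"
  using outcome_prob_nonneg(2)[OF psd] d by simp

lemma glob_separable_sep_state: "glob_separable n d (sep_state C)"
  unfolding sep_state_def
  by (intro glob_separable_mixture finite_results results_total results_nonneg density_cond_state)

lemma reduced_sep_state:
  assumes "i < n" "j < n" "i \<noteq> j" "u \<in> pairs d" "v \<in> pairs d"
  shows "reduced n d (sep_state C) i j u v = (\<Sum>z\<in>PiE C (\<lambda>_. outcomes d). of_real (Re (outcome_prob n d \<rho> C z)) *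
     (cond_state C z i (fst u) (fst v) * cond_state C z j (snd u) (snd v)))"
  unfolding sep_state_def
  using density_cond_state by (intro reduced_mixture assms) (auto simp: density_on_def)

lemma psd_reduced_sep_state:
  assumes "i < n" "j < n" "i \<noteq> j"
  shows "psd_on (pairs d) (reduced n d (sep_state C) i j)"
    and "mtrace (pairs d) (reduced n d (sep_state C) i j) = 1"
proof -
  let ?T = "\<lambda>z u v. cond_state C z i (fst u) (fst v) * cond_state C z j (snd u) (snd v)"
  have dens: "density_on {..<d} (cond_state C z i)" "density_on {..<d} (cond_state C z j)" for z
    using assms by (auto intro: density_cond_state)
  have "psd_on (pairs d) (\<lambda>u v. \<Sum>z\<in>PiE C (\<lambda>_. outcomes d). of_real (Re (outcome_prob n d \<rho> C z)) * ?T z u v)"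
    using dens by (intro psd_on_weighted_sum results_nonneg psd_tensor) (auto simp: density_on_def)
  thus "psd_on (pairs d) (reduced n d (sep_state C) i j)"
    by (simp add: psd_on_def reduced_sep_state assms)
  have "mtrace (pairs d) (?T z) = 1" for z
    using dens[of z] by (simp add: mtrace_def sum_pairs density_on_def flip: sum_product)
  moreover have "mtrace (pairs d) (reduced n d (sep_state C) i j)
     = (\<Sum>z\<in>PiE C (\<lambda>_. outcomes d). of_real (Re (outcome_prob n d \<rho> C z)) * mtrace (pairs d) (?T z))"
    unfolding mtrace_def sum_distrib_left
    by (subst sum.swap) (simp add: reduced_sep_state assms)
  ultimately show "mtrace (pairs d) (reduced n d (sep_state C) i j) = 1"
    using arg_cong[OF results_total, of complex_of_real] by simp
qed

lemma edge_witness: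
  assumes "i < n" "j < n" "i \<noteq> j"
  obtains W where "contraction (pairs d) W"
    "trace_norm (pairs d) (\<lambda>u v. reduced n d \<rho> i j u v - reduced n d (sep_state C) i j u v)
     = Re (trace_prod (pairs d) W (\<lambda>u v. reduced n d \<rho> i j u v - reduced n d (sep_state C) i j u v))"
proof -
  have fin: "finite (pairs d)" by (simp add: pairs_def)
  have d0: "d > 0" using d by simp
  have "herm_on (pairs d) (\<lambda>u v. reduced n d \<rho> i j u v - reduced n d (sep_state C) i j u v)"
    using psd_on_imp_herm_on[OF psd_reduced[OF psd assms d0] fin]
      psd_on_imp_herm_on[OF psd_reduced_sep_state(1)[OF assms] fin]
    unfolding herm_on_def by (metis complex_cnj_diff)
  thus ?thesis using trace_norm_witness fin that by blast
qed

lemma edge_bound_trivial: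
  assumes "i < n" "j < n" "i \<noteq> j"
  shows "trace_norm (pairs d) (\<lambda>u v. reduced n d \<rho> i j u v - reduced n d (sep_state C) i j u v) \<le> 2"
proof -
  have fin: "finite (pairs d)" by (simp add: pairs_def)
  have d0: "d > 0" using d by simp
  obtain W where W: "contraction (pairs d) W"
    "trace_norm (pairs d) (\<lambda>u v. reduced n d \<rho> i j u v - reduced n d (sep_state C) i j u v)
     = Re (trace_prod (pairs d) W (\<lambda>u v. reduced n d \<rho> i j u v - reduced n d (sep_state C) i j u v))"
    using edge_witness[OF assms] .
  have "cmod (trace_prod (pairs d) W (reduced n d \<rho> i j)) \<le> 1"
    using contraction_psd_bound[OF W(1) psd_reduced[OF psd assms d0] fin] by (simp add: mtrace_reduced assms tr)
  moreover have "cmod (trace_prod (pairs d) W (reduced n d (sep_state C) i j)) \<le> 1"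
    using contraction_psd_bound[OF W(1) psd_reduced_sep_state(1)[OF assms] fin] by (simp add: psd_reduced_sep_state(2) assms)
  ultimately have "Re (trace_prod (pairs d) W (reduced n d \<rho> i j)) \<le> 1" "- Re (trace_prod (pairs d) W (reduced n d (sep_state C) i j)) \<le> 1"
    using complex_Re_le_cmod abs_Re_le_cmod by (smt (verit, best))+
  thus ?thesis unfolding W(2) trace_prod_diff by simp
qed

text \<open>Summing \<open>cond_mat2\<close> over all outcomes restores the reduced state of
  \<open>\<rho>\<close>, so the difference of the reduced states is a sum of conditional
  correlations. A single witness \<open>W\<close> for the whole difference then serves every
  outcome.\<close>

lemma edge_bound_entropy:
  assumes ij: "i < n" "j < n" "i \<noteq> j" "i \<notin> C" "j \<notin> C" and c: "c > 0"
  shows "trace_norm (pairs d) (\<lambda>u v. reduced n d \<rho> i j u v - reduced n d (sep_state C) i j u v)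
    \<le> (real d + 1) * (c + (cond_ent n d \<rho> C i - cond_ent n d \<rho> (insert j C) i) / c)"
proof -
  have d0: "d > 0" using d by simp
  let ?Z = "PiE C (\<lambda>_. outcomes d)"
  let ?\<xi> = "\<lambda>z u v. cond_mat2 n d \<rho> C z i j u v - cond_mat n d \<rho> C z i (fst u) (fst v) * cond_mat n d \<rho> C z j (snd u) (snd v) / of_real (Re (outcome_prob n d \<rho> C z))"
  obtain W where W: "contraction (pairs d) W"
    "trace_norm (pairs d) (\<lambda>u v. reduced n d \<rho> i j u v - reduced n d (sep_state C) i j u v)
     = Re (trace_prod (pairs d) W (\<lambda>u v. reduced n d \<rho> i j u v - reduced n d (sep_state C) i j u v))"
    using edge_witness[OF ij(1-3)] .
  have "reduced n d \<rho> i j u v - reduced n d (sep_state C) i j u v = (\<Sum>z\<in>?Z. ?\<xi> z u v)"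
    if uv: "u \<in> pairs d" "v \<in> pairs d" for u v
  proof -
    let ?A = "(\<lambda>_. idm)(i := unit_mat (fst u) (fst v), j := unit_mat (snd u) (snd v))"
    have "(\<lambda>k. if k \<in> C then idm else ?A k) = ?A" using ij by (auto simp: fun_eq_iff)
    hence "(\<Sum>z\<in>?Z. cond_mat2 n d \<rho> C z i j u v) = reduced n d \<rho> i j u v"
      unfolding cond_mat2_def reduced_eq_tensor_trace[OF ij(1-3) uv]
      using tensor_trace_measured_total[OF finite_subset[OF C finite_lessThan] C, of d \<rho> ?A] by simp
    \<comment> \<open>For an outcome of probability 0 both sides are 0, the right one by the
      convention on division, so the placeholder state does not show.\<close>
    moreover have "of_real (Re (outcome_prob n d \<rho> C z)) * (cond_state C z i (fst u) (fst v) * cond_state C z j (snd u) (snd v))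
       = cond_mat n d \<rho> C z i (fst u) (fst v) * cond_mat n d \<rho> C z j (snd u) (snd v) / of_real (Re (outcome_prob n d \<rho> C z))" for z
      using ij by (simp add: cond_state_def)
    ultimately show ?thesis
      by (simp add: sum_subtractf reduced_sep_state[OF ij(1-3) uv])
  qed
  hence "trace_prod (pairs d) W (\<lambda>u v. reduced n d \<rho> i j u v - reduced n d (sep_state C) i j u v)
      = trace_prod (pairs d) W (\<lambda>u v. \<Sum>z\<in>?Z. ?\<xi> z u v)"
    by (rule trace_prod_cong)
  also have "\<dots> = (\<Sum>z\<in>?Z. trace_prod (pairs d) W (?\<xi> z))" by (rule trace_prod_sum)
  finally have eq: "trace_prod (pairs d) W (\<lambda>u v. reduced n d \<rho> i j u v - reduced n d (sep_state C) i j u v)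
      = (\<Sum>z\<in>?Z. trace_prod (pairs d) W (?\<xi> z))" .
  show ?thesis
    unfolding W(2) eq by (rule order.trans[OF complex_Re_le_cmod good_edge_bound[OF rho d0 ij(1,2,4,5,3) C W(1) c]])
qed

text \<open>An edge meeting \<open>C\<close> gets the trivial bound 2, any other edge the entropy
  bound. The total of the drops is at most \<open>n * lam\<close> whatever \<open>D\<close> is,
  which is where many edges per site pay off.\<close>

lemma sum_edge_bound:
  fixes lam :: real
  assumes c: "c > 0"
    and good: "\<And>j. j < n \<Longrightarrow> j \<notin> C \<Longrightarrow> (\<Sum>i\<in>{..<n} - insert j C. cond_ent n d \<rho> C i - cond_ent n d \<rho> (insert j C) i) \<le> lam"
    and lam: "lam \<ge> 0"
  shows "(\<Sum>(i, j)\<in>edges. trace_norm (pairs d) (\<lambda>u v. reduced n d \<rho> i j u v - reduced n d (sep_state C) i j u v))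
    \<le> 4 * real D * card C + real D * n * ((real d + 1) * c) + (real d + 1) / c * (n * lam)"
proof -
  have d0: "d > 0" using d by simp
  \<comment> \<open>The drop is set to 0 on the diagonal and for pairs meeting \<open>C\<close>, so
    that \<open>g\<close> is nonnegative on all pairs of sites.\<close>
  define g where "g = (\<lambda>i j. if i \<notin> C \<and> j \<notin> C \<and> i \<noteq> j then cond_ent n d \<rho> C i - cond_ent n d \<rho> (insert j C) i else 0)"
  have g0: "g i j \<ge> 0" if "i < n" "j < n" for i j
    using cond_ent_insert_le[OF psd d0 that] by (auto simp: g_def)
  have indC: "(\<Sum>i<n. of_bool (i \<in> C) :: real) = card C"
  proof -
    have "{..<n} \<inter> C = C" using C by auto
    thus ?thesis by simp
  qed
  have each: "trace_norm (pairs d) (\<lambda>u v. reduced n d \<rho> i j u v - reduced n d (sep_state C) i j u v)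
     \<le> 2 * of_bool (i \<in> C) + 2 * of_bool (j \<in> C) + (real d + 1) * c + (real d + 1) / c * g i j" (is "?t \<le> _")
    if "(i, j) \<in> edges" for i j
  proof -
    have ij: "i < n" "j < n" "i \<noteq> j" using that E_less E_irrefl by (auto simp: edges_def)
    show ?thesis
    proof (cases "i \<in> C \<or> j \<in> C")
      case True
      have "?t \<le> 2" by (rule edge_bound_trivial[OF ij])
      moreover have "0 \<le> (real d + 1) * c" "0 \<le> (real d + 1) / c * g i j" using c g0[OF ij(1,2)] by auto
      ultimately show ?thesis using True by auto
    next
      case False
      thus ?thesis using edge_bound_entropy[OF ij _ _ c] ij by (simp add: g_def distrib_left)
    qed
  qed
  \<comment> \<open>Edges are enlarged to all ordered pairs because the minimality of
    \<open>C\<close> controls, for each \<open>j\<close>, the sum over all \<open>i\<close>.\<close>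
  have "(\<Sum>(i, j)\<in>edges. g i j) \<le> (\<Sum>(i, j)\<in>{..<n} \<times> {..<n}. g i j)"
    using g0 E_less by (intro sum_mono2) (auto simp: edges_def)
  also have "\<dots> = (\<Sum>j<n. \<Sum>i<n. g i j)"
    unfolding sum.cartesian_product[symmetric] by (rule sum.swap)
  also have "\<dots> \<le> (\<Sum>j<n. lam)"
  proof (intro sum_mono)
    fix j assume j: "j \<in> {..<n}"
    show "(\<Sum>i<n. g i j) \<le> lam"
    proof (cases "j \<in> C")
      case True
      thus ?thesis using lam by (simp add: g_def)
    next
      case False
      have "(\<Sum>i<n. g i j) = (\<Sum>i\<in>{..<n} - insert j C. cond_ent n d \<rho> C i - cond_ent n d \<rho> (insert j C) i)"
        using False by (intro sum.mono_neutral_cong_right) (auto simp: g_def)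
      thus ?thesis using good[of j] j False by simp
    qed
  qed
  finally have G: "(\<Sum>(i, j)\<in>edges. g i j) \<le> n * lam" by simp
  have "(\<Sum>(i, j)\<in>edges. trace_norm (pairs d) (\<lambda>u v. reduced n d \<rho> i j u v - reduced n d (sep_state C) i j u v))
     \<le> (\<Sum>(i, j)\<in>edges. 2 * of_bool (i \<in> C) + 2 * of_bool (j \<in> C) + (real d + 1) * c + (real d + 1) / c * g i j)"
    using each by (intro sum_mono) auto
  also have "\<dots> = 2 * (\<Sum>(i, j)\<in>edges. of_bool (i \<in> C)) + 2 * (\<Sum>(i, j)\<in>edges. of_bool (j \<in> C))
      + card edges * ((real d + 1) * c) + (real d + 1) / c * (\<Sum>(i, j)\<in>edges. g i j)"
    by (simp add: case_prod_unfold sum.distrib sum_distrib_left)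
  also have "\<dots> = 4 * real D * card C + real D * n * ((real d + 1) * c) + (real d + 1) / c * (\<Sum>(i, j)\<in>edges. g i j)"
    unfolding sum_edges_swap sum_edges indC card_edges by simp
  also have "\<dots> \<le> 4 * real D * card C + real D * n * ((real d + 1) * c) + (real d + 1) / c * (n * lam)"
    using G c by (intro add_left_mono mult_left_mono) auto
  finally show ?thesis .
qed

end

theorem approximation:
  "\<exists>\<sigma>. glob_separable n d \<sigma> \<and>
    (\<Sum>(i, j)\<in>edges. trace_norm (pairs d) (\<lambda>u v. reduced n d \<rho> i j u v - reduced n d \<sigma> i j u v)) / real (card edges)
    \<le> 12 * (real d ^ 2 * ln (real d) / real D) powr (1 / 3)"
proof -
  have d0: "d > 0" using d by simp
  define L where "L = ln (real d)"
  have L: "L > 0" using d by (simp add: L_def)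
  define \<kappa> where "\<kappa> = (real d ^ 2 * L / real D) powr (1 / 3)"
  have base: "real d ^ 2 * L / real D > 0" using L D d0 by simp
  hence \<kappa>: "\<kappa> > 0" unfolding \<kappa>_def by (metis less_irrefl powr_gt_zero)
  have "B > 0 \<Longrightarrow> (B powr (1 / 3)) ^ 3 = B" for B :: real
    by (simp add: powr_powr flip: powr_numeral)
  from this[OF base] have "\<kappa> ^ 3 = real d ^ 2 * L / real D" unfolding \<kappa>_def .
  hence \<kappa>3: "\<kappa> ^ 3 * real D = real d ^ 2 * L" using D by (simp add: field_simps)
  \<comment> \<open>With this penalty, \<open>lam * card C \<le> n * ln d\<close> reads
    \<open>card C \<le> \<kappa> * n\<close>.\<close>
  define lam where "lam = L / \<kappa>"
  have lam: "lam > 0" using L \<kappa> by (simp add: lam_def)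
  \<comment> \<open>Makes both parts of the entropy bound, \<open>(d + 1) * c\<close> and
    \<open>(d + 1) / c * lam / D\<close>, at most \<open>3 / 2 * \<kappa>\<close>. The factor 3/2
    comes from \<open>d + 1 \<le> 3 / 2 * d\<close>, valid for \<open>d \<ge> 2\<close>.\<close>
  define c where "c = 3 / 2 * \<kappa> / (real d + 1)"
  have c: "c > 0" using \<kappa> by (simp add: c_def)
  obtain C where C: "C \<subseteq> {..<n}" "lam * card C \<le> n * ln d"
    "\<And>j. j < n \<Longrightarrow> j \<notin> C \<Longrightarrow> (\<Sum>i\<in>{..<n} - insert j C. cond_ent n d \<rho> C i - cond_ent n d \<rho> (insert j C) i) \<le> lam"
    using exists_good_sites[OF rho d0 lam] by blast
  let ?T = "\<Sum>(i, j)\<in>edges. trace_norm (pairs d) (\<lambda>u v. reduced n d \<rho> i j u v - reduced n d (sep_state C) i j u v)"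
  have T: "?T \<le> 4 * real D * card C + real D * n * ((real d + 1) * c) + (real d + 1) / c * (n * lam)"
    using lam by (intro sum_edge_bound C c) auto
  have "L * card C \<le> L * (n * \<kappa>)" using C(2) \<kappa> by (simp add: lam_def L_def field_simps)
  hence 1: "4 * real D * card C \<le> 4 * real D * (n * \<kappa>)" using L by (intro mult_left_mono) auto
  have cancel: "m > 0 \<Longrightarrow> m * (a / m) = a" for a m :: real by simp
  have 2: "(real d + 1) * c = 3 / 2 * \<kappa>" unfolding c_def by (rule cancel) simp
  have 3: "(real d + 1) / c * (n * lam) \<le> 3 / 2 * \<kappa> * (real D * n)"
  proof -
    have "real d + 1 \<le> 3 / 2 * real d" using d by simp
    hence "(real d + 1)\<^sup>2 \<le> (3 / 2 * real d)\<^sup>2" by (intro power_mono) auto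
    hence "(real d + 1)\<^sup>2 * L \<le> (3 / 2 * real d)\<^sup>2 * L" using L by (intro mult_right_mono) auto
    also have "\<dots> = 9 / 4 * (\<kappa> ^ 3 * real D)" unfolding \<kappa>3 by (simp add: power2_eq_square)
    finally have *: "(real d + 1)\<^sup>2 * L \<le> 9 / 4 * (\<kappa> ^ 3 * real D)" .
    have rearrange: "m > 0 \<Longrightarrow> m / (3 / 2 * \<kappa> / m) * (N * (L / \<kappa>)) = (m\<^sup>2 * L) * N / (3 / 2 * \<kappa>\<^sup>2)" for m N :: real
      using \<kappa> by (simp add: power2_eq_square field_simps)
    have "(real d + 1) / c * (n * lam) = ((real d + 1)\<^sup>2 * L) * n / (3 / 2 * \<kappa>\<^sup>2)"
      unfolding c_def lam_def by (rule rearrange) simp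
    also have "\<dots> \<le> (9 / 4 * (\<kappa> ^ 3 * real D)) * n / (3 / 2 * \<kappa>\<^sup>2)"
      using * by (intro divide_right_mono mult_right_mono) auto
    also have "\<dots> = 3 / 2 * \<kappa> * (real D * n)"
      using \<kappa> by (simp add: power2_eq_square power3_eq_cube)
    finally show ?thesis .
  qed
  have "?T \<le> 7 * \<kappa> * (real D * n)"
  proof -
    have "4 * real D * (n * \<kappa>) + real D * n * (3 / 2 * \<kappa>) + 3 / 2 * \<kappa> * (real D * n) = 7 * \<kappa> * (real D * n)"
      by (simp add: algebra_simps)
    thus ?thesis using T 1 3 unfolding 2 by linarith
  qed
  also have "\<dots> \<le> 12 * \<kappa> * (real D * n)" using \<kappa> by (intro mult_right_mono) auto
  finally have "?T \<le> 12 * \<kappa> * card edges" unfolding card_edges .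
  \<comment> \<open>Without vertices there are no edges, and the quotient is 0 by
    convention.\<close>
  hence "?T / card edges \<le> 12 * \<kappa>"
    using \<kappa> by (cases "card edges = 0") (auto simp: divide_le_eq)
  thus ?thesis using glob_separable_sep_state[OF C(1)] by (auto simp: \<kappa>_def L_def)
qed

end

theorem theorem3:
  fixes d D n :: nat
    and E :: "nat \<Rightarrow> nat \<Rightarrow> bool"
    and \<rho> :: "(nat \<Rightarrow> nat) \<Rightarrow> (nat \<Rightarrow> nat) \<Rightarrow> complex"
  assumes "d \<ge> 2" and "D \<ge> 1"
    and "\<forall>i j. E i j \<longrightarrow> i < n \<and> j < n"
    and "\<forall>i j. E i j \<longrightarrow> E j i"
    and "\<forall>i. \<not> E i i"
    and "\<forall>i<n. card {j. E i j} = D"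
    and "density_on (cfg n d) \<rho>"
  shows "\<exists>\<sigma>. glob_separable n d \<sigma> \<and>
    (\<Sum>(i, j)\<in>{(i, j). E i j}.
        trace_norm (pairs d) (\<lambda>u v. reduced n d \<rho> i j u v - reduced n d \<sigma> i j u v))
      / real (card {(i, j). E i j})
    \<le> 12 * (real d ^ 2 * ln (real d) / real D) powr (1 / 3)"
proof -
  interpret regular_graph_state d D n E \<rho>
    using assms by unfold_locales auto
  show ?thesis using approximation unfolding edges_def .
qed

end
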